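(* Let $D$ be one of the following (non-rectangular) planar domains: \begin{itemize} \item (elliptic) $\mathcal{E}=\{(x,y)\in\mathbb{R}^2:(x/a)^2+(y/b)^2<1\}$ with $a,b>0$, $a\neq b$; \item (parabolic) $\mathcal{P}=\{(x,y)\in\mathbb{R}^2:y>cx^2\}$ with $c>0$; \item (hyperbolic) $\mathcal{H}=\{(x,y)\in\mathbb{R}^2:\frac{x^2}{a^2}-\frac{y^2}{b^2}>1,\ x>a\}$ with $a,b>0$, $a>(1+\sqrt{2})b$; \item (wedge) $\mathcal{W}=\{re^{i\theta}:0<r<\infty,\ -\frac{\alpha}{2}<\theta<\frac{\alpha}{2}\}$ with $0<\alpha<\frac{\pi}{4}$ (where $\mathbb{C}$ is identified with $\mathbb{R}^2$); \item (equilateral triangle) $\mathcal{T}=\{(x,y)\in\mathbb{R}^2:-\frac{b}{\sqrt3}<x<\frac{b}{\sqrt3},\ 0<y<b-\sqrt{3}|x|\}$ with $b>0$. \end{itemize} Suppose that for some positive constants $c_1,c_2$ the level curves $\{(x,y)\in D:\mathbb{E}^{(x,y)}[\tau_D]=c_1\}$ and $\{(x,y)\in D:\mathbb{E}^{(x,y)}[\tau_D^2]=c_2\}$ intersect (i.e. have nonempty intersection). Then: \begin{enumerate} \item If $D=\mathcal{E}$, the level curves intersect at either exactly four points, exactly two points, or exactly one point, determined by $c_1$ and $c_2$. \item If $D=\mathcal{P}$, $\mathcal{H}$ or $\mathcal{W}$, the level curves intersect at either exactly two points or exactly one point, determined by $c_1$ and $c_2$. \item If $D=\mathcal{T}$,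 the level curves intersect at either exactly six points, exactly three points, or exactly one point, determined by $c_1$ and $c_2$. \end{enumerate} Moreover, if $\mathcal{R}=\{(x,y)\in\mathbb{R}^2:0<x<a,\ 0<y<b\}$ with $a,b>0$, $a\neq b$, and $(c_k)_{k\geq 1}$ are positive numbers such that the level curves $\{(x,y)\in\mathcal{R}:\mathbb{E}^{(x,y)}[\tau_{\mathcal{R}}^k]=c_k\}$, $k\geq1$, have a common point, then the intersection of all of them over $k\ge 1$ consists of exactly one, two, or four points, determined by the values $c_k$.
   Context: For a planar domain $D\subseteq\mathbb{R}^2$ and $(x,y)\in D$, let $X_t$ be planar Brownian motion with continuous paths started at $(x,y)$, normalized so that its generator is $\Delta$ (i.e. $X_t=(x,y)+\sqrt{2}B_t$ with $B_t$ standard planar Brownian motion). Its first exit time from $D$ is $\tau_D=\inf\{t\geq0:X_t\notin D\}$, and $\mathbb{E}^{(x,y)}[\tau_D^k]$ ($k\geq1$) denotes the $k$th moment of $\tau_D$ for Brownian motion started at $(x,y)$. *)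

theory Defs
  imports "HOL-Probability.Probability"
begin

text \<open>Standard planar Brownian motion started at the origin, with time set the nonnegative reals;
  the values of \<open>B\<close> at negative times are irrelevant. The density below is that of the
  centred Gaussian law on the plane with covariance matrix \<open>(t - s) I\<close>.\<close>

locale planar_brownian_motion = prob_space M
  for M :: "'w measure" and B :: "real \<Rightarrow> 'w \<Rightarrow> real \<times> real" +
  assumes measurable_at: "0 \<le> t \<Longrightarrow> B t \<in> borel_measurable M"
    and starts_at_origin: "\<omega> \<in> space M \<Longrightarrow> B 0 \<omega> = 0"
    and continuous_paths: "\<omega> \<in> space M \<Longrightarrow> continuous_on {0..} (\<lambda>t. B t \<omega>)"
    and gaussian_increments: "0 \<le> s \<Longrightarrow> s < t \<Longrightarrow>
      distributed M lborel (\<lambda>\<omega>. B t \<omega> - B s \<omega>)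
        (\<lambda>(u, v). ennreal (normal_density 0 (sqrt (t - s)) u * normal_density 0 (sqrt (t - s)) v))"
    and independent_increments: "0 \<le> r 0 \<Longrightarrow> (\<And>i. i < n \<Longrightarrow> r i < r (Suc i)) \<Longrightarrow>
      indep_vars (\<lambda>_. borel) (\<lambda>i \<omega>. B (r (Suc i)) \<omega> - B (r i) \<omega>) {..<(n::nat)}"

text \<open>The factor \<open>sqrt 2\<close> makes the Laplacian (rather than half of it) the generator.\<close>

definition started_at :: "real \<times> real \<Rightarrow> (real \<Rightarrow> 'w \<Rightarrow> real \<times> real) \<Rightarrow> real \<Rightarrow> 'w \<Rightarrow> real \<times> real"
  where "started_at p B t \<omega> = p + sqrt 2 *\<^sub>R B t \<omega>"

text \<open>The infimum of the empty set is infinity in \<^typ>\<open>ennreal\<close>, so paths that never leave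
  the domain have infinite exit time.\<close>

definition exit_time :: "(real \<times> real) set \<Rightarrow> (real \<Rightarrow> 'w \<Rightarrow> real \<times> real) \<Rightarrow> 'w \<Rightarrow> ennreal"
  where "exit_time D X \<omega> = (INF t \<in> {t. 0 \<le> t \<and> X t \<omega> \<notin> D}. ennreal t)"

definition exit_moment ::
    "'w measure \<Rightarrow> (real \<Rightarrow> 'w \<Rightarrow> real \<times> real) \<Rightarrow> (real \<times> real) set \<Rightarrow> nat \<Rightarrow> real \<times> real \<Rightarrow> ennreal"
  where "exit_moment M B D k p = (\<integral>\<^sup>+ \<omega>. exit_time D (started_at p B) \<omega> ^ k \<partial>M)"

definition level_curve ::
    "'w measure \<Rightarrow> (real \<Rightarrow> 'w \<Rightarrow> real \<times> real) \<Rightarrow> (real \<times> real) set \<Rightarrow> nat \<Rightarrow> real \<Rightarrow> (real \<times> real) set"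
  where "level_curve M B D k c = {p \<in> D. exit_moment M B D k p = ennreal c}"

definition elliptic_domain :: "real \<Rightarrow> real \<Rightarrow> (real \<times> real) set"
  where "elliptic_domain a b = {(x, y). (x / a)\<^sup>2 + (y / b)\<^sup>2 < 1}"

definition parabolic_domain :: "real \<Rightarrow> (real \<times> real) set"
  where "parabolic_domain c = {(x, y). y > c * x\<^sup>2}"

definition hyperbolic_domain :: "real \<Rightarrow> real \<Rightarrow> (real \<times> real) set"
  where "hyperbolic_domain a b = {(x, y). x\<^sup>2 / a\<^sup>2 - y\<^sup>2 / b\<^sup>2 > 1 \<and> x > a}"

definition wedge_domain :: "real \<Rightarrow> (real \<times> real) set"
  where "wedge_domain \<alpha> =
    {(r * cos \<theta>, r * sin \<theta>) | r \<theta>. 0 < r \<and> - \<alpha> / 2 < \<theta> \<and> \<theta> < \<alpha> / 2}"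

definition triangular_domain :: "real \<Rightarrow> (real \<times> real) set"
  where "triangular_domain b =
    {(x, y). - b / sqrt 3 < x \<and> x < b / sqrt 3 \<and> 0 < y \<and> y < b - sqrt 3 * \<bar>x\<bar>}"

definition rectangular_domain :: "real \<Rightarrow> real \<Rightarrow> (real \<times> real) set"
  where "rectangular_domain a b = {(x, y). 0 < x \<and> x < a \<and> 0 < y \<and> y < b}"

end

(* Every function f(t, x, y) below that solves f_t + f_xx + f_yy = 0 and has polynomial growth is averaged exactly
   by Gaussian increments, so f(t, X_t) stopped at the exit time is a martingale. Stopping is done on dyadic
   time grids at the first grid time at which the walk is within epsilon of the complement; refining the grid
   and then letting epsilon tend to 0 reaches the exit time itself. A pathwise form of Doob's inequality
   supplies all the dominating functions.

   For the five non-rectangular domains both moments are polynomials, u1 = const * f and u2 = f * g, where f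
   is the defining function of the domain and g is quadratic. In the unbounded domains the stopped path is
   bounded in L^4 because Re z^4 is harmonic and comparable to |z|^4 there (for the hyperbola and the wedge
   this is what the angle conditions mean). Fixing the two moments fixes f and g: for the conics this is a
   linear system for (x^2, y^2), and for the triangle it fixes the elementary symmetric functions of the
   distances to the three sides.

   For the rectangle, sin * sin * exp gives P(tau > t) as the product of two sine series. The moments of order
   k, divided by k!, are then a sum of geometric sequences in k, whose two leading terms determine
   sin(pi x / a) sin(pi y / b) and, since a and b differ, sin(pi x / a) sin(3 pi y / b) (y along the longer side). *)
theory Submission
  imports Defs
begin

subsection \<open>Gaussian averages and caloric functions\<close>

text \<open>Ito's formula is replaced by the mean value property under Gaussian averages, and a
  filtration in continuous time by the increments on one dyadic grid. The epsilon is forced by the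
  grid: a walk seen only at grid times can step over a thin part of the complement, whereas a
  neighbourhood of the complement contains the positions at all grid times shortly after the true
  exit. In unbounded domains no bound on the path is available in advance, so exit times are cut off
  at an integer \<open>K\<close>; the harmonic quartic bounds the fourth moment at the cut-off exit
  uniformly in \<open>K\<close>, and one dominating function for all \<open>K\<close> follows.
  Integrability of the squared exit time is a consequence of this. "Determined by the values" means
  that the number of points is a function \<open>N\<close> chosen before the probability space.
  Every moment is therefore expressed without \<open>M\<close> and \<open>B\<close>; for the
  rectangle this is why the survival probability is identified with a limit of sine sums. Fourier
  partial sums of the constant 1 overshoot near the ends, whereas the binomial sums used instead
  stay between 0 and 1.\<close>

lemma power_add_le:
  fixes a b :: real
  assumes "0 \<le> a" "0 \<le> b"
  shows "(a + b) ^ n \<le> 2 ^ n * (a ^ n + b ^ n)"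
proof -
  have "(a + b) ^ n \<le> (2 * max a b) ^ n"
    using assms by (intro power_mono) auto
  also have "\<dots> = 2 ^ n * max a b ^ n"
    by (rule power_mult_distrib)
  also have "max a b ^ n \<le> a ^ n + b ^ n"
    using assms by (auto simp: max_def)
  finally show ?thesis by simp
qed

text \<open>Written as an image of the standard normal law, so that the moments and the
  characteristic function of that law apply after scaling.\<close>

definition gauss :: "real \<Rightarrow> real measure"
  where "gauss h = distr std_normal_distribution borel (\<lambda>z. sqrt h * z)"

definition gauss2 :: "real \<Rightarrow> (real \<times> real) measure"
  where "gauss2 h = gauss h \<Otimes>\<^sub>M gauss h"

lemma sets_gauss [measurable_cong, simp]: "sets (gauss h) = sets borel"
  by (simp add: gauss_def)

lemma sets_gauss2 [measurable_cong, simp]: "sets (gauss2 h) = sets borel"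
  unfolding gauss2_def borel_prod[symmetric] by (intro sets_pair_measure_cong) auto

lemma space_gauss [simp]: "space (gauss h) = UNIV"
  by (simp add: gauss_def)

lemma space_gauss2 [simp]: "space (gauss2 h) = UNIV"
  by (simp add: gauss2_def space_pair_measure)

lemma prob_space_gauss: "prob_space (gauss h)"
  unfolding gauss_def
  by (intro prob_space.prob_space_distr prob_space_normal_density) auto

lemma prob_space_gauss2: "prob_space (gauss2 h)"
proof -
  interpret g: prob_space "gauss h" by (rule prob_space_gauss)
  interpret pair_prob_space "gauss h" "gauss h" ..
  show ?thesis unfolding gauss2_def by unfold_locales
qed

lemma gauss_density:
  assumes "0 < h"
  shows "gauss h = density lborel (\<lambda>x. ennreal (normal_density 0 (sqrt h) x))"
proof -
  interpret prob_space std_normal_distribution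
    by (rule prob_space_normal_density) simp
  have "distributed std_normal_distribution lborel (\<lambda>x. x) std_normal_density"
    by (auto simp: distributed_def distr_id2)
  from normal_density_affine[OF this, of "sqrt h" 0] assms
  have "distributed std_normal_distribution lborel (\<lambda>x. sqrt h * x) (normal_density 0 (sqrt h))"
    by simp
  from distributed_distr_eq_density[OF this] show ?thesis
    by (simp add: gauss_def cong: distr_cong)
qed

lemma gauss2_density:
  assumes "0 < h"
  shows "gauss2 h = density lborel
    (\<lambda>(u, v). ennreal (normal_density 0 (sqrt h) u * normal_density 0 (sqrt h) v))"
proof -
  have sf: "sigma_finite_measure (density lborel (\<lambda>x. ennreal (normal_density 0 (sqrt h) x)))"
    using prob_space_gauss[of h] gauss_density[OF assms]
    by (metis prob_space_imp_sigma_finite)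
  have "gauss2 h = density (lborel \<Otimes>\<^sub>M lborel)
    (\<lambda>(u, v). ennreal (normal_density 0 (sqrt h) u) * ennreal (normal_density 0 (sqrt h) v))"
    unfolding gauss2_def gauss_density[OF assms]
    by (intro pair_measure_density sf) (auto intro: sigma_finite_lborel)
  also have "\<dots> = density lborel
    (\<lambda>(u, v). ennreal (normal_density 0 (sqrt h) u * normal_density 0 (sqrt h) v))"
    unfolding lborel_prod by (simp add: ennreal_mult')
  finally show ?thesis .
qed

lemma integral_gauss:
  fixes f :: "real \<Rightarrow> real"
  assumes "f \<in> borel_measurable borel"
  shows "integral\<^sup>L (gauss h) f = integral\<^sup>L std_normal_distribution (\<lambda>z. f (sqrt h * z))"
  unfolding gauss_def using assms by (subst integral_distr) auto

lemma integrable_gauss_iff: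
  fixes f :: "real \<Rightarrow> real"
  assumes "f \<in> borel_measurable borel"
  shows "integrable (gauss h) f \<longleftrightarrow> integrable std_normal_distribution (\<lambda>z. f (sqrt h * z))"
  unfolding gauss_def using assms by (subst integrable_distr_eq) auto

lemma integrable_gauss_abs_power: "integrable (gauss h) (\<lambda>x. \<bar>x\<bar> ^ n)"
proof -
  have "integrable std_normal_distribution (\<lambda>z. \<bar>z ^ n\<bar>)"
    by (intro integrable_abs integrable_std_normal_distribution_moment)
  then have "integrable std_normal_distribution (\<lambda>z. \<bar>sqrt h\<bar> ^ n * \<bar>z\<bar> ^ n)"
    by (simp add: power_abs)
  then show ?thesis
    by (subst integrable_gauss_iff) (auto simp: abs_mult power_mult_distrib)
qed

lemma integrable_gauss2_fst:
  fixes f :: "real \<Rightarrow> real"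
  assumes "integrable (gauss h) f"
  shows "integrable (gauss2 h) (\<lambda>w. f (fst w))" "integrable (gauss2 h) (\<lambda>w. f (snd w))"
proof -
  interpret g: prob_space "gauss h" by (rule prob_space_gauss)
  interpret pair_prob_space "gauss h" "gauss h" ..
  have [measurable]: "f \<in> borel_measurable borel"
    using borel_measurable_integrable[OF assms] by simp
  have "integrable (distr (gauss h \<Otimes>\<^sub>M gauss h) (gauss h) fst) f"
    using assms by (simp add: g.distr_pair_fst)
  then show 1: "integrable (gauss2 h) (\<lambda>w. f (fst w))"
    unfolding gauss2_def by (subst (asm) integrable_distr_eq) auto
  show "integrable (gauss2 h) (\<lambda>w. f (snd w))"
    using integrable_product_swap[OF 1[unfolded gauss2_def]]
    unfolding gauss2_def by (simp add: case_prod_unfold)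
qed

lemma integrable_gauss2_norm_power: "integrable (gauss2 h) (\<lambda>w. norm w ^ n)"
proof (rule Bochner_Integration.integrable_bound)
  show "integrable (gauss2 h) (\<lambda>w. 2 ^ n * (\<bar>fst w\<bar> ^ n + \<bar>snd w\<bar> ^ n))"
    by (rule integrable_mult_right, rule Bochner_Integration.integrable_add)
      (intro integrable_gauss2_fst[of h "\<lambda>x. \<bar>x\<bar> ^ n"] integrable_gauss_abs_power)+
  show "AE w in gauss2 h. norm (norm w ^ n) \<le> norm (2 ^ n * (\<bar>fst w\<bar> ^ n + \<bar>snd w\<bar> ^ n))"
  proof (intro AE_I2)
    fix w :: "real \<times> real"
    have "norm w ^ n \<le> (\<bar>fst w\<bar> + \<bar>snd w\<bar>) ^ n"
      using norm_Pair_le[of "fst w" "snd w"] by (intro power_mono) auto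
    also have "\<dots> \<le> 2 ^ n * (\<bar>fst w\<bar> ^ n + \<bar>snd w\<bar> ^ n)"
      by (rule power_add_le) auto
    finally show "norm (norm w ^ n) \<le> norm (2 ^ n * (\<bar>fst w\<bar> ^ n + \<bar>snd w\<bar> ^ n))"
      by simp
  qed
qed measurable

lemma integrable_gauss_bounded_growth:
  fixes f :: "real \<Rightarrow> real"
  assumes [measurable]: "f \<in> borel_measurable borel" and "\<And>u. \<bar>f u\<bar> \<le> K * (1 + \<bar>u\<bar>) ^ n"
  shows "integrable (gauss h) f"
proof (rule Bochner_Integration.integrable_bound)
  interpret prob_space "gauss h" by (rule prob_space_gauss)
  show "integrable (gauss h) (\<lambda>u. \<bar>K\<bar> * (2 ^ n * (1 + \<bar>u\<bar> ^ n)))"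
    by (rule integrable_mult_right, rule integrable_mult_right, rule Bochner_Integration.integrable_add)
      (simp, rule integrable_gauss_abs_power)
  show "AE u in gauss h. norm (f u) \<le> norm (\<bar>K\<bar> * (2 ^ n * (1 + \<bar>u\<bar> ^ n)))"
  proof (intro AE_I2)
    fix u
    have "\<bar>f u\<bar> \<le> \<bar>K\<bar> * (1 + \<bar>u\<bar>) ^ n"
      using assms(2)[of u] by (rule order_trans) (auto intro!: mult_right_mono)
    also have "(1 + \<bar>u\<bar>) ^ n \<le> 2 ^ n * (1 + \<bar>u\<bar> ^ n)"
      using power_add_le[of 1 "\<bar>u\<bar>" n] by simp
    finally show "norm (f u) \<le> norm (\<bar>K\<bar> * (2 ^ n * (1 + \<bar>u\<bar> ^ n)))"
      by (simp add: mult_left_mono)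
  qed
qed measurable

lemma integral_gauss2_prod:
  fixes f g :: "real \<Rightarrow> real"
  assumes f: "integrable (gauss h) f" and g: "integrable (gauss h) g"
  shows "integrable (gauss2 h) (\<lambda>(u, v). f u * g v)"
    and "(\<integral>(u, v). f u * g v \<partial>gauss2 h) = integral\<^sup>L (gauss h) f * integral\<^sup>L (gauss h) g"
proof -
  interpret ga: prob_space "gauss h" by (rule prob_space_gauss)
  interpret pair_prob_space "gauss h" "gauss h" ..
  have [measurable]: "f \<in> borel_measurable borel" "g \<in> borel_measurable borel"
    using borel_measurable_integrable[OF f] borel_measurable_integrable[OF g] by simp_all
  show 1: "integrable (gauss2 h) (\<lambda>(u, v). f u * g v)"
    unfolding gauss2_def
  proof (rule Fubini_integrable)
    show "integrable (gauss h) (\<lambda>x. LINT y|gauss h. norm (case (x, y) of (u, v) \<Rightarrow> f u * g v))"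
      using f by (simp add: abs_mult)
  qed (use g in simp_all)
  show "(\<integral>(u, v). f u * g v \<partial>gauss2 h) = integral\<^sup>L (gauss h) f * integral\<^sup>L (gauss h) g"
    using integral_fst'[OF 1[unfolded gauss2_def]] by (simp add: gauss2_def)
qed

section \<open>Functions with the Gaussian mean value property\<close>

text \<open>The backward heat equation \<open>g_t + g_xx = 0\<close> in integrated form: averaging
  over a Gaussian step of length \<open>h\<close> moves the time argument from \<open>t + h\<close>
  back to \<open>t\<close>. The exponent 8 leaves room for the degrees that occur, and the growth
  bound is asked on bounded time intervals only, because exponentials in \<open>t\<close>
  occur.\<close>

definition caloric1 :: "(real \<Rightarrow> real \<Rightarrow> real) \<Rightarrow> bool"
  where "caloric1 g \<longleftrightarrow> continuous_on UNIV (\<lambda>(t, x). g t x) \<and>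
    (\<forall>T. \<exists>K. \<forall>t\<in>{0..T}. \<forall>x. \<bar>g t x\<bar> \<le> K * (1 + \<bar>x\<bar>) ^ 8) \<and>
    (\<forall>t\<ge>0. \<forall>h>0. \<forall>x. (\<integral>u. g (t + h) (x + sqrt 2 * u) \<partial>gauss h) = g t x)"

text \<open>The exponent is \<open>16 = 8 + 8\<close> for products of two one-dimensional factors,
  and also \<open>4 * Suc 3\<close>, the shape of the powers controlled by the maximal
  inequality.\<close>

definition caloric :: "(real \<Rightarrow> real \<times> real \<Rightarrow> real) \<Rightarrow> bool"
  where "caloric f \<longleftrightarrow> continuous_on UNIV (\<lambda>(t, z). f t z) \<and>
    (\<forall>T. \<exists>K. \<forall>t\<in>{0..T}. \<forall>z. \<bar>f t z\<bar> \<le> K * (1 + norm z) ^ 16) \<and>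
    (\<forall>t\<ge>0. \<forall>h>0. \<forall>z. (\<integral>w. f (t + h) (z + sqrt 2 *\<^sub>R w) \<partial>gauss2 h) = f t z)"

lemma caloric_measurable:
  assumes "caloric f"
  shows "(\<lambda>(t, z). f t z) \<in> borel_measurable borel" "f t \<in> borel_measurable borel"
proof -
  show *: "(\<lambda>(t, z). f t z) \<in> borel_measurable borel"
    using assms by (intro borel_measurable_continuous_onI) (auto simp: caloric_def)
  have "(\<lambda>z. case_prod f (t, z)) \<in> borel_measurable borel"
    using * by (rule measurable_compose[rotated]) simp
  then show "f t \<in> borel_measurable borel"
    by simp
qed

lemma caloric_mean:
  "caloric f \<Longrightarrow> 0 \<le> t \<Longrightarrow> 0 < h \<Longrightarrow> (\<integral>w. f (t + h) (z + sqrt 2 *\<^sub>R w) \<partial>gauss2 h) = f t z"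
  unfolding caloric_def by blast

lemma caloric1_measurable:
  assumes "caloric1 g"
  shows "g t \<in> borel_measurable borel"
proof -
  have "(\<lambda>(t, z). g t z) \<in> borel_measurable borel"
    using assms by (intro borel_measurable_continuous_onI) (auto simp: caloric1_def)
  then have "(\<lambda>z. case_prod g (t, z)) \<in> borel_measurable borel"
    by (rule measurable_compose[rotated]) simp
  then show ?thesis
    by simp
qed

lemma growth_shift:
  fixes a u :: real
  assumes "0 \<le> a" "0 \<le> u"
  shows "(1 + (a + sqrt 2 * u)) ^ n \<le> ((1 + a) * sqrt 2) ^ n * (1 + u) ^ n"
proof -
  have "1 \<le> sqrt (2::real)" "0 \<le> a * (sqrt 2 * u)" "a * 1 \<le> a * sqrt 2"
    using assms by (simp, simp, intro mult_left_mono) auto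
  then have "1 + a + (sqrt 2 * u) \<le> sqrt 2 + a * sqrt 2 + a * (sqrt 2 * u) + sqrt 2 * u"
    by linarith
  then have "1 + (a + sqrt 2 * u) \<le> (1 + a) * sqrt 2 * (1 + u)"
    by (simp add: algebra_simps)
  then have "(1 + (a + sqrt 2 * u)) ^ n \<le> ((1 + a) * sqrt 2 * (1 + u)) ^ n"
    using assms by (intro power_mono) auto
  then show ?thesis
    by (simp only: power_mult_distrib)
qed

lemma caloric1_integrable:
  assumes "caloric1 g" "0 \<le> t"
  shows "integrable (gauss h) (\<lambda>u. g t (x + sqrt 2 * u))"
proof -
  note [measurable] = caloric1_measurable[OF assms(1)]
  obtain K where K: "\<And>y. \<bar>g t y\<bar> \<le> K * (1 + \<bar>y\<bar>) ^ 8"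
    using assms unfolding caloric1_def by (metis atLeastAtMost_iff order_refl)
  have "0 \<le> K"
    using K[of 0] by (auto dest: order_trans[OF abs_ge_zero])
  show ?thesis
  proof (rule integrable_gauss_bounded_growth)
    fix u
    have "\<bar>g t (x + sqrt 2 * u)\<bar> \<le> K * (1 + \<bar>x + sqrt 2 * u\<bar>) ^ 8"
      by (rule K)
    also have "\<dots> \<le> K * (1 + (\<bar>x\<bar> + sqrt 2 * \<bar>u\<bar>)) ^ 8"
    proof -
      have "\<bar>x + sqrt 2 * u\<bar> \<le> \<bar>x\<bar> + sqrt 2 * \<bar>u\<bar>"
        using abs_triangle_ineq[of x "sqrt 2 * u"] by (simp add: abs_mult)
      then show ?thesis
        using \<open>0 \<le> K\<close> by (intro mult_left_mono power_mono) auto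
    qed
    also have "\<dots> \<le> K * (((1 + \<bar>x\<bar>) * sqrt 2) ^ 8 * (1 + \<bar>u\<bar>) ^ 8)"
      using \<open>0 \<le> K\<close> by (intro mult_left_mono growth_shift) auto
    finally show "\<bar>g t (x + sqrt 2 * u)\<bar> \<le> (K * ((1 + \<bar>x\<bar>) * sqrt 2) ^ 8) * (1 + \<bar>u\<bar>) ^ 8"
      by (simp add: mult.assoc)
  qed measurable
qed

lemma integrable_gauss2_bounded_growth:
  fixes f :: "real \<times> real \<Rightarrow> real"
  assumes [measurable]: "f \<in> borel_measurable borel" and "\<And>w. \<bar>f w\<bar> \<le> K * (1 + norm w) ^ n"
  shows "integrable (gauss2 h) f"
proof (rule Bochner_Integration.integrable_bound)
  interpret prob_space "gauss2 h" by (rule prob_space_gauss2)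
  show "integrable (gauss2 h) (\<lambda>u. \<bar>K\<bar> * (2 ^ n * (1 + norm u ^ n)))"
    by (rule integrable_mult_right, rule integrable_mult_right, rule Bochner_Integration.integrable_add)
      (simp, rule integrable_gauss2_norm_power)
  show "AE u in gauss2 h. norm (f u) \<le> norm (\<bar>K\<bar> * (2 ^ n * (1 + norm u ^ n)))"
  proof (intro AE_I2)
    fix u
    have "\<bar>f u\<bar> \<le> \<bar>K\<bar> * (1 + norm u) ^ n"
      using assms(2)[of u] by (rule order_trans) (auto intro!: mult_right_mono)
    also have "(1 + norm u) ^ n \<le> 2 ^ n * (1 + norm u ^ n)"
      using power_add_le[of 1 "norm u" n] by simp
    finally show "norm (f u) \<le> norm (\<bar>K\<bar> * (2 ^ n * (1 + norm u ^ n)))"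
      by (simp add: mult_left_mono)
  qed
qed measurable

lemma caloric_integrable:
  assumes "caloric f" "0 \<le> t"
  shows "integrable (gauss2 h) (\<lambda>w. f t (z + sqrt 2 *\<^sub>R w))"
proof -
  note [measurable] = caloric_measurable(2)[OF assms(1)]
  obtain K where K: "\<And>y. \<bar>f t y\<bar> \<le> K * (1 + norm y) ^ 16"
    using assms unfolding caloric_def by (metis atLeastAtMost_iff order_refl)
  have "0 \<le> K"
    using K[of 0] by (auto dest: order_trans[OF abs_ge_zero])
  show ?thesis
  proof (rule integrable_gauss2_bounded_growth)
    fix w
    have "\<bar>f t (z + sqrt 2 *\<^sub>R w)\<bar> \<le> K * (1 + norm (z + sqrt 2 *\<^sub>R w)) ^ 16"
      by (rule K)
    also have "\<dots> \<le> K * (1 + (norm z + sqrt 2 * norm w)) ^ 16"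
    proof -
      have "norm (z + sqrt 2 *\<^sub>R w) \<le> norm z + sqrt 2 * norm w"
        using norm_triangle_ineq[of z "sqrt 2 *\<^sub>R w"] by simp
      then show ?thesis
        using \<open>0 \<le> K\<close> by (intro mult_left_mono power_mono) auto
    qed
    also have "\<dots> \<le> K * (((1 + norm z) * sqrt 2) ^ 16 * (1 + norm w) ^ 16)"
      using \<open>0 \<le> K\<close> by (intro mult_left_mono growth_shift) auto
    finally show "\<bar>f t (z + sqrt 2 *\<^sub>R w)\<bar> \<le> (K * ((1 + norm z) * sqrt 2) ^ 16) * (1 + norm w) ^ 16"
      by (simp add: mult.assoc)
  qed measurable
qed

text \<open>The planar Gaussian law is a product, so the average of a product splits. All planar
  examples arise in this way from functions of one coordinate.\<close>

lemma caloric_prod: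
  assumes f: "caloric1 f" and g: "caloric1 g"
  shows "caloric (\<lambda>t (x, y). f t x * g t y)"
  unfolding caloric_def
proof (intro conjI allI impI)
  have c: "continuous_on UNIV (\<lambda>(t, x). f t x)" "continuous_on UNIV (\<lambda>(t, x). g t x)"
    using f g by (auto simp: caloric1_def)
  have "continuous_on UNIV (\<lambda>z. (\<lambda>(t, x). f t x) (fst z, fst (snd z)) * (\<lambda>(t, x). g t x) (fst z, snd (snd z)))"
    by (intro continuous_on_mult continuous_on_compose2[OF c(1)] continuous_on_compose2[OF c(2)]
        continuous_intros) auto
  then show "continuous_on UNIV (\<lambda>(t, z). case z of (x, y) \<Rightarrow> f t x * g t y)"
    by (simp add: case_prod_unfold)
next
  fix T
  obtain K where K: "\<And>t x. t \<in> {0..T} \<Longrightarrow> \<bar>f t x\<bar> \<le> K * (1 + \<bar>x\<bar>) ^ 8"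
    using f unfolding caloric1_def by blast
  obtain L where L: "\<And>t x. t \<in> {0..T} \<Longrightarrow> \<bar>g t x\<bar> \<le> L * (1 + \<bar>x\<bar>) ^ 8"
    using g unfolding caloric1_def by blast
  show "\<exists>K. \<forall>t\<in>{0..T}. \<forall>z. \<bar>case z of (x, y) \<Rightarrow> f t x * g t y\<bar> \<le> K * (1 + norm z) ^ 16"
  proof (intro exI ballI allI)
    fix t :: real and z :: "real \<times> real" assume t: "t \<in> {0..T}"
    obtain x y where z: "z = (x, y)" by (cases z)
    have "0 \<le> K" "0 \<le> L"
      using K[OF t, of 0] L[OF t, of 0] by (auto dest: order_trans[OF abs_ge_zero])
    have "\<bar>x\<bar> \<le> norm z" "\<bar>y\<bar> \<le> norm z"
      using norm_fst_le[of x y] norm_snd_le[of y x] by (auto simp: z)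
    then have "\<bar>f t x\<bar> \<le> K * (1 + norm z) ^ 8" "\<bar>g t y\<bar> \<le> L * (1 + norm z) ^ 8"
      using \<open>0 \<le> K\<close> \<open>0 \<le> L\<close>
      by (auto intro!: order_trans[OF K[OF t]] order_trans[OF L[OF t]] mult_left_mono power_mono)
    then have "\<bar>f t x\<bar> * \<bar>g t y\<bar> \<le> (K * (1 + norm z) ^ 8) * (L * (1 + norm z) ^ 8)"
      by (intro mult_mono) (auto intro: order_trans[OF abs_ge_zero])
    also have "\<dots> = (K * L) * (1 + norm z) ^ (8 + 8)"
      by (simp only: power_add mult_ac)
    finally show "\<bar>case z of (x, y) \<Rightarrow> f t x * g t y\<bar> \<le> (K * L) * (1 + norm z) ^ 16"
      by (simp add: z abs_mult)
  qed
next
  fix t h :: real and z :: "real \<times> real" assume th: "0 \<le> t" "0 < h"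
  obtain x y where z: "z = (x, y)" by (cases z)
  have *: "integrable (gauss h) (\<lambda>u. f (t + h) (x + sqrt 2 * u))"
    "integrable (gauss h) (\<lambda>u. g (t + h) (y + sqrt 2 * u))"
    using th by (auto intro: caloric1_integrable f g)
  show "(\<integral>w. (case z + sqrt 2 *\<^sub>R w of (x, y) \<Rightarrow> f (t + h) x * g (t + h) y) \<partial>gauss2 h) =
       (case z of (x, y) \<Rightarrow> f t x * g t y)"
    using integral_gauss2_prod(2)[OF *] f g th by (simp add: z case_prod_unfold caloric1_def)
qed

lemma caloric_add:
  assumes f: "caloric f" and g: "caloric g"
  shows "caloric (\<lambda>t z. f t z + g t z)"
  unfolding caloric_def
proof (intro conjI allI impI)
  show "continuous_on UNIV (\<lambda>(t, z). f t z + g t z)"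
    using continuous_on_add[of UNIV "case_prod f" "case_prod g"] f g
    by (simp add: case_prod_unfold caloric_def)
next
  fix T
  obtain K where K: "\<And>t x. t \<in> {0..T} \<Longrightarrow> \<bar>f t x\<bar> \<le> K * (1 + norm x) ^ 16"
    using f unfolding caloric_def by blast
  obtain L where L: "\<And>t x. t \<in> {0..T} \<Longrightarrow> \<bar>g t x\<bar> \<le> L * (1 + norm x) ^ 16"
    using g unfolding caloric_def by blast
  show "\<exists>K. \<forall>t\<in>{0..T}. \<forall>z. \<bar>f t z + g t z\<bar> \<le> K * (1 + norm z) ^ 16"
  proof (intro exI[of _ "K + L"] ballI allI)
    fix t z assume t: "t \<in> {0..T}"
    show "\<bar>f t z + g t z\<bar> \<le> (K + L) * (1 + norm z) ^ 16"
      using K[OF t, of z] L[OF t, of z] by (simp add: distrib_right)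
  qed
next
  fix t h :: real and z assume th: "0 \<le> t" "0 < h"
  then have "integrable (gauss2 h) (\<lambda>w. f (t + h) (z + sqrt 2 *\<^sub>R w))"
    "integrable (gauss2 h) (\<lambda>w. g (t + h) (z + sqrt 2 *\<^sub>R w))"
    by (auto intro!: caloric_integrable f g)
  then show "(\<integral>w. f (t + h) (z + sqrt 2 *\<^sub>R w) + g (t + h) (z + sqrt 2 *\<^sub>R w) \<partial>gauss2 h) = f t z + g t z"
    using th by (simp add: caloric_mean f g)
qed

lemma caloric_scale:
  assumes f: "caloric f"
  shows "caloric (\<lambda>t z. c * f t z)"
  unfolding caloric_def
proof (intro conjI allI impI)
  show "continuous_on UNIV (\<lambda>(t, z). c * f t z)"
    using continuous_on_mult_left[of UNIV "case_prod f" c] f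
    by (simp add: case_prod_unfold caloric_def)
next
  fix T
  obtain K where K: "\<And>t x. t \<in> {0..T} \<Longrightarrow> \<bar>f t x\<bar> \<le> K * (1 + norm x) ^ 16"
    using f unfolding caloric_def by blast
  show "\<exists>K. \<forall>t\<in>{0..T}. \<forall>z. \<bar>c * f t z\<bar> \<le> K * (1 + norm z) ^ 16"
  proof (intro exI[of _ "\<bar>c\<bar> * K"] ballI allI)
    fix t z assume t: "t \<in> {0..T}"
    show "\<bar>c * f t z\<bar> \<le> (\<bar>c\<bar> * K) * (1 + norm z) ^ 16"
      using mult_left_mono[OF K[OF t, of z], of "\<bar>c\<bar>"] by (simp add: abs_mult mult.assoc)
  qed
qed (use f in \<open>auto simp: caloric_def\<close>)


section \<open>Heat polynomials and exponential sine solutions\<close>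

text \<open>With \<open>s = sqrt 2 * sqrt h\<close> the averaged function is a polynomial in a
  standard normal variable, whose moments of order 0, 2, 4 are 1, 1, 3 and whose odd moments vanish.
  The mean value property thus becomes the polynomial identity in \<open>mean\<close>.\<close>

lemma caloric1_polyI:
  fixes g :: "real \<Rightarrow> real \<Rightarrow> real" and c :: "nat \<Rightarrow> real \<Rightarrow> real"
  assumes g: "\<And>t x. g t x = (\<Sum>i\<le>5. c i t * x ^ i)"
    and c: "\<And>i. continuous_on UNIV (c i)"
    and mean: "\<And>t h x s. s\<^sup>2 = 2 * h \<Longrightarrow>
      \<exists>d. (\<forall>z. g (t + h) (x + s * z) = (\<Sum>i\<le>5. d i * z ^ i)) \<and> d 0 + d 2 + 3 * d 4 = g t x"
  shows "caloric1 g"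
  unfolding caloric1_def
proof (intro conjI allI impI)
  have "continuous_on UNIV (\<lambda>z. \<Sum>i\<le>5. c i (fst z) * snd z ^ i)"
    by (intro continuous_intros continuous_on_compose2[OF c]) auto
  then show "continuous_on UNIV (\<lambda>(t, x). g t x)"
    by (simp add: g case_prod_unfold)
next
  fix T :: real
  have "\<forall>i. \<exists>K. \<forall>t\<in>{0..T}. \<bar>c i t\<bar> \<le> K"
  proof
    fix i
    have "bounded (c i ` {0..T})"
      by (intro compact_imp_bounded compact_continuous_image continuous_on_subset[OF c]) auto
    then show "\<exists>K. \<forall>t\<in>{0..T}. \<bar>c i t\<bar> \<le> K"
      by (auto simp: bounded_iff)
  qed
  then obtain K where K: "\<And>i t. t \<in> {0..T} \<Longrightarrow> \<bar>c i t\<bar> \<le> K i"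
    by metis
  show "\<exists>K. \<forall>t\<in>{0..T}. \<forall>x. \<bar>g t x\<bar> \<le> K * (1 + \<bar>x\<bar>) ^ 8"
  proof (intro exI ballI allI)
    fix t x assume t: "t \<in> {0..T}"
    have "\<bar>g t x\<bar> \<le> (\<Sum>i\<le>5. \<bar>c i t * x ^ i\<bar>)"
      unfolding g by (rule sum_abs)
    also have "\<dots> \<le> (\<Sum>i\<le>5. K i * (1 + \<bar>x\<bar>) ^ 8)"
    proof (rule sum_mono)
      fix i :: nat assume "i \<in> {..5}"
      have "\<bar>x\<bar> ^ i \<le> (1 + \<bar>x\<bar>) ^ i"
        by (intro power_mono) auto
      also have "\<dots> \<le> (1 + \<bar>x\<bar>) ^ 8"
        using \<open>i \<in> {..5}\<close> by (intro power_increasing) auto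
      finally show "\<bar>c i t * x ^ i\<bar> \<le> K i * (1 + \<bar>x\<bar>) ^ 8"
        unfolding abs_mult power_abs using K[OF t, of i]
        by (intro mult_mono) (auto intro: order_trans[OF abs_ge_zero])
    qed
    finally show "\<bar>g t x\<bar> \<le> (\<Sum>i\<le>5. K i) * (1 + \<bar>x\<bar>) ^ 8"
      by (simp add: sum_distrib_right)
  qed
next
  fix t h x :: real assume th: "0 \<le> t" "0 < h"
  define s where "s = sqrt 2 * sqrt h"
  have s: "s\<^sup>2 = 2 * h"
    using th by (simp add: s_def power_mult_distrib)
  obtain d where d: "\<And>z. g (t + h) (x + s * z) = (\<Sum>i\<le>5. d i * z ^ i)" "d 0 + d 2 + 3 * d 4 = g t x"
    using mean[OF s] by blast
  have odd: "(\<integral>z. z ^ 1 \<partial>std_normal_distribution) = 0" "(\<integral>z. z ^ 3 \<partial>std_normal_distribution) = 0"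
    "(\<integral>z. z ^ 5 \<partial>std_normal_distribution) = 0"
    by (rule integral_std_normal_distribution_moment_odd, simp)+
  have m: "g (t + h) \<in> borel_measurable borel"
    unfolding g[abs_def] by measurable
  have "(\<integral>u. g (t + h) (x + sqrt 2 * u) \<partial>gauss h) = (\<integral>z. (\<Sum>i\<le>5. d i * z ^ i) \<partial>std_normal_distribution)"
    using measurable_compose[OF _ m, of "\<lambda>u. x + sqrt 2 * u" borel]
    by (subst integral_gauss) (auto simp: d(1)[symmetric] s_def mult.assoc)
  also have "\<dots> = (\<Sum>i\<le>5. d i * (\<integral>z. z ^ i \<partial>std_normal_distribution))"
    by (subst Bochner_Integration.integral_sum)
      (auto intro!: integrable_mult_right integrable_std_normal_distribution_moment)
  also have "\<dots> = d 0 + d 2 + 3 * d 4"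
    using odd std_normal_distribution_even_moments(1)[of 0]
      std_normal_distribution_even_moments(1)[of 1] std_normal_distribution_even_moments(1)[of 2]
    by (simp add: eval_nat_numeral)
  finally show "(\<integral>u. g (t + h) (x + sqrt 2 * u) \<partial>gauss h) = g t x"
    using d(2) by simp
qed

text \<open>Hermite polynomials of variance \<open>2 * t\<close>, that is
  \<open>(2 t) ^ (n / 2) He_n (x / sqrt (2 t))\<close> for positive \<open>t\<close>; the recurrence
  is that of \<open>He_n\<close> after this rescaling and makes sense for every real
  \<open>t\<close>.\<close>

fun heat_poly :: "nat \<Rightarrow> real \<Rightarrow> real \<Rightarrow> real" where
  "heat_poly 0 t x = 1"
| "heat_poly (Suc 0) t x = x"
| "heat_poly (Suc (Suc n)) t x = x * heat_poly (Suc n) t x - 2 * real (Suc n) * t * heat_poly n t x"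

lemma heat_poly_simps:
  "heat_poly 0 t x = 1" "heat_poly 1 t x = x" "heat_poly 2 t x = x\<^sup>2 - 2 * t"
  "heat_poly 3 t x = x ^ 3 - 6 * t * x" "heat_poly 4 t x = x ^ 4 - 12 * t * x\<^sup>2 + 12 * t\<^sup>2"
  "heat_poly 5 t x = x ^ 5 - 20 * t * x ^ 3 + 60 * t\<^sup>2 * x"
  by (simp_all add: eval_nat_numeral algebra_simps)

text \<open>Degree 5 is what the second moment of the triangle requires. In each case
  \<open>?c\<close> lists the coefficients in \<open>x\<close>, and \<open>?d\<close> those of
  \<open>g (t + h) (x + s * z)\<close> in \<open>z\<close>.\<close>

lemma caloric1_heat_poly:
  assumes "n \<le> 5"
  shows "caloric1 (heat_poly n)"
proof -
  have s5: "(\<Sum>i\<le>5. f i) = f 0 + f 1 + f 2 + f 3 + f 4 + f 5" for f :: "nat \<Rightarrow> real"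
    by (simp add: eval_nat_numeral)
  have n: "n \<in> {0, 1, 2, 3, 4, 5}"
    using assms by auto
  have nth6: "[a0, a1, a2, a3, a4, a5] ! 0 = a0" "[a0, a1, a2, a3, a4, a5] ! 1 = a1"
    "[a0, a1, a2, a3, a4, a5] ! 2 = a2" "[a0, a1, a2, a3, a4, a5] ! 3 = a3"
    "[a0, a1, a2, a3, a4, a5] ! 4 = a4" "[a0, a1, a2, a3, a4, a5] ! 5 = a5"
    for a0 a1 a2 a3 a4 a5 :: real
    by simp_all
  have cont6: "continuous_on UNIV (\<lambda>t. [a0 t, a1 t, a2 t, a3 t, a4 t, a5 t] ! i)"
    if "continuous_on UNIV a0" "continuous_on UNIV a1" "continuous_on UNIV a2"
      "continuous_on UNIV a3" "continuous_on UNIV a4" "continuous_on UNIV a5"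
    for a0 a1 a2 a3 a4 a5 :: "real \<Rightarrow> real" and i :: nat
  proof (cases "i < 6")
    case True
    then have "i \<in> {0, 1, 2, 3, 4, 5}" by auto
    then show ?thesis using that by (auto simp: nth6 simp del: One_nat_def)
  next
    case False
    \<comment> \<open>Beyond the end of the list the lookup is an unspecified value, but one that
      does not depend on \<open>t\<close>, hence continuous.\<close>
    then have "[a0 t, a1 t, a2 t, a3 t, a4 t, a5 t] ! i = [] ! (i - 6)" for t
      by (simp add: nth_Cons' diff_diff_add eval_nat_numeral)
    then show ?thesis by simp
  qed
  have "caloric1 (heat_poly 0)"
  proof (rule caloric1_polyI, unfold heat_poly_simps)
    let ?c = "\<lambda>i t :: real. [1 :: real, 0, 0, 0, 0, 0] ! i"
    show "1 = (\<Sum>i\<le>5. ?c i t * x ^ i)" for t x :: real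
      unfolding s5 by (simp add: algebra_simps)
    show "continuous_on UNIV (?c i)" for i :: nat
      by (rule cont6[of "\<lambda>t. 1" "\<lambda>t. 0" "\<lambda>t. 0" "\<lambda>t. 0" "\<lambda>t. 0" "\<lambda>t. 0"]) (intro continuous_intros)+
    fix t h x s :: real assume s: "s\<^sup>2 = 2 * h"
    let ?d = "\<lambda>i. [1 :: real, 0, 0, 0, 0, 0] ! i"
    have "1 = (\<Sum>i\<le>5. ?d i * z ^ i)" for z
      unfolding s5 nth6 by (algebra | simp)
    moreover have "?d 0 + ?d 2 + 3 * ?d 4 = 1"
      unfolding nth6 using s by (algebra | simp)
    ultimately show "\<exists>d. (\<forall>z. 1 = (\<Sum>i\<le>5. d i * z ^ i)) \<and>
        d 0 + d 2 + 3 * d 4 = (1 :: real)" by blast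
  qed
  moreover have "caloric1 (heat_poly 1)"
  proof (rule caloric1_polyI, unfold heat_poly_simps)
    let ?c = "\<lambda>i t :: real. [0 :: real, 1, 0, 0, 0, 0] ! i"
    show "x = (\<Sum>i\<le>5. ?c i t * x ^ i)" for t x :: real
      unfolding s5 by (simp add: algebra_simps)
    show "continuous_on UNIV (?c i)" for i :: nat
      by (rule cont6[of "\<lambda>t. 0" "\<lambda>t. 1" "\<lambda>t. 0" "\<lambda>t. 0" "\<lambda>t. 0" "\<lambda>t. 0"]) (intro continuous_intros)+
    fix t h x s :: real assume s: "s\<^sup>2 = 2 * h"
    let ?d = "\<lambda>i. [x, s, 0, 0, 0, 0] ! i"
    have "x + s * z = (\<Sum>i\<le>5. ?d i * z ^ i)" for z
      unfolding s5 nth6 by (algebra | simp)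
    moreover have "?d 0 + ?d 2 + 3 * ?d 4 = x"
      unfolding nth6 using s by (algebra | simp)
    ultimately show "\<exists>d. (\<forall>z. x + s * z = (\<Sum>i\<le>5. d i * z ^ i)) \<and>
        d 0 + d 2 + 3 * d 4 = x" by blast
  qed
  moreover have "caloric1 (heat_poly 2)"
  proof (rule caloric1_polyI, unfold heat_poly_simps)
    let ?c = "\<lambda>i t :: real. [- 2 * t, 0, 1, 0, 0, 0] ! i"
    show "x\<^sup>2 - 2 * t = (\<Sum>i\<le>5. ?c i t * x ^ i)" for t x :: real
      unfolding s5 by (simp add: algebra_simps)
    show "continuous_on UNIV (?c i)" for i :: nat
      by (rule cont6[of "\<lambda>t. - 2 * t" "\<lambda>t. 0" "\<lambda>t. 1" "\<lambda>t. 0" "\<lambda>t. 0" "\<lambda>t. 0"]) (intro continuous_intros)+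
    fix t h x s :: real assume s: "s\<^sup>2 = 2 * h"
    let ?d = "\<lambda>i. [x\<^sup>2 - 2 * (t + h), 2 * x * s, s\<^sup>2, 0, 0, 0] ! i"
    have "(x + s * z)\<^sup>2 - 2 * (t + h) = (\<Sum>i\<le>5. ?d i * z ^ i)" for z
      unfolding s5 nth6 by (algebra | simp)
    moreover have "?d 0 + ?d 2 + 3 * ?d 4 = x\<^sup>2 - 2 * t"
      unfolding nth6 using s by (algebra | simp)
    ultimately show "\<exists>d. (\<forall>z. (x + s * z)\<^sup>2 - 2 * (t + h) = (\<Sum>i\<le>5. d i * z ^ i)) \<and>
        d 0 + d 2 + 3 * d 4 = x\<^sup>2 - 2 * t" by blast
  qed
  moreover have "caloric1 (heat_poly 3)"
  proof (rule caloric1_polyI, unfold heat_poly_simps)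
    let ?c = "\<lambda>i t :: real. [0, - 6 * t, 0, 1, 0, 0] ! i"
    show "x ^ 3 - 6 * t * x = (\<Sum>i\<le>5. ?c i t * x ^ i)" for t x :: real
      unfolding s5 by (simp add: algebra_simps)
    show "continuous_on UNIV (?c i)" for i :: nat
      by (rule cont6[of "\<lambda>t. 0" "\<lambda>t. - 6 * t" "\<lambda>t. 0" "\<lambda>t. 1" "\<lambda>t. 0" "\<lambda>t. 0"]) (intro continuous_intros)+
    fix t h x s :: real assume s: "s\<^sup>2 = 2 * h"
    let ?d = "\<lambda>i. [x ^ 3 - 6 * (t + h) * x, 3 * x\<^sup>2 * s - 6 * (t + h) * s, 3 * x * s\<^sup>2, s ^ 3, 0, 0] ! i"
    have "(x + s * z) ^ 3 - 6 * (t + h) * (x + s * z) = (\<Sum>i\<le>5. ?d i * z ^ i)" for z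
      unfolding s5 nth6 by (algebra | simp)
    moreover have "?d 0 + ?d 2 + 3 * ?d 4 = x ^ 3 - 6 * t * x"
      unfolding nth6 using s by (algebra | simp)
    ultimately show "\<exists>d. (\<forall>z. (x + s * z) ^ 3 - 6 * (t + h) * (x + s * z) = (\<Sum>i\<le>5. d i * z ^ i)) \<and>
        d 0 + d 2 + 3 * d 4 = x ^ 3 - 6 * t * x" by blast
  qed
  moreover have "caloric1 (heat_poly 4)"
  proof (rule caloric1_polyI, unfold heat_poly_simps)
    let ?c = "\<lambda>i t :: real. [12 * t\<^sup>2, 0, - 12 * t, 0, 1, 0] ! i"
    show "x ^ 4 - 12 * t * x\<^sup>2 + 12 * t\<^sup>2 = (\<Sum>i\<le>5. ?c i t * x ^ i)" for t x :: real
      unfolding s5 by (simp add: algebra_simps)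
    show "continuous_on UNIV (?c i)" for i :: nat
      by (rule cont6[of "\<lambda>t. 12 * t\<^sup>2" "\<lambda>t. 0" "\<lambda>t. - 12 * t" "\<lambda>t. 0" "\<lambda>t. 1" "\<lambda>t. 0"]) (intro continuous_intros)+
    fix t h x s :: real assume s: "s\<^sup>2 = 2 * h"
    let ?d = "\<lambda>i. [x ^ 4 - 12 * (t + h) * x\<^sup>2 + 12 * (t + h)\<^sup>2, 4 * x ^ 3 * s - 24 * (t + h) * x * s, 6 * x\<^sup>2 * s\<^sup>2 - 12 * (t + h) * s\<^sup>2, 4 * x * s ^ 3, s ^ 4, 0] ! i"
    have "(x + s * z) ^ 4 - 12 * (t + h) * (x + s * z)\<^sup>2 + 12 * (t + h)\<^sup>2 = (\<Sum>i\<le>5. ?d i * z ^ i)" for z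
      unfolding s5 nth6 by (algebra | simp)
    moreover have "?d 0 + ?d 2 + 3 * ?d 4 = x ^ 4 - 12 * t * x\<^sup>2 + 12 * t\<^sup>2"
      unfolding nth6 using s by (algebra | simp)
    ultimately show "\<exists>d. (\<forall>z. (x + s * z) ^ 4 - 12 * (t + h) * (x + s * z)\<^sup>2 + 12 * (t + h)\<^sup>2 = (\<Sum>i\<le>5. d i * z ^ i)) \<and>
        d 0 + d 2 + 3 * d 4 = x ^ 4 - 12 * t * x\<^sup>2 + 12 * t\<^sup>2" by blast
  qed
  moreover have "caloric1 (heat_poly 5)"
  proof (rule caloric1_polyI, unfold heat_poly_simps)
    let ?c = "\<lambda>i t :: real. [0, 60 * t\<^sup>2, 0, - 20 * t, 0, 1] ! i"
    show "x ^ 5 - 20 * t * x ^ 3 + 60 * t\<^sup>2 * x = (\<Sum>i\<le>5. ?c i t * x ^ i)" for t x :: real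
      unfolding s5 by (simp add: algebra_simps)
    show "continuous_on UNIV (?c i)" for i :: nat
      by (rule cont6[of "\<lambda>t. 0" "\<lambda>t. 60 * t\<^sup>2" "\<lambda>t. 0" "\<lambda>t. - 20 * t" "\<lambda>t. 0" "\<lambda>t. 1"]) (intro continuous_intros)+
    fix t h x s :: real assume s: "s\<^sup>2 = 2 * h"
    let ?d = "\<lambda>i. [x ^ 5 - 20 * (t + h) * x ^ 3 + 60 * (t + h)\<^sup>2 * x, 5 * x ^ 4 * s - 60 * (t + h) * x\<^sup>2 * s + 60 * (t + h)\<^sup>2 * s, 10 * x ^ 3 * s\<^sup>2 - 60 * (t + h) * x * s\<^sup>2, 10 * x\<^sup>2 * s ^ 3 - 20 * (t + h) * s ^ 3, 5 * x * s ^ 4, s ^ 5] ! i"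
    have "(x + s * z) ^ 5 - 20 * (t + h) * (x + s * z) ^ 3 + 60 * (t + h)\<^sup>2 * (x + s * z) = (\<Sum>i\<le>5. ?d i * z ^ i)" for z
      unfolding s5 nth6 by (algebra | simp)
    moreover have "?d 0 + ?d 2 + 3 * ?d 4 = x ^ 5 - 20 * t * x ^ 3 + 60 * t\<^sup>2 * x"
      unfolding nth6 using s by (algebra | simp)
    ultimately show "\<exists>d. (\<forall>z. (x + s * z) ^ 5 - 20 * (t + h) * (x + s * z) ^ 3 + 60 * (t + h)\<^sup>2 * (x + s * z) = (\<Sum>i\<le>5. d i * z ^ i)) \<and>
        d 0 + d 2 + 3 * d 4 = x ^ 5 - 20 * t * x ^ 3 + 60 * t\<^sup>2 * x" by blast
  qed
  ultimately show ?thesis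
    using n by auto
qed

text \<open>The characteristic function of the normal law gives
  \<open>E cos (r Z) = exp (- r^2 / 2)\<close> and \<open>E sin (r Z) = 0\<close>; with
  \<open>r^2 = 2 a^2 h\<close> the loss \<open>exp (- a^2 h)\<close> cancels the factor gained in
  time.\<close>

lemma caloric1_sin: "caloric1 (\<lambda>t x. exp (a\<^sup>2 * t) * sin (a * x))"
  unfolding caloric1_def
proof (intro conjI allI impI)
  show "continuous_on UNIV (\<lambda>(t, x). exp (a\<^sup>2 * t) * sin (a * x))"
    by (auto intro!: continuous_intros simp: case_prod_unfold)
next
  fix T :: real
  show "\<exists>K. \<forall>t\<in>{0..T}. \<forall>x. \<bar>exp (a\<^sup>2 * t) * sin (a * x)\<bar> \<le> K * (1 + \<bar>x\<bar>) ^ 8"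
  proof (intro exI ballI allI)
    fix t x assume t: "t \<in> {0..T}"
    have "\<bar>exp (a\<^sup>2 * t) * sin (a * x)\<bar> \<le> exp (a\<^sup>2 * T) * 1"
      unfolding abs_mult using t by (intro mult_mono) (auto intro: mult_left_mono)
    also have "\<dots> \<le> exp (a\<^sup>2 * T) * (1 + \<bar>x\<bar>) ^ 8"
      by (intro mult_left_mono one_le_power) auto
    finally show "\<bar>exp (a\<^sup>2 * t) * sin (a * x)\<bar> \<le> exp (a\<^sup>2 * T) * (1 + \<bar>x\<bar>) ^ 8" .
  qed
next
  fix t h x :: real assume th: "0 \<le> t" "0 < h"
  define r where "r = a * sqrt 2 * sqrt h"
  have r: "r\<^sup>2 = 2 * (a\<^sup>2 * h)"
    using th by (simp add: r_def power_mult_distrib)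
  interpret real_distribution std_normal_distribution
    by (rule real_dist_normal_dist)
  have int: "integrable std_normal_distribution (\<lambda>z. iexp (r * z))"
    by (intro integrable_const_bound[where B = 1]) auto
  have ch: "(CLINT z|std_normal_distribution. iexp (r * z)) = complex_of_real (exp (- (r\<^sup>2) / 2))"
    using char_std_normal_distribution by (simp add: char_def fun_eq_iff)
  have "(\<integral>z. cos (r * z) \<partial>std_normal_distribution) = Re (CLINT z|std_normal_distribution. iexp (r * z))"
    by (subst integral_Re[OF int, symmetric]) (simp add: Re_exp)
  then have c: "(\<integral>z. cos (r * z) \<partial>std_normal_distribution) = exp (- (a\<^sup>2 * h))"
    by (simp only: ch r) simp
  have "(\<integral>z. sin (r * z) \<partial>std_normal_distribution) = Im (CLINT z|std_normal_distribution. iexp (r * z))"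
    by (subst integral_Im[OF int, symmetric]) (simp add: Im_exp)
  then have s: "(\<integral>z. sin (r * z) \<partial>std_normal_distribution) = 0"
    by (simp only: ch r) simp
  have ints: "integrable std_normal_distribution (\<lambda>z. cos (r * z))"
    "integrable std_normal_distribution (\<lambda>z. sin (r * z))"
    by (intro integrable_const_bound[where B = 1]; auto)+
  have "(\<integral>u. exp (a\<^sup>2 * (t + h)) * sin (a * (x + sqrt 2 * u)) \<partial>gauss h) =
    (\<integral>z. exp (a\<^sup>2 * (t + h)) * (sin (a * x) * cos (r * z) + cos (a * x) * sin (r * z)) \<partial>std_normal_distribution)"
  proof (subst integral_gauss)
    have "sin (a * (x + sqrt 2 * (sqrt h * z))) = sin (a * x) * cos (r * z) + cos (a * x) * sin (r * z)" for z
      unfolding sin_add[symmetric] by (simp add: r_def distrib_left mult.assoc)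
    then show "(\<integral>z. exp (a\<^sup>2 * (t + h)) * sin (a * (x + sqrt 2 * (sqrt h * z))) \<partial>std_normal_distribution) =
      (\<integral>z. exp (a\<^sup>2 * (t + h)) * (sin (a * x) * cos (r * z) + cos (a * x) * sin (r * z)) \<partial>std_normal_distribution)"
      by simp
  qed simp
  also have "\<dots> = exp (a\<^sup>2 * (t + h)) * (sin (a * x) * exp (- (a\<^sup>2 * h)))"
    using ints by (simp add: c s)
  also have "\<dots> = exp (a\<^sup>2 * t) * sin (a * x)"
    by (simp add: algebra_simps flip: exp_add)
  finally show "(\<integral>u. exp (a\<^sup>2 * (t + h)) * sin (a * (x + sqrt 2 * u)) \<partial>gauss h) = exp (a\<^sup>2 * t) * sin (a * x)" .
qed

subsection \<open>Independence of the past\<close>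

lemma power_Suc_tangent:
  fixes u w :: real
  assumes "0 \<le> u" "0 \<le> w"
  shows "w ^ Suc r + real (Suc r) * w ^ r * (u - w) \<le> u ^ Suc r"
proof (induction r)
  case (Suc r)
  have "0 \<le> real (Suc r) * w ^ r * (u - w)\<^sup>2"
    using assms by simp
  also have "\<dots> = u * (w ^ Suc r + real (Suc r) * w ^ r * (u - w))
      - (w ^ Suc (Suc r) + real (Suc (Suc r)) * w ^ Suc r * (u - w))"
    by (simp add: power2_eq_square algebra_simps)
  finally show ?case
    using mult_left_mono[OF Suc assms(1)] by simp
qed simp

text \<open>Support inequality at \<open>x\<close> for the convex function
  \<open>norm y ^ (2 * Suc r)\<close>: a minorant that is affine in \<open>y\<close>, so that its
  Gaussian average is explicit. It stands in for Jensen's inequality.\<close>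

lemma norm_power_tangent:
  fixes x y :: "'a::real_inner"
  shows "norm x ^ (2 * Suc r) + 2 * real (Suc r) * norm x ^ (2 * r) * (x \<bullet> y - x \<bullet> x) \<le> norm y ^ (2 * Suc r)"
proof -
  have "0 \<le> (norm (y - x))\<^sup>2"
    by simp
  then have "2 * (x \<bullet> y - x \<bullet> x) \<le> (norm y)\<^sup>2 - (norm x)\<^sup>2"
    unfolding power2_norm_eq_inner by (simp add: inner_diff inner_commute)
  then have "real (Suc r) * ((norm x)\<^sup>2) ^ r * (2 * (x \<bullet> y - x \<bullet> x)) \<le>
      real (Suc r) * ((norm x)\<^sup>2) ^ r * ((norm y)\<^sup>2 - (norm x)\<^sup>2)"
    by (intro mult_left_mono) auto
  moreover have "((norm x)\<^sup>2) ^ Suc r + real (Suc r) * ((norm x)\<^sup>2) ^ r * ((norm y)\<^sup>2 - (norm x)\<^sup>2)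
      \<le> ((norm y)\<^sup>2) ^ Suc r"
    by (rule power_Suc_tangent) auto
  moreover have "real (Suc r) * ((norm x)\<^sup>2) ^ r * (2 * (x \<bullet> y - x \<bullet> x)) =
      2 * real (Suc r) * ((norm x)\<^sup>2) ^ r * (x \<bullet> y - x \<bullet> x)"
    by (simp add: algebra_simps)
  ultimately show ?thesis
    unfolding power_mult by linarith
qed

text \<open>A deterministic form of Doob's L^2 inequality. The sum is a discrete stochastic integral
  of the running maximum; for a nonnegative submartingale its mean is nonnegative and only the
  constant 4 remains. In the induction a new maximum contributes the square
  \<open>(s (Suc n) - m n)^2\<close>, and the conclusion uses
  \<open>(m n - 2 * s n)^2 \<ge> 0\<close>.\<close>

lemma doob_pathwise:
  fixes s :: "nat \<Rightarrow> real"
  defines "m \<equiv> \<lambda>n. Max (s ` {..n})"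
  shows "(m n)\<^sup>2 \<le> 4 * (s n)\<^sup>2 - 4 * (\<Sum>i<n. m i * (s (Suc i) - s i))"
proof -
  have m_Suc: "m (Suc n) = max (s (Suc n)) (m n)" for n
    unfolding m_def atMost_Suc image_insert by (subst Max_insert) auto
  have "2 * (\<Sum>i<n. m i * (s (Suc i) - s i)) \<le> 2 * m n * s n - (m n)\<^sup>2"
  proof (induction n)
    case 0
    then show ?case by (simp add: m_def power2_eq_square)
  next
    case (Suc n)
    have "2 * m n * s (Suc n) - (m n)\<^sup>2 \<le> 2 * m (Suc n) * s (Suc n) - (m (Suc n))\<^sup>2"
    proof (cases "s (Suc n) \<le> m n")
      case False
      have "0 \<le> (s (Suc n) - m n)\<^sup>2" by simp
      then show ?thesis
        using False by (simp add: m_Suc power2_eq_square algebra_simps)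
    qed (simp add: m_Suc)
    then show ?case
      using Suc by (simp add: algebra_simps)
  qed
  moreover have "0 \<le> (m n - 2 * s n)\<^sup>2"
    by simp
  ultimately show ?thesis
    by (simp add: power2_eq_square algebra_simps)
qed

lemma integral_gauss2_inner:
  assumes "0 < h"
  shows "integrable (gauss2 h) (\<lambda>w. x \<bullet> (z + sqrt 2 *\<^sub>R w))"
    "(\<integral>w. x \<bullet> (z + sqrt 2 *\<^sub>R w) \<partial>gauss2 h) = x \<bullet> z"
proof -
  have c: "caloric (\<lambda>t (x, y). heat_poly 1 t x * heat_poly 0 t y)"
    "caloric (\<lambda>t (x, y). heat_poly 0 t x * heat_poly 1 t y)"
    by (intro caloric_prod caloric1_heat_poly; simp)+
  have c': "caloric (\<lambda>t z'. fst x * (case z' of (x, y) \<Rightarrow> heat_poly 1 t x * heat_poly 0 t y) +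
      snd x * (case z' of (x, y) \<Rightarrow> heat_poly 0 t x * heat_poly 1 t y))"
    by (intro caloric_add caloric_scale c)
  have *: "(\<lambda>t z'. fst x * (case z' of (x, y) \<Rightarrow> heat_poly 1 t x * heat_poly 0 t y) +
      snd x * (case z' of (x, y) \<Rightarrow> heat_poly 0 t x * heat_poly 1 t y)) = (\<lambda>t z'. x \<bullet> z')"
    by (auto simp: heat_poly_simps inner_prod_def fun_eq_iff case_prod_unfold)
  have "caloric (\<lambda>t z'. x \<bullet> z')"
    using c' unfolding * .
  from caloric_integrable[OF this, of 0 h z] caloric_mean[OF this, of 0 h z] assms
  show "integrable (gauss2 h) (\<lambda>w. x \<bullet> (z + sqrt 2 *\<^sub>R w))"
    "(\<integral>w. x \<bullet> (z + sqrt 2 *\<^sub>R w) \<partial>gauss2 h) = x \<bullet> z"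
    by auto
qed

lemma integrable_gauss2_norm_shift:
  "integrable (gauss2 h) (\<lambda>w. norm (z + sqrt 2 *\<^sub>R w) ^ n)"
proof (rule integrable_gauss2_bounded_growth)
  fix w
  have "norm (z + sqrt 2 *\<^sub>R w) \<le> 1 + (norm z + sqrt 2 * norm w)"
    using norm_triangle_ineq[of z "sqrt 2 *\<^sub>R w"] by simp
  then have "norm (z + sqrt 2 *\<^sub>R w) ^ n \<le> (1 + (norm z + sqrt 2 * norm w)) ^ n"
    by (intro power_mono) auto
  also have "\<dots> \<le> ((1 + norm z) * sqrt 2) ^ n * (1 + norm w) ^ n"
    by (rule growth_shift) auto
  finally show "\<bar>norm (z + sqrt 2 *\<^sub>R w) ^ n\<bar> \<le> ((1 + norm z) * sqrt 2) ^ n * (1 + norm w) ^ n"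
    by simp
qed measurable

text \<open>Averaging the tangent inequality at \<open>z\<close> leaves only its constant term,
  since the linear term is centred.\<close>

lemma gauss2_norm_power_ge:
  assumes "0 < h"
  shows "norm z ^ (2 * Suc r) \<le> (\<integral>w. norm (z + sqrt 2 *\<^sub>R w) ^ (2 * Suc r) \<partial>gauss2 h)"
proof -
  interpret prob_space "gauss2 h" by (rule prob_space_gauss2)
  let ?l = "\<lambda>w. norm z ^ (2 * Suc r) +
    2 * real (Suc r) * norm z ^ (2 * r) * (z \<bullet> (z + sqrt 2 *\<^sub>R w) - z \<bullet> z)"
  have i: "integrable (gauss2 h) (\<lambda>w. z \<bullet> (z + sqrt 2 *\<^sub>R w))"
    "(\<integral>w. z \<bullet> (z + sqrt 2 *\<^sub>R w) \<partial>gauss2 h) = z \<bullet> z"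
    using integral_gauss2_inner[OF assms] by auto
  have "norm z ^ (2 * Suc r) = (\<integral>w. ?l w \<partial>gauss2 h)"
    using i prob_space by (simp del: mult_Suc_right power_Suc)
  also have "\<dots> \<le> (\<integral>w. norm (z + sqrt 2 *\<^sub>R w) ^ (2 * Suc r) \<partial>gauss2 h)"
    using i by (intro integral_mono norm_power_tangent integrable_gauss2_norm_shift
      Bochner_Integration.integrable_add integrable_mult_right Bochner_Integration.integrable_diff) auto
  finally show ?thesis .
qed

section \<open>The past on a dyadic grid\<close>

context planar_brownian_motion
begin

text \<open>Generated by increments because these are assumed independent; the positions at grid
  times up to \<open>k\<close> are recovered by telescoping from \<open>B 0 = 0\<close>.\<close>

definition past :: "nat \<Rightarrow> nat \<Rightarrow> 'w measure" where
  "past n k = vimage_algebra (space M)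
    (\<lambda>\<omega>. \<lambda>i\<in>{..<k}. B (Suc i / 2 ^ n) \<omega> - B (i / 2 ^ n) \<omega>) (PiM {..<k} (\<lambda>_. borel))"

abbreviation step :: "nat \<Rightarrow> nat \<Rightarrow> 'w \<Rightarrow> real \<times> real"
  where "step n k \<omega> \<equiv> B (Suc k / 2 ^ n) \<omega> - B (k / 2 ^ n) \<omega>"

lemma space_past [simp]: "space (past n k) = space M"
  by (simp add: past_def)

lemma measurable_B_past:
  fixes j k :: nat
  assumes "j \<le> k"
  shows "(\<lambda>\<omega>. B (j / 2 ^ n) \<omega>) \<in> borel_measurable (past n k)"
proof -
  have *: "step n i \<in> borel_measurable (past n k)" if "i < k" for i
  proof -
    have "(\<lambda>\<omega>. (\<lambda>i\<in>{..<k}. step n i \<omega>) i) \<in> borel_measurable (past n k)"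
      unfolding past_def using that
      by (intro measurable_compose[where g = "\<lambda>f. f i" and f = "\<lambda>\<omega>. \<lambda>i\<in>{..<k}. step n i \<omega>",
            OF measurable_vimage_algebra1 measurable_component_singleton])
        (auto simp: space_PiM)
    then show ?thesis
      using that by simp
  qed
  have sum: "B (j / 2 ^ n) \<omega> = (\<Sum>i<j. step n i \<omega>)" if "\<omega> \<in> space M" for \<omega>
    using that starts_at_origin sum_lessThan_telescope[of "\<lambda>i. B (real i / 2 ^ n) \<omega>" j] by simp
  have "(\<lambda>\<omega>. \<Sum>i<j. step n i \<omega>) \<in> borel_measurable (past n k)"
    using assms by (intro borel_measurable_sum *) auto
  then show ?thesis
    by (subst measurable_cong[OF sum]) auto
qed

lemma measurable_start: "0 \<le> t \<Longrightarrow> started_at p B t \<in> borel_measurable M"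
  using measurable_at[of t] unfolding started_at_def[abs_def] by simp

lemma measurable_start_past:
  fixes j k :: nat
  shows "j \<le> k \<Longrightarrow> started_at p B (j / 2 ^ n) \<in> borel_measurable (past n k)"
  using measurable_B_past[of j k n] unfolding started_at_def[abs_def] by simp

lemma distr_increment:
  assumes "0 \<le> s" "s < t"
  shows "distr M borel (\<lambda>\<omega>. B t \<omega> - B s \<omega>) = gauss2 (t - s)"
proof -
  have "distr M borel (\<lambda>\<omega>. B t \<omega> - B s \<omega>) = distr M lborel (\<lambda>\<omega>. B t \<omega> - B s \<omega>)"
    by (rule distr_cong) auto
  also have "\<dots> = gauss2 (t - s)"
    using distributed_distr_eq_density[OF gaussian_increments[OF assms]] assms
    by (simp add: gauss2_density)
  finally show ?thesis .
qed

text \<open>The increment is padded with \<open>0\<close> because \<open>indep_var\<close> relates variables of one common type.\<close>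

lemma indep_past:
  fixes Z :: "'w \<Rightarrow> real \<times> real \<times> real"
  assumes Z: "Z \<in> borel_measurable (past n k)"
  shows "indep_var borel Z borel (\<lambda>\<omega>. (0 :: real, step n k \<omega>))"
proof -
  let ?X = "\<lambda>i \<omega>. step n i \<omega>"
  let ?T = "\<lambda>\<omega>. \<lambda>i\<in>{..<k}. ?X i \<omega>" and ?S = "\<lambda>\<omega>. \<lambda>i\<in>{k}. ?X i \<omega>"
  let ?P = "PiM {..<k} (\<lambda>_. borel :: (real \<times> real) measure)"
  let ?Q = "PiM {k} (\<lambda>_. borel :: (real \<times> real) measure)"
  have ind: "indep_vars (\<lambda>_. borel) ?X {..<Suc k}"
    using independent_increments[of "\<lambda>i. real i / 2 ^ n" "Suc k"]
    by (simp add: divide_strict_right_mono)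
  have 1: "indep_var ?P ?T ?Q ?S"
    by (rule indep_var_restrict[OF ind]) auto
  have T: "?T \<in> space M \<rightarrow> space ?P"
    by (auto simp: space_PiM)
  have sets_past: "sets (past n k) = {?T -` A \<inter> space M | A. A \<in> sets ?P}"
    unfolding past_def by (rule sets_vimage_algebra2[OF T])
  have sub: "sets (past n k) \<subseteq> sets M"
    using 1 unfolding sets_past by (auto simp: indep_var_eq intro: measurable_sets)
  have ZM: "Z \<in> borel_measurable M"
    using Z sub by (auto simp: measurable_def)
  have step: "step n k \<in> borel_measurable M"
    by (intro borel_measurable_diff measurable_at) auto
  have "sigma_sets (space M) {Z -` A \<inter> space M | A. A \<in> sets borel} \<subseteq> sigma_sets (space M) {?T -` A \<inter> space M | A. A \<in> sets ?P}"
  proof (rule sigma_sets_mono, safe)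
    fix A :: "(real \<times> real \<times> real) set" assume "A \<in> sets borel"
    then have "Z -` A \<inter> space M \<in> sets (past n k)"
      using measurable_sets[OF Z, of A] by simp
    then show "Z -` A \<inter> space M \<in> sigma_sets (space M) {?T -` A \<inter> space M | A. A \<in> sets ?P}"
      unfolding sets_past by (rule sigma_sets.Basic)
  qed
  moreover have "sigma_sets (space M) {(\<lambda>\<omega>. (0 :: real, step n k \<omega>)) -` A \<inter> space M | A. A \<in> sets borel} \<subseteq>
      sigma_sets (space M) {?S -` A \<inter> space M | A. A \<in> sets ?Q}"
  proof (rule sigma_sets_mono, safe)
    fix A :: "(real \<times> real \<times> real) set" assume A: "A \<in> sets borel"
    have "(\<lambda>f. f k) \<in> measurable ?Q borel"
      by (rule measurable_component_singleton) simp
    from borel_measurable_Pair[OF borel_measurable_const this]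
    have "(\<lambda>f. (0 :: real, f k)) \<in> borel_measurable ?Q" .
    then have "(\<lambda>f. (0, f k)) -` A \<inter> space ?Q \<in> sets ?Q"
      using A by (rule measurable_sets)
    moreover have "(\<lambda>\<omega>. (0 :: real, step n k \<omega>)) -` A \<inter> space M = ?S -` ((\<lambda>f. (0, f k)) -` A \<inter> space ?Q) \<inter> space M"
      by (auto simp: space_PiM)
    ultimately show "(\<lambda>\<omega>. (0 :: real, step n k \<omega>)) -` A \<inter> space M \<in> sigma_sets (space M) {?S -` A \<inter> space M | A. A \<in> sets ?Q}"
      by (intro sigma_sets.Basic) blast
  qed
  moreover have "indep_set (sigma_sets (space M) {?T -` A \<inter> space M | A. A \<in> sets ?P})
      (sigma_sets (space M) {?S -` A \<inter> space M | A. A \<in> sets ?Q})"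
    using 1 unfolding indep_var_eq by (rule conjunct2)
  ultimately have "indep_set (sigma_sets (space M) {Z -` A \<inter> space M | A. A \<in> sets borel})
      (sigma_sets (space M) {(\<lambda>\<omega>. (0 :: real, step n k \<omega>)) -` A \<inter> space M | A. A \<in> sets borel})"
    unfolding indep_sets2_eq by (meson subset_iff)
  moreover have "(\<lambda>\<omega>. (0 :: real, step n k \<omega>)) \<in> borel_measurable M"
    using step by (intro borel_measurable_Pair) auto
  ultimately show ?thesis
    using ZM unfolding indep_var_eq by blast
qed

text \<open>This replaces conditional expectation: \<open>Z\<close> and the next increment have a
  product law, so Fubini integrates over the increment with \<open>Z\<close> frozen. A sign is what
  submartingales require, and martingales follow by applying it to \<open>f\<close> and
  \<open>- f\<close>.\<close>

lemma freeze_nonneg: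
  fixes Z :: "'w \<Rightarrow> real \<times> real \<times> real"
  assumes Z: "Z \<in> borel_measurable (past n k)"
    and phi [measurable]: "\<phi> \<in> borel_measurable (borel \<Otimes>\<^sub>M borel)"
    and int: "integrable M (\<lambda>\<omega>. \<phi> (Z \<omega>, step n k \<omega>))"
    and pos: "\<And>z. 0 \<le> (\<integral>w. \<phi> (z, w) \<partial>gauss2 (1 / 2 ^ n))"
  shows "0 \<le> (\<integral>\<omega>. \<phi> (Z \<omega>, step n k \<omega>) \<partial>M :: real)"
proof -
  define D where "D = step n k"
  let ?h = "1 / 2 ^ n :: real" and ?Y = "\<lambda>\<omega>. (0 :: real, D \<omega>)"
  have "0 \<le> real k / 2 ^ n" "real k / 2 ^ n < Suc k / 2 ^ n" "Suc k / 2 ^ n - k / 2 ^ n = ?h"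
    by (auto simp: divide_strict_right_mono diff_divide_distrib[symmetric])
  then have d: "distr M borel D = gauss2 ?h"
    unfolding D_def using distr_increment by metis
  have [measurable]: "D \<in> borel_measurable M"
    unfolding D_def by (intro borel_measurable_diff measurable_at) auto
  have D_eq: "step n k \<omega> = D \<omega>" for \<omega>
    by (simp add: D_def)
  note ind = indep_past[OF Z, unfolded indep_var_distribution_eq, unfolded D_eq]
  have [measurable]: "Z \<in> borel_measurable M" "?Y \<in> borel_measurable M"
    using ind by blast+
  let ?J = "distr M (borel \<Otimes>\<^sub>M borel) (\<lambda>\<omega>. (Z \<omega>, ?Y \<omega>))"
  let ?\<phi> = "\<lambda>(z, y :: real \<times> real \<times> real). \<phi> (z, snd y)"
  have J: "distr M borel Z \<Otimes>\<^sub>M distr M borel ?Y = ?J"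
    using ind by simp
  have snd: "snd \<in> borel_measurable (borel :: (real \<times> real \<times> real) measure)"
    by (intro borel_measurable_continuous_onI continuous_intros)
  have "(\<lambda>x :: (real \<times> real \<times> real) \<times> (real \<times> real \<times> real). (fst x, snd (snd x))) \<in> borel \<Otimes>\<^sub>M borel \<rightarrow>\<^sub>M borel \<Otimes>\<^sub>M borel"
    by (rule measurable_Pair[OF measurable_fst measurable_compose[OF measurable_snd snd]])
  from measurable_compose[OF this phi] have [measurable]: "?\<phi> \<in> borel_measurable (borel \<Otimes>\<^sub>M borel)"
    by (simp add: case_prod_unfold)
  interpret Z: prob_space "distr M borel Z"
    by (intro prob_space_distr) auto
  interpret G: prob_space "distr M borel ?Y" by (intro prob_space_distr) auto
  interpret pair_prob_space "distr M borel Z" "distr M borel ?Y" ..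
  have inner: "(\<integral>y. ?\<phi> (z, y) \<partial>distr M borel ?Y) = (\<integral>w. \<phi> (z, w) \<partial>gauss2 ?h)" for z
    unfolding d[symmetric] by (subst (1 2) integral_distr) auto
  have "integrable ?J ?\<phi>"
    using int[unfolded D_eq] by (subst integrable_distr_eq) auto
  then have "integral\<^sup>L ?J ?\<phi> = (\<integral>z. \<integral>y. ?\<phi> (z, y) \<partial>distr M borel ?Y \<partial>distr M borel Z)"
    unfolding J[symmetric] by (subst integral_fst') auto
  moreover have "integral\<^sup>L ?J ?\<phi> = (\<integral>\<omega>. \<phi> (Z \<omega>, D \<omega>) \<partial>M)"
    by (subst integral_distr) auto
  ultimately show ?thesis
    using pos unfolding inner D_eq by simp
qed

lemma integrable_norm_B: "0 \<le> t \<Longrightarrow> integrable M (\<lambda>\<omega>. norm (B t \<omega>) ^ m)"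
proof (cases "t = 0")
  case True
  then have "integrable M (\<lambda>\<omega>. norm (B t \<omega>) ^ m) \<longleftrightarrow> integrable M (\<lambda>\<omega>. 0 ^ m :: real)"
    using starts_at_origin by (intro Bochner_Integration.integrable_cong) auto
  then show ?thesis by simp
next
  case False
  assume "0 \<le> t"
  with False have "0 < t" by simp
  have [measurable]: "B t \<in> borel_measurable M" "B 0 \<in> borel_measurable M"
    using measurable_at \<open>0 \<le> t\<close> by auto
  have "integrable (distr M borel (\<lambda>\<omega>. B t \<omega> - B 0 \<omega>)) (\<lambda>w. norm w ^ m)"
    using distr_increment[of 0 t] \<open>0 < t\<close> integrable_gauss2_norm_power by simp
  then have "integrable M (\<lambda>\<omega>. norm (B t \<omega> - B 0 \<omega>) ^ m)"
    by (subst (asm) integrable_distr_eq) auto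
  moreover have "integrable M (\<lambda>\<omega>. norm (B t \<omega>) ^ m) \<longleftrightarrow> integrable M (\<lambda>\<omega>. norm (B t \<omega> - B 0 \<omega>) ^ m)"
    using starts_at_origin by (intro Bochner_Integration.integrable_cong) auto
  ultimately show ?thesis by simp
qed

lemma integrable_start_growth:
  assumes t: "0 \<le> t"
  shows "integrable M (\<lambda>\<omega>. (1 + norm (started_at p B t \<omega>)) ^ m)"
proof (rule Bochner_Integration.integrable_bound)
  have [measurable]: "started_at p B t \<in> borel_measurable M"
    by (rule measurable_start[OF t])
  show "(\<lambda>\<omega>. (1 + norm (started_at p B t \<omega>)) ^ m) \<in> borel_measurable M"
    by measurable
  show "integrable M (\<lambda>\<omega>. ((1 + norm p) * sqrt 2) ^ m * (2 ^ m * (1 + norm (B t \<omega>) ^ m)))"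
    by (rule integrable_mult_right, rule integrable_mult_right, rule Bochner_Integration.integrable_add)
      (simp, rule integrable_norm_B[OF t])
  show "AE \<omega> in M. norm ((1 + norm (started_at p B t \<omega>)) ^ m) \<le>
      norm (((1 + norm p) * sqrt 2) ^ m * (2 ^ m * (1 + norm (B t \<omega>) ^ m)))"
  proof (intro AE_I2)
    fix \<omega>
    have "norm (started_at p B t \<omega>) \<le> norm p + sqrt 2 * norm (B t \<omega>)"
      using norm_triangle_ineq[of p "sqrt 2 *\<^sub>R B t \<omega>"] by (simp add: started_at_def)
    then have "(1 + norm (started_at p B t \<omega>)) ^ m \<le> (1 + (norm p + sqrt 2 * norm (B t \<omega>))) ^ m"
      by (intro power_mono) auto
    also have "\<dots> \<le> ((1 + norm p) * sqrt 2) ^ m * (1 + norm (B t \<omega>)) ^ m"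
      by (rule growth_shift) auto
    also have "(1 + norm (B t \<omega>)) ^ m \<le> 2 ^ m * (1 + norm (B t \<omega>) ^ m)"
      using power_add_le[of 1 "norm (B t \<omega>)" m] by simp
    finally show "norm ((1 + norm (started_at p B t \<omega>)) ^ m) \<le>
      norm (((1 + norm p) * sqrt 2) ^ m * (2 ^ m * (1 + norm (B t \<omega>) ^ m)))"
      by (simp add: mult_left_mono)
  qed
qed

lemma integrable_start_bounded:
  fixes f :: "real \<times> real \<Rightarrow> real"
  assumes "0 \<le> t" "f \<in> borel_measurable borel" "\<And>z. \<bar>f z\<bar> \<le> K * (1 + norm z) ^ m"
  shows "integrable M (\<lambda>\<omega>. f (started_at p B t \<omega>))"
proof (rule Bochner_Integration.integrable_bound)
  show "integrable M (\<lambda>\<omega>. K * (1 + norm (started_at p B t \<omega>)) ^ m)"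
    using integrable_start_growth[OF assms(1)] by auto
  show "(\<lambda>\<omega>. f (started_at p B t \<omega>)) \<in> borel_measurable M"
    using measurable_compose[OF measurable_start[OF assms(1)] assms(2)] .
  show "AE \<omega> in M. norm (f (started_at p B t \<omega>)) \<le> norm (K * (1 + norm (started_at p B t \<omega>)) ^ m)"
    unfolding real_norm_def by (intro AE_I2 order_trans[OF assms(3) abs_ge_self])
qed

lemma integrable_caloric:
  assumes f: "caloric f" and t: "0 \<le> t"
  shows "integrable M (\<lambda>\<omega>. f t (started_at p B t \<omega>))"
proof -
  obtain K where "\<And>y. \<bar>f t y\<bar> \<le> K * (1 + norm y) ^ 16"
    using f t unfolding caloric_def by (metis atLeastAtMost_iff order_refl)
  then show ?thesis
    by (rule integrable_start_bounded[OF t caloric_measurable(2)[OF f]])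
qed

end

subsection \<open>Optional stopping and a maximal inequality on dyadic grids\<close>

lemma sum_stopped_telescope:
  fixes g :: "nat \<Rightarrow> real"
  assumes "s \<le> N"
  shows "g s = g 0 + (\<Sum>k<N. of_bool (k < s) * (g (Suc k) - g k))"
proof -
  have "(\<Sum>k<N. of_bool (k < s) * (g (Suc k) - g k)) = (\<Sum>k<s. g (Suc k) - g k)"
    using assms by (intro sum.mono_neutral_cong_right) auto
  then show ?thesis
    by (simp add: sum_lessThan_telescope)
qed

lemma measurable_fst_borel: "fst \<in> borel_measurable (borel :: ('a::topological_space \<times> 'b::topological_space) measure)"
  by (intro borel_measurable_continuous_onI continuous_intros)

lemma measurable_snd_borel: "snd \<in> borel_measurable (borel :: ('a::topological_space \<times> 'b::topological_space) measure)"
  by (intro borel_measurable_continuous_onI continuous_intros)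

context planar_brownian_motion
begin

text \<open>The disjunct \<open>k = N\<close> makes the least element exist and bounds the time by
  \<open>N\<close>.\<close>

definition exit_step :: "(real \<times> real) set \<Rightarrow> nat \<Rightarrow> nat \<Rightarrow> real \<times> real \<Rightarrow> 'w \<Rightarrow> nat" where
  "exit_step U n N p \<omega> = (LEAST k :: nat. k = N \<or> started_at p B (k / 2 ^ n) \<omega> \<notin> U)"

lemma exit_step_le: "exit_step U n N p \<omega> \<le> N"
  unfolding exit_step_def by (rule Least_le) simp

lemma exit_step_cases:
  "exit_step U n N p \<omega> = N \<or> started_at p B (exit_step U n N p \<omega> / 2 ^ n) \<omega> \<notin> U"
  unfolding exit_step_def
  using LeastI[of "\<lambda>k. k = N \<or> started_at p B (real k / 2 ^ n) \<omega> \<notin> U" N] by simp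

text \<open>Survival beyond step \<open>k\<close> is read off the positions at steps up to
  \<open>k\<close> alone; this is the stopping time property.\<close>

lemma less_exit_step_iff:
  "k < exit_step U n N p \<omega> \<longleftrightarrow> k < N \<and> (\<forall>j\<in>{..k}. started_at p B (j / 2 ^ n) \<omega> \<in> U)"
proof
  assume "k < exit_step U n N p \<omega>"
  then have "\<not> (j = N \<or> started_at p B (j / 2 ^ n) \<omega> \<notin> U)" if "j \<le> k" for j :: nat
    using that unfolding exit_step_def by (intro not_less_Least) auto
  then show "k < N \<and> (\<forall>j\<in>{..k}. started_at p B (j / 2 ^ n) \<omega> \<in> U)"
    using \<open>k < exit_step U n N p \<omega>\<close> exit_step_le[of U n N p \<omega>] by fastforce
next
  assume *: "k < N \<and> (\<forall>j\<in>{..k}. started_at p B (j / 2 ^ n) \<omega> \<in> U)"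
  show "k < exit_step U n N p \<omega>"
    using * exit_step_cases[of U n N p \<omega>] by (metis atMost_iff linorder_not_less)
qed

lemma alive_measurable:
  assumes [measurable]: "U \<in> sets borel"
  shows "(\<lambda>\<omega>. of_bool (k < exit_step U n N p \<omega>) :: real) \<in> borel_measurable (past n k)"
    "(\<lambda>\<omega>. of_bool (k < exit_step U n N p \<omega>) :: real) \<in> borel_measurable M"
proof -
  have eq: "(of_bool (k < exit_step U n N p \<omega>) :: real) =
      of_bool (k < N) * (\<Prod>j\<le>k. indicator U (started_at p B (j / 2 ^ n) \<omega>))" for \<omega>
    by (auto simp: less_exit_step_iff indicator_def of_bool_def prod_zero_iff)
  have ind: "indicator U \<in> borel_measurable (borel :: (real \<times> real) measure)"
    by measurable
  have "(\<lambda>\<omega>. indicator U (started_at p B (j / 2 ^ n) \<omega>) :: real) \<in> borel_measurable (past n k)" if "j \<le> k" for j :: nat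
    using measurable_start_past[OF that] by (rule measurable_compose) measurable
  then show "(\<lambda>\<omega>. of_bool (k < exit_step U n N p \<omega>) :: real) \<in> borel_measurable (past n k)"
    unfolding eq by (intro borel_measurable_times borel_measurable_const borel_measurable_prod) auto
  have "(\<lambda>\<omega>. indicator U (started_at p B (j / 2 ^ n) \<omega>) :: real) \<in> borel_measurable M" for j :: nat
    by (rule measurable_compose[OF measurable_start]) (simp, measurable)
  then show "(\<lambda>\<omega>. of_bool (k < exit_step U n N p \<omega>) :: real) \<in> borel_measurable M"
    unfolding eq by (intro borel_measurable_times borel_measurable_const borel_measurable_prod) auto
qed

text \<open>One step of a submartingale transform: the weight \<open>G\<close> is known at step
  \<open>k\<close>, and \<open>le\<close> is the one-step inequality from every starting
  point.\<close>

lemma increment_nonneg: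
  fixes f g :: "real \<times> real \<Rightarrow> real" and G :: "'w \<Rightarrow> real"
  assumes G: "G \<in> borel_measurable (past n k)" "\<And>\<omega>. 0 \<le> G \<omega>"
    and fg [measurable]: "f \<in> borel_measurable borel" "g \<in> borel_measurable borel"
    and int: "integrable M (\<lambda>\<omega>. G \<omega> * (f (started_at p B (Suc k / 2 ^ n) \<omega>) - g (started_at p B (k / 2 ^ n) \<omega>)))"
    and f: "\<And>z. integrable (gauss2 (1 / 2 ^ n)) (\<lambda>w. f (z + sqrt 2 *\<^sub>R w))"
    and le: "\<And>z. g z \<le> (\<integral>w. f (z + sqrt 2 *\<^sub>R w) \<partial>gauss2 (1 / 2 ^ n))"
  shows "0 \<le> (\<integral>\<omega>. G \<omega> * (f (started_at p B (Suc k / 2 ^ n) \<omega>) - g (started_at p B (k / 2 ^ n) \<omega>)) \<partial>M)"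
proof -
  interpret Q: prob_space "gauss2 (1 / 2 ^ n)" by (rule prob_space_gauss2)
  define Z where "Z \<omega> = (G \<omega>, started_at p B (k / 2 ^ n) \<omega>)" for \<omega>
  \<comment> \<open>The absolute value keeps the inner integral nonnegative at every frozen value,
    also at negative first components, which \<open>G\<close> never takes.\<close>
  define \<phi> :: "(real \<times> real \<times> real) \<times> (real \<times> real) \<Rightarrow> real" where
    "\<phi> x = \<bar>fst (fst x)\<bar> * (f (snd (fst x) + sqrt 2 *\<^sub>R snd x) - g (snd (fst x)))" for x
  have Z: "Z \<in> borel_measurable (past n k)"
    unfolding Z_def[abs_def] using G by (intro borel_measurable_Pair measurable_start_past) auto
  have eq: "G \<omega> * (f (started_at p B (Suc k / 2 ^ n) \<omega>) - g (started_at p B (k / 2 ^ n) \<omega>)) = \<phi> (Z \<omega>, step n k \<omega>)" for \<omega>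
    using G(2)[of \<omega>] by (simp add: \<phi>_def Z_def started_at_def algebra_simps)
  have 1: "(\<lambda>x. fst (fst x)) \<in> borel_measurable ((borel :: (real \<times> real \<times> real) measure) \<Otimes>\<^sub>M (borel :: (real \<times> real) measure))"
    by (rule measurable_compose[OF measurable_fst measurable_fst_borel])
  have 2: "(\<lambda>x. snd (fst x)) \<in> borel_measurable ((borel :: (real \<times> real \<times> real) measure) \<Otimes>\<^sub>M (borel :: (real \<times> real) measure))"
    by (rule measurable_compose[OF measurable_fst measurable_snd_borel])
  have 3: "snd \<in> borel_measurable ((borel :: (real \<times> real \<times> real) measure) \<Otimes>\<^sub>M (borel :: (real \<times> real) measure))"
    by (rule measurable_snd)
  have 4: "(\<lambda>x. snd (fst x) + sqrt 2 *\<^sub>R snd x) \<in> borel_measurable ((borel :: (real \<times> real \<times> real) measure) \<Otimes>\<^sub>M (borel :: (real \<times> real) measure))"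
    by (intro borel_measurable_add borel_measurable_scaleR borel_measurable_const 2 3)
  have \<phi>: "\<phi> \<in> borel_measurable (borel \<Otimes>\<^sub>M borel)"
    unfolding \<phi>_def[abs_def]
    by (intro borel_measurable_times borel_measurable_abs borel_measurable_diff 1
        measurable_compose[OF 4 fg(1)] measurable_compose[OF 2 fg(2)])
  have "0 \<le> (\<integral>w. \<phi> (z, w) \<partial>gauss2 (1 / 2 ^ n))" for z
    unfolding \<phi>_def using f[of "snd z"] le[of "snd z"] Q.prob_space by simp
  then show ?thesis
    using freeze_nonneg[OF Z \<phi>] int unfolding eq by blast
qed

lemma increment_zero:
  fixes G :: "'w \<Rightarrow> real"
  assumes G: "G \<in> borel_measurable (past n k)" "\<And>\<omega>. 0 \<le> G \<omega>" and f: "caloric f"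
    and int: "integrable M (\<lambda>\<omega>. G \<omega> * (f (Suc k / 2 ^ n) (started_at p B (Suc k / 2 ^ n) \<omega>) - f (k / 2 ^ n) (started_at p B (k / 2 ^ n) \<omega>)))"
  shows "(\<integral>\<omega>. G \<omega> * (f (Suc k / 2 ^ n) (started_at p B (Suc k / 2 ^ n) \<omega>) - f (k / 2 ^ n) (started_at p B (k / 2 ^ n) \<omega>)) \<partial>M) = 0"
    (is "?I = 0")
proof -
  have t: "real (Suc k) / 2 ^ n = real k / 2 ^ n + 1 / 2 ^ n"
    by (simp add: add_divide_distrib)
  have mean: "(\<integral>w. f (Suc k / 2 ^ n) (z + sqrt 2 *\<^sub>R w) \<partial>gauss2 (1 / 2 ^ n)) = f (k / 2 ^ n) z" for z
    unfolding t by (rule caloric_mean[OF f]) auto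
  have i: "integrable (gauss2 (1 / 2 ^ n)) (\<lambda>w. f (Suc k / 2 ^ n) (z + sqrt 2 *\<^sub>R w))" for z
    by (rule caloric_integrable[OF f]) simp
  have "0 \<le> ?I"
    by (rule increment_nonneg[OF G caloric_measurable(2)[OF f] caloric_measurable(2)[OF f] int i]) (simp only: mean)
  moreover have int': "integrable M (\<lambda>\<omega>. G \<omega> * (- f (Suc k / 2 ^ n) (started_at p B (Suc k / 2 ^ n) \<omega>) - - f (k / 2 ^ n) (started_at p B (k / 2 ^ n) \<omega>)))"
    using integrable_minus[OF int] by (simp add: right_diff_distrib)
  have "0 \<le> (\<integral>\<omega>. G \<omega> * (- f (Suc k / 2 ^ n) (started_at p B (Suc k / 2 ^ n) \<omega>) - - f (k / 2 ^ n) (started_at p B (k / 2 ^ n) \<omega>)) \<partial>M)"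
    by (rule increment_nonneg[OF G _ _ int'])
      (use i mean caloric_measurable(2)[OF f] in \<open>auto simp del: of_nat_Suc\<close>)
  moreover have "\<dots> = - ?I"
    unfolding Bochner_Integration.integral_minus[symmetric] by (intro Bochner_Integration.integral_cong) (auto simp: algebra_simps)
  ultimately show ?thesis by linarith
qed

lemma integrable_alive_times:
  assumes "U \<in> sets borel" "integrable M g"
  shows "integrable M (\<lambda>\<omega>. of_bool (k < exit_step U n N p \<omega>) * g \<omega> :: real)"
  using assms(2)
proof (rule Bochner_Integration.integrable_bound)
  show "(\<lambda>\<omega>. of_bool (k < exit_step U n N p \<omega>) * g \<omega>) \<in> borel_measurable M"
    using alive_measurable(2)[OF assms(1)] borel_measurable_integrable[OF assms(2)]
    by (rule borel_measurable_times)
qed (auto simp: of_bool_def)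

text \<open>The stopped value telescopes into increments weighted by the indicator that the walk is
  still running, and each of them has mean zero by the mean value property.\<close>

lemma optional_stopping_grid:
  assumes U: "U \<in> sets borel" and f: "caloric f"
  shows "(\<integral>\<omega>. f (exit_step U n N p \<omega> / 2 ^ n) (started_at p B (exit_step U n N p \<omega> / 2 ^ n) \<omega>) \<partial>M) = f 0 p"
proof -
  define g where "g k \<omega> = f (real k / 2 ^ n) (started_at p B (k / 2 ^ n) \<omega>)" for k :: nat and \<omega>
  define A where "A k \<omega> = (of_bool (k < exit_step U n N p \<omega>) :: real)" for k \<omega>
  have int: "integrable M (g k)" for k
    unfolding g_def by (rule integrable_caloric[OF f]) simp
  have int': "integrable M (\<lambda>\<omega>. A k \<omega> * (g (Suc k) \<omega> - g k \<omega>))" for k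
    unfolding A_def by (intro integrable_alive_times[OF U] Bochner_Integration.integrable_diff int)
  have zero: "(\<integral>\<omega>. A k \<omega> * (g (Suc k) \<omega> - g k \<omega>) \<partial>M) = 0" for k
    using int'[of k] unfolding g_def
    by (intro increment_zero[OF _ _ f]) (auto simp: A_def alive_measurable[OF U])
  have eq: "g (exit_step U n N p \<omega>) \<omega> = f 0 p + (\<Sum>k<N. A k \<omega> * (g (Suc k) \<omega> - g k \<omega>))" if "\<omega> \<in> space M" for \<omega>
    using sum_stopped_telescope[OF exit_step_le, of "\<lambda>k. g k \<omega>" U n N p \<omega>] that starts_at_origin
    by (simp add: A_def g_def started_at_def)
  have "(\<integral>\<omega>. g (exit_step U n N p \<omega>) \<omega> \<partial>M) = (\<integral>\<omega>. f 0 p + (\<Sum>k<N. A k \<omega> * (g (Suc k) \<omega> - g k \<omega>)) \<partial>M)"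
    by (rule Bochner_Integration.integral_cong[OF refl eq])
  also have "\<dots> = f 0 p"
    using int' zero prob_space by (simp add: Bochner_Integration.integral_sum)
  finally show ?thesis
    by (simp add: g_def)
qed

lemma integrable_stopped_power:
  assumes U: "U \<in> sets borel"
  shows "integrable M (\<lambda>\<omega>. norm (started_at p B (min k (exit_step U n N p \<omega>) / 2 ^ n) \<omega>) ^ m)"
proof -
  define g where "g k \<omega> = norm (started_at p B (real k / 2 ^ n) \<omega>) ^ m" for k \<omega>
  have int: "integrable M (g k)" for k
    unfolding g_def by (rule integrable_start_bounded[where K = 1 and m = m]) (auto intro!: power_mono)
  have "integrable M (\<lambda>\<omega>. g 0 \<omega> + (\<Sum>j<k. of_bool (j < exit_step U n N p \<omega>) * (g (Suc j) \<omega> - g j \<omega>)))"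
    by (intro Bochner_Integration.integrable_add int Bochner_Integration.integrable_sum
        integrable_alive_times[OF U] Bochner_Integration.integrable_diff)
  moreover have "g 0 \<omega> + (\<Sum>j<k. of_bool (j < exit_step U n N p \<omega>) * (g (Suc j) \<omega> - g j \<omega>)) =
      g (min k (exit_step U n N p \<omega>)) \<omega>" for \<omega>
  proof -
    have "(\<Sum>j<k. of_bool (j < exit_step U n N p \<omega>) * (g (Suc j) \<omega> - g j \<omega>)) =
        (\<Sum>j<k. of_bool (j < min k (exit_step U n N p \<omega>)) * (g (Suc j) \<omega> - g j \<omega>))"
      by (intro sum.cong) auto
    then show ?thesis
      using sum_stopped_telescope[of "min k (exit_step U n N p \<omega>)" k "\<lambda>k. g k \<omega>"] by simp
  qed
  ultimately show ?thesis
    by (simp add: g_def)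
qed

text \<open>\<open>doob_pathwise\<close> is applied to the stopped values of \<open>F\<close>, whose
  square is the power in the claim. The integrand is the running maximum \<open>m\<close> of the
  stopped sequence; as long as the walk is running it equals the maximum \<open>m'\<close> of the
  unstopped one, which is measurable with respect to the past.\<close>

lemma doob_grid:
  fixes n N :: nat and p :: "real \<times> real" and U
  defines "\<sigma> \<equiv> exit_step U n N p"
  assumes U: "U \<in> sets borel"
  shows "(\<integral>\<^sup>+\<omega>. (SUP j\<in>{..N}. ennreal (norm (started_at p B (min j (\<sigma> \<omega>) / 2 ^ n) \<omega>) ^ (4 * Suc r))) \<partial>M)
    \<le> ennreal (4 * (\<integral>\<omega>. norm (started_at p B (\<sigma> \<omega> / 2 ^ n) \<omega>) ^ (4 * Suc r) \<partial>M))"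
proof -
  define F where "F z = norm z ^ (2 * Suc r)" for z :: "real \<times> real"
  have [measurable]: "F \<in> borel_measurable borel"
    unfolding F_def[abs_def] by measurable
  have F0: "0 \<le> F z" for z by (simp add: F_def)
  have F2: "(F z)\<^sup>2 = norm z ^ (4 * Suc r)" for z
  proof -
    have "4 * Suc r = 2 * Suc r * 2"
      by simp
    then show ?thesis
      unfolding F_def by (simp only: power_mult)
  qed
  define Y where "Y k \<omega> = F (started_at p B (real k / 2 ^ n) \<omega>)" for k \<omega>
  define s where "s k \<omega> = Y (min k (\<sigma> \<omega>)) \<omega>" for k \<omega>
  define m where "m k \<omega> = Max ((\<lambda>j. s j \<omega>) ` {..k})" for k \<omega>
  define m' where "m' k \<omega> = Max ((\<lambda>j. Y j \<omega>) ` {..k})" for k \<omega>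
  define A where "A k \<omega> = (of_bool (k < \<sigma> \<omega>) :: real)" for k \<omega>
  have Y0: "0 \<le> Y k \<omega>" for k \<omega> by (simp add: Y_def F0)
  have m'0: "0 \<le> m' k \<omega>" for k \<omega>
    unfolding m'_def by (rule Max_ge_iff[THEN iffD2]) (auto simp: Y0)
  have m'_le: "m' k \<omega> \<le> (\<Sum>j\<le>k. Y j \<omega>)" for k \<omega>
    unfolding m'_def by (rule Max.boundedI) (auto intro!: member_le_sum Y0)
  have Y_past: "Y j \<in> borel_measurable (past n k)" if "j \<le> k" for j k
    unfolding Y_def by (rule measurable_compose[OF measurable_start_past[OF that]]) measurable
  have Y_M [measurable]: "Y j \<in> borel_measurable M" for j
    unfolding Y_def by (rule measurable_compose[OF measurable_start]) (simp, measurable)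
  have m'_past: "m' k \<in> borel_measurable (past n k)" for k
    unfolding m'_def[abs_def] by (intro borel_measurable_Max Y_past) auto
  have m'_M: "m' k \<in> borel_measurable M" for k
    unfolding m'_def[abs_def] by (intro borel_measurable_Max Y_M) auto
  have Y2: "integrable M (\<lambda>\<omega>. (Y k \<omega>)\<^sup>2)" for k
    unfolding Y_def F2 by (rule integrable_start_bounded[where K = 1 and m = "4 * Suc r"]) (auto intro!: power_mono)
  have int: "integrable M (\<lambda>\<omega>. A k \<omega> * m' k \<omega> * (Y (Suc k) \<omega> - Y k \<omega>))" for k
  proof (rule Bochner_Integration.integrable_bound)
    show "integrable M (\<lambda>\<omega>. (\<Sum>j\<le>Suc k. real (Suc (Suc k)) * (Y j \<omega>)\<^sup>2))"
      using Y2 by auto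
    show "(\<lambda>\<omega>. A k \<omega> * m' k \<omega> * (Y (Suc k) \<omega> - Y k \<omega>)) \<in> borel_measurable M"
      using alive_measurable(2)[OF U] m'_M unfolding A_def \<sigma>_def by measurable
    \<comment> \<open>The maximum and the increment are both at most the sum of all
      \<open>Y j\<close>; Cauchy-Schwarz bounds the square of this sum by a multiple of the sum of
      squares.\<close>
    show "AE \<omega> in M. norm (A k \<omega> * m' k \<omega> * (Y (Suc k) \<omega> - Y k \<omega>)) \<le>
        norm (\<Sum>j\<le>Suc k. real (Suc (Suc k)) * (Y j \<omega>)\<^sup>2)"
    proof (intro AE_I2)
      fix \<omega>
      let ?S = "\<Sum>j\<le>Suc k. Y j \<omega>"
      have 0: "0 \<le> ?S" "0 \<le> (\<Sum>j\<le>k. Y j \<omega>)"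
        by (rule sum_nonneg, rule Y0)+
      have "\<bar>A k \<omega>\<bar> \<le> 1" by (simp add: A_def)
      moreover have "\<bar>m' k \<omega>\<bar> \<le> ?S"
        using m'_le[of k \<omega>] m'0[of k \<omega>] Y0[of "Suc k" \<omega>] by simp
      moreover have "\<bar>Y (Suc k) \<omega> - Y k \<omega>\<bar> \<le> ?S"
      proof -
        have "Y (Suc k) \<omega> \<le> ?S" "Y k \<omega> \<le> ?S"
          by (auto intro!: member_le_sum Y0 simp del: sum.atMost_Suc)
        then show ?thesis using Y0[of "Suc k" \<omega>] Y0[of k \<omega>] by linarith
      qed
      ultimately have "\<bar>A k \<omega>\<bar> * \<bar>m' k \<omega>\<bar> * \<bar>Y (Suc k) \<omega> - Y k \<omega>\<bar> \<le> 1 * ?S * ?S"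
        using 0 by (intro mult_mono) auto
      also have "\<dots> = (\<Sum>j\<le>Suc k. Y j \<omega>)\<^sup>2"
        by (simp add: power2_eq_square)
      also have "\<dots> \<le> real (card {..Suc k}) * (\<Sum>j\<le>Suc k. (Y j \<omega>)\<^sup>2)"
        using sum_squared_le_sum_of_squares[of "\<lambda>j. Y j \<omega>" "{..Suc k}"] by (simp add: mult.commute)
      also have "\<dots> = (\<Sum>j\<le>Suc k. real (Suc (Suc k)) * (Y j \<omega>)\<^sup>2)"
        by (simp only: sum_distrib_left card_atMost)
      finally show "norm (A k \<omega> * m' k \<omega> * (Y (Suc k) \<omega> - Y k \<omega>)) \<le>
          norm (\<Sum>j\<le>Suc k. real (Suc (Suc k)) * (Y j \<omega>)\<^sup>2)"
        unfolding real_norm_def abs_mult by (rule order_trans[OF _ abs_ge_self])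
    qed
  qed
  have nonneg: "0 \<le> (\<integral>\<omega>. A k \<omega> * m' k \<omega> * (Y (Suc k) \<omega> - Y k \<omega>) \<partial>M)" for k
  proof -
    have "0 \<le> (\<integral>\<omega>. (A k \<omega> * m' k \<omega>) * (F (started_at p B (Suc k / 2 ^ n) \<omega>) - F (started_at p B (k / 2 ^ n) \<omega>)) \<partial>M)"
    proof (rule increment_nonneg)
      show "(\<lambda>\<omega>. A k \<omega> * m' k \<omega>) \<in> borel_measurable (past n k)"
        using alive_measurable(1)[OF U] m'_past unfolding A_def \<sigma>_def by measurable
      show "integrable M (\<lambda>\<omega>. A k \<omega> * m' k \<omega> * (F (started_at p B (real (Suc k) / 2 ^ n) \<omega>) - F (started_at p B (real k / 2 ^ n) \<omega>)))"
        using int[of k] by (simp add: Y_def)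
      show "F z \<le> (\<integral>w. F (z + sqrt 2 *\<^sub>R w) \<partial>gauss2 (1 / 2 ^ n))" for z
        unfolding F_def by (rule gauss2_norm_power_ge) simp
      show "integrable (gauss2 (1 / 2 ^ n)) (\<lambda>w. F (z + sqrt 2 *\<^sub>R w))" for z
        unfolding F_def by (rule integrable_gauss2_norm_shift)
    qed (auto simp: A_def m'0)
    then show ?thesis by (simp add: Y_def)
  qed
  have incr: "m k \<omega> * (s (Suc k) \<omega> - s k \<omega>) = A k \<omega> * m' k \<omega> * (Y (Suc k) \<omega> - Y k \<omega>)" for k \<omega>
  proof (cases "k < \<sigma> \<omega>")
    case True
    then have "m k \<omega> = m' k \<omega>"
      unfolding m_def m'_def s_def by (intro arg_cong[where f = Max] image_cong) auto
    then show ?thesis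
      using True by (simp add: A_def s_def)
  qed (simp add: A_def s_def)
  have doob: "(m N \<omega>)\<^sup>2 \<le> 4 * (Y (\<sigma> \<omega>) \<omega>)\<^sup>2 - 4 * (\<Sum>i<N. A i \<omega> * m' i \<omega> * (Y (Suc i) \<omega> - Y i \<omega>))" for \<omega>
  proof -
    have "s N \<omega> = Y (\<sigma> \<omega>) \<omega>"
      using exit_step_le[of U n N p \<omega>] by (simp add: s_def \<sigma>_def min_absorb2)
    then show ?thesis
      using doob_pathwise[of "\<lambda>k. s k \<omega>" N] by (simp add: m_def[symmetric] incr)
  qed
  have Ys: "integrable M (\<lambda>\<omega>. (Y (\<sigma> \<omega>) \<omega>)\<^sup>2)"
  proof -
    have "integrable M (\<lambda>\<omega>. norm (started_at p B (min N (exit_step U n N p \<omega>) / 2 ^ n) \<omega>) ^ (4 * Suc r))"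
      by (rule integrable_stopped_power[OF U])
    then show ?thesis
      unfolding Y_def F2 \<sigma>_def by (simp add: min_absorb2 exit_step_le)
  qed
  have "(\<integral>\<^sup>+\<omega>. (SUP j\<in>{..N}. ennreal (norm (started_at p B (min j (\<sigma> \<omega>) / 2 ^ n) \<omega>) ^ (4 * Suc r))) \<partial>M) \<le>
      (\<integral>\<^sup>+\<omega>. ennreal (4 * (Y (\<sigma> \<omega>) \<omega>)\<^sup>2 - 4 * (\<Sum>i<N. A i \<omega> * m' i \<omega> * (Y (Suc i) \<omega> - Y i \<omega>))) \<partial>M)"
  proof (intro nn_integral_mono SUP_least ennreal_leI)
    fix \<omega> j assume "j \<in> {..N}"
    then have "s j \<omega> \<le> m N \<omega>"
      unfolding m_def by (intro Max_ge) auto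
    then have "(s j \<omega>)\<^sup>2 \<le> (m N \<omega>)\<^sup>2"
      by (intro power_mono) (auto simp: s_def Y0)
    then show "norm (started_at p B (real (min j (\<sigma> \<omega>)) / 2 ^ n) \<omega>) ^ (4 * Suc r) \<le>
      4 * (Y (\<sigma> \<omega>) \<omega>)\<^sup>2 - 4 * (\<Sum>i<N. A i \<omega> * m' i \<omega> * (Y (Suc i) \<omega> - Y i \<omega>))"
      using doob[of \<omega>] by (simp only: s_def Y_def F2)
  qed
  also have "\<dots> = ennreal (\<integral>\<omega>. 4 * (Y (\<sigma> \<omega>) \<omega>)\<^sup>2 - 4 * (\<Sum>i<N. A i \<omega> * m' i \<omega> * (Y (Suc i) \<omega> - Y i \<omega>)) \<partial>M)"
  proof (rule nn_integral_eq_integral)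
    show "integrable M (\<lambda>\<omega>. 4 * (Y (\<sigma> \<omega>) \<omega>)\<^sup>2 - 4 * (\<Sum>i<N. A i \<omega> * m' i \<omega> * (Y (Suc i) \<omega> - Y i \<omega>)))"
      using Ys int by (intro Bochner_Integration.integrable_diff integrable_mult_right Bochner_Integration.integrable_sum) auto
    show "AE \<omega> in M. 0 \<le> 4 * (Y (\<sigma> \<omega>) \<omega>)\<^sup>2 - 4 * (\<Sum>i<N. A i \<omega> * m' i \<omega> * (Y (Suc i) \<omega> - Y i \<omega>))"
      by (intro AE_I2 order_trans[OF zero_le_power2 doob])
  qed
  also have "\<dots> \<le> ennreal (4 * (\<integral>\<omega>. (Y (\<sigma> \<omega>) \<omega>)\<^sup>2 \<partial>M))"
  proof (rule ennreal_leI)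
    have "(\<integral>\<omega>. 4 * (Y (\<sigma> \<omega>) \<omega>)\<^sup>2 - 4 * (\<Sum>i<N. A i \<omega> * m' i \<omega> * (Y (Suc i) \<omega> - Y i \<omega>)) \<partial>M) =
      4 * (\<integral>\<omega>. (Y (\<sigma> \<omega>) \<omega>)\<^sup>2 \<partial>M) - 4 * (\<Sum>i<N. \<integral>\<omega>. A i \<omega> * m' i \<omega> * (Y (Suc i) \<omega> - Y i \<omega>) \<partial>M)"
      using Ys int by (simp add: Bochner_Integration.integral_diff Bochner_Integration.integral_sum)
    also have "\<dots> \<le> 4 * (\<integral>\<omega>. (Y (\<sigma> \<omega>) \<omega>)\<^sup>2 \<partial>M)"
      using nonneg by (simp add: sum_nonneg)
    finally show "(\<integral>\<omega>. 4 * (Y (\<sigma> \<omega>) \<omega>)\<^sup>2 - 4 * (\<Sum>i<N. A i \<omega> * m' i \<omega> * (Y (Suc i) \<omega> - Y i \<omega>)) \<partial>M)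
      \<le> 4 * (\<integral>\<omega>. (Y (\<sigma> \<omega>) \<omega>)\<^sup>2 \<partial>M)" .
  qed
  finally show ?thesis
    unfolding Y_def F2 .
qed

end

subsection \<open>Passage to continuous time\<close>

lemma floor_dyadic_tendsto:
  fixes t :: real
  assumes "0 \<le> t"
  shows "(\<lambda>n. real (nat \<lfloor>2 ^ n * t\<rfloor>) / 2 ^ n) \<longlonglongrightarrow> t" "real (nat \<lfloor>2 ^ n * t\<rfloor>) / 2 ^ n \<le> t"
proof -
  have le: "real (nat \<lfloor>2 ^ n * t\<rfloor>) / 2 ^ n \<le> t" for n
    using assms by (simp add: divide_le_eq mult.commute)
  have ge: "t - (1 / 2) ^ n \<le> real (nat \<lfloor>2 ^ n * t\<rfloor>) / 2 ^ n" for n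
  proof -
    have "2 ^ n * t - 1 \<le> real (nat \<lfloor>2 ^ n * t\<rfloor>)"
      using assms by linarith
    then have "(2 ^ n * t - 1) / 2 ^ n \<le> real (nat \<lfloor>2 ^ n * t\<rfloor>) / 2 ^ n"
      by (rule divide_right_mono) simp
    then show ?thesis
      by (simp add: diff_divide_distrib power_one_over)
  qed
  have "(\<lambda>n. t - (1 / 2) ^ n) \<longlonglongrightarrow> t - 0"
    by (intro tendsto_intros LIMSEQ_realpow_zero) auto
  then show "(\<lambda>n. real (nat \<lfloor>2 ^ n * t\<rfloor>) / 2 ^ n) \<longlonglongrightarrow> t"
    using tendsto_sandwich[of "\<lambda>n. t - (1 / 2) ^ n" "\<lambda>n. real (nat \<lfloor>2 ^ n * t\<rfloor>) / 2 ^ n" sequentially "\<lambda>_. t" t]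
      le ge by simp
  show "real (nat \<lfloor>2 ^ n * t\<rfloor>) / 2 ^ n \<le> t" by (rule le)
qed

context planar_brownian_motion
begin

lemma start_continuous: "\<omega> \<in> space M \<Longrightarrow> continuous_on {0..} (\<lambda>t. started_at p B t \<omega>)"
  unfolding started_at_def by (intro continuous_intros continuous_paths)

lemma start_tendsto:
  assumes "\<omega> \<in> space M" "\<And>n. 0 \<le> s n" "s \<longlonglongrightarrow> t"
  shows "(\<lambda>n. started_at p B (s n) \<omega>) \<longlonglongrightarrow> started_at p B t \<omega>"
proof -
  have "0 \<le> t"
    using assms(2,3) by (intro LIMSEQ_le_const[OF assms(3)]) auto
  then show ?thesis
    using continuous_on_tendsto_compose[OF start_continuous[OF assms(1)] assms(3)] assms(2) by auto
qed

text \<open>Dyadic rounding from below gives a time with countably many values, and continuity of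
  the paths passes to the limit.\<close>

lemma measurable_stopped [measurable (raw)]:
  assumes [measurable]: "\<theta> \<in> borel_measurable M" and pos: "\<And>\<omega>. \<omega> \<in> space M \<Longrightarrow> 0 \<le> \<theta> \<omega>"
  shows "(\<lambda>\<omega>. started_at p B (\<theta> \<omega>) \<omega>) \<in> borel_measurable M"
proof (rule borel_measurable_LIMSEQ_metric)
  fix n :: nat
  have "(\<lambda>\<omega>. nat \<lfloor>2 ^ n * \<theta> \<omega>\<rfloor>) \<in> measurable M (count_space UNIV)"
    by measurable
  then show "(\<lambda>\<omega>. started_at p B (real (nat \<lfloor>2 ^ n * \<theta> \<omega>\<rfloor>) / 2 ^ n) \<omega>) \<in> borel_measurable M"
    by (rule measurable_compose_countable[rotated]) (rule measurable_start, simp)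
next
  fix \<omega> assume "\<omega> \<in> space M"
  then show "(\<lambda>n. started_at p B (real (nat \<lfloor>2 ^ n * \<theta> \<omega>\<rfloor>) / 2 ^ n) \<omega>) \<longlonglongrightarrow> started_at p B (\<theta> \<omega>) \<omega>"
    by (intro start_tendsto floor_dyadic_tendsto pos) auto
qed

text \<open>The set \<open>L\<close> of admitted grid levels is needed because the maximal inequality for a path stopped on
  the grid of level \<open>n\<close> only concerns that grid; it is extended to all levels in the limit.\<close>

definition runsup :: "real \<times> real \<Rightarrow> nat \<Rightarrow> nat set \<Rightarrow> ('w \<Rightarrow> real) \<Rightarrow> 'w \<Rightarrow> ennreal" where
  "runsup p r L \<theta> \<omega> = (SUP (n, j)\<in>L \<times> UNIV. ennreal (norm (started_at p B (min (real j / 2 ^ n) (\<theta> \<omega>)) \<omega>) ^ (4 * Suc r)))"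

lemma measurable_runsup:
  assumes "\<theta> \<in> borel_measurable M" and "\<And>\<omega>. \<omega> \<in> space M \<Longrightarrow> 0 \<le> \<theta> \<omega>"
  shows "runsup p r L \<theta> \<in> borel_measurable M"
proof -
  have "(\<lambda>\<omega>. SUP nj\<in>L \<times> UNIV. ennreal (norm (started_at p B (min (real (snd nj) / 2 ^ fst nj) (\<theta> \<omega>)) \<omega>) ^ (4 * Suc r))) \<in> borel_measurable M"
  proof (rule borel_measurable_SUP)
    fix nj :: "nat \<times> nat"
    have [measurable]: "(\<lambda>\<omega>. started_at p B (min (real (snd nj) / 2 ^ fst nj) (\<theta> \<omega>)) \<omega>) \<in> borel_measurable M"
      using assms by (intro measurable_stopped) auto
    show "(\<lambda>\<omega>. ennreal (norm (started_at p B (min (real (snd nj) / 2 ^ fst nj) (\<theta> \<omega>)) \<omega>) ^ (4 * Suc r))) \<in> borel_measurable M"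
      by measurable
  qed (rule countable_subset[OF subset_UNIV], simp)
  then show ?thesis
    by (simp add: runsup_def[abs_def] case_prod_unfold)
qed

lemma runsup_upper:
  "n \<in> L \<Longrightarrow> ennreal (norm (started_at p B (min (real j / 2 ^ n) (\<theta> \<omega>)) \<omega>) ^ (4 * Suc r)) \<le> runsup p r L \<theta> \<omega>"
  unfolding runsup_def by (rule SUP_upper2[of "(n, j)"]) auto

lemma runsup_liminf:
  assumes \<omega>: "\<omega> \<in> space M" and pos: "\<And>n. 0 \<le> \<theta> n \<omega>" and lim: "(\<lambda>n. \<theta> n \<omega>) \<longlonglongrightarrow> \<theta>' \<omega>"
    and L: "\<And>m. m \<in> L' \<Longrightarrow> \<forall>\<^sub>F n in sequentially. m \<in> L n"
  shows "runsup p r L' \<theta>' \<omega> \<le> liminf (\<lambda>n. runsup p r (L n) (\<theta> n) \<omega>)"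
  unfolding runsup_def[of p r L']
proof (rule SUP_least, safe)
  fix m j :: nat assume m: "m \<in> L'"
  let ?q = "real j / 2 ^ m"
  have "(\<lambda>n. ennreal (norm (started_at p B (min ?q (\<theta> n \<omega>)) \<omega>) ^ (4 * Suc r))) \<longlonglongrightarrow>
      ennreal (norm (started_at p B (min ?q (\<theta>' \<omega>)) \<omega>) ^ (4 * Suc r))"
    using pos lim by (intro tendsto_intros tendsto_ennrealI start_tendsto[OF \<omega>]) auto
  then have "ennreal (norm (started_at p B (min ?q (\<theta>' \<omega>)) \<omega>) ^ (4 * Suc r)) =
      liminf (\<lambda>n. ennreal (norm (started_at p B (min ?q (\<theta> n \<omega>)) \<omega>) ^ (4 * Suc r)))"
    by (rule lim_imp_Liminf[OF trivial_limit_sequentially, symmetric])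
  also have "\<dots> \<le> liminf (\<lambda>n. runsup p r (L n) (\<theta> n) \<omega>)"
    using L[OF m] by (intro Liminf_mono) (auto elim!: eventually_mono intro: runsup_upper simp del: mult_Suc_right)
  finally show "ennreal (norm (started_at p B (min ?q (\<theta>' \<omega>)) \<omega>) ^ (4 * Suc r)) \<le>
      liminf (\<lambda>n. runsup p r (L n) (\<theta> n) \<omega>)" .
qed

text \<open>Dyadic times are dense and paths are continuous, so the countable supremum controls the
  whole path up to \<open>\<theta>\<close>.\<close>

lemma runsup_path:
  assumes \<omega>: "\<omega> \<in> space M" and t: "0 \<le> t" "t \<le> \<theta> \<omega>"
  shows "ennreal (norm (started_at p B t \<omega>) ^ (4 * Suc r)) \<le> runsup p r UNIV \<theta> \<omega>"
proof -
  let ?q = "\<lambda>n. real (nat \<lfloor>2 ^ n * t\<rfloor>) / 2 ^ n"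
  have "(\<lambda>n. ennreal (norm (started_at p B (?q n) \<omega>) ^ (4 * Suc r))) \<longlonglongrightarrow> ennreal (norm (started_at p B t \<omega>) ^ (4 * Suc r))"
    by (intro tendsto_intros tendsto_ennrealI start_tendsto[OF \<omega>] floor_dyadic_tendsto t) auto
  moreover have "ennreal (norm (started_at p B (?q n) \<omega>) ^ (4 * Suc r)) \<le> runsup p r UNIV \<theta> \<omega>" for n
  proof -
    have "min (?q n) (\<theta> \<omega>) = ?q n"
      using floor_dyadic_tendsto(2)[OF t(1), of n] t(2) by linarith
    then show ?thesis
      using runsup_upper[of n UNIV p "nat \<lfloor>2 ^ n * t\<rfloor>" \<theta> \<omega> r] by (simp only: UNIV_I simp_thms)
  qed
  ultimately show ?thesis
    by (intro LIMSEQ_le_const2[where x = "ennreal (norm (started_at p B t \<omega>) ^ (4 * Suc r))"]) blast+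
qed

text \<open>Every time of a level \<open>m \<le> n\<close> is also a time of level \<open>n\<close>,
  and so is its minimum with the stopped time; hence the supremum only meets positions on the grid
  of level \<open>n\<close>.\<close>

lemma runsup_grid:
  fixes N :: nat and n :: nat and U :: "(real \<times> real) set" and p :: "real \<times> real"
  defines "\<theta> \<equiv> \<lambda>\<omega>. real (exit_step U n N p \<omega>) / 2 ^ n"
  assumes U: "U \<in> sets borel"
  shows "(\<integral>\<^sup>+\<omega>. runsup p r {..n} \<theta> \<omega> \<partial>M) \<le> ennreal (4 * (\<integral>\<omega>. norm (started_at p B (\<theta> \<omega>) \<omega>) ^ (4 * Suc r) \<partial>M))"
proof -
  let ?\<sigma> = "exit_step U n N p"
  have "runsup p r {..n} \<theta> \<omega> \<le>
      (SUP j\<in>{..N}. ennreal (norm (started_at p B (min j (?\<sigma> \<omega>) / 2 ^ n) \<omega>) ^ (4 * Suc r)))" for \<omega>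
    unfolding runsup_def
  proof (rule SUP_least, safe)
    fix m i :: nat assume "m \<le> n"
    define j where "j = min (i * 2 ^ (n - m)) (N)"
    have q: "real i / 2 ^ m = real (i * 2 ^ (n - m)) / 2 ^ n"
    proof -
      have "(2 :: real) ^ n = 2 ^ m * 2 ^ (n - m)"
        using \<open>m \<le> n\<close> by (simp flip: power_add)
      then show ?thesis by simp
    qed
    have "min (real a / 2 ^ n) (real b / 2 ^ n) = real (min a b) / 2 ^ n" for a b :: nat
      by (auto simp: min_def divide_le_cancel)
    then have "min (real i / 2 ^ m) (\<theta> \<omega>) = real (min (i * 2 ^ (n - m)) (?\<sigma> \<omega>)) / 2 ^ n"
      unfolding \<theta>_def q .
    also have "min (i * 2 ^ (n - m)) (?\<sigma> \<omega>) = min j (?\<sigma> \<omega>)"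
      using exit_step_le[of U n "N" p \<omega>] by (auto simp: j_def)
    finally show "ennreal (norm (started_at p B (min (real i / 2 ^ m) (\<theta> \<omega>)) \<omega>) ^ (4 * Suc r)) \<le>
      (SUP j\<in>{..N}. ennreal (norm (started_at p B (min j (?\<sigma> \<omega>) / 2 ^ n) \<omega>) ^ (4 * Suc r)))"
      by (intro SUP_upper2[of j]) (auto simp: j_def)
  qed
  then have "(\<integral>\<^sup>+\<omega>. runsup p r {..n} \<theta> \<omega> \<partial>M) \<le>
      (\<integral>\<^sup>+\<omega>. (SUP j\<in>{..N}. ennreal (norm (started_at p B (min j (?\<sigma> \<omega>) / 2 ^ n) \<omega>) ^ (4 * Suc r))) \<partial>M)"
    by (rule nn_integral_mono)
  also have "\<dots> \<le> ennreal (4 * (\<integral>\<omega>. norm (started_at p B (?\<sigma> \<omega> / 2 ^ n) \<omega>) ^ (4 * Suc r) \<partial>M))"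
    by (rule doob_grid[OF U])
  finally show ?thesis
    by (simp add: \<theta>_def)
qed

lemma exit_step_UNIV: "exit_step UNIV n N p \<omega> = N"
  using exit_step_cases[of UNIV n N p \<omega>] by auto

text \<open>Exit from \<open>UNIV\<close> never happens, so the grid exit is the fixed time
  \<open>K\<close>; \<open>r = 3\<close> gives the power 16 allowed in \<open>caloric\<close>.
  Fatou's lemma carries the bound from single grids to all dyadic times.\<close>

lemma dominating_path:
  "\<exists>D. integrable M D \<and> (AE \<omega> in M. \<forall>t\<in>{0..real K}. (1 + norm (started_at p B t \<omega>)) ^ 16 \<le> D \<omega>)"
proof -
  define C where "C = ennreal (4 * (\<integral>\<omega>. norm (started_at p B (real K) \<omega>) ^ (4 * Suc 3) \<partial>M))"
  have b: "(\<integral>\<^sup>+\<omega>. runsup p 3 {..n} (\<lambda>_. real K) \<omega> \<partial>M) \<le> C" for n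
    using runsup_grid[of UNIV p 3 n "K * 2 ^ n"] by (simp add: exit_step_UNIV C_def)
  have meas: "runsup p 3 L (\<lambda>_. real K) \<in> borel_measurable M" for L
    by (rule measurable_runsup) auto
  have "(\<integral>\<^sup>+\<omega>. runsup p 3 UNIV (\<lambda>_. real K) \<omega> \<partial>M) \<le> (\<integral>\<^sup>+\<omega>. liminf (\<lambda>n. runsup p 3 {..n} (\<lambda>_. real K) \<omega>) \<partial>M)"
    by (intro nn_integral_mono runsup_liminf) (auto intro: eventually_ge_at_top)
  also have "\<dots> \<le> liminf (\<lambda>n. \<integral>\<^sup>+\<omega>. runsup p 3 {..n} (\<lambda>_. real K) \<omega> \<partial>M)"
    by (rule nn_integral_liminf) (rule meas)
  also have "\<dots> \<le> C"
    using b by (intro Liminf_le) auto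
  finally have fin: "(\<integral>\<^sup>+\<omega>. runsup p 3 UNIV (\<lambda>_. real K) \<omega> \<partial>M) < \<infinity>"
    by (simp add: C_def le_less_trans)
  let ?R = "runsup p 3 UNIV (\<lambda>_. real K)"
  have ae: "AE \<omega> in M. ?R \<omega> \<noteq> \<infinity>"
    using fin by (intro nn_integral_PInf_AE meas) auto
  have int: "integrable M (\<lambda>\<omega>. enn2real (?R \<omega>))"
  proof (rule integrableI_nonneg)
    have "(\<integral>\<^sup>+\<omega>. ennreal (enn2real (?R \<omega>)) \<partial>M) \<le> (\<integral>\<^sup>+\<omega>. ?R \<omega> \<partial>M)"
      by (intro nn_integral_mono) (auto simp: ennreal_enn2real_if)
    then show "(\<integral>\<^sup>+\<omega>. ennreal (enn2real (?R \<omega>)) \<partial>M) < \<infinity>"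
      using fin by (rule le_less_trans)
  qed (use meas in measurable)
  show ?thesis
  proof (intro exI conjI)
    show "integrable M (\<lambda>\<omega>. 2 ^ 16 * (1 + enn2real (?R \<omega>)))"
      using int by auto
    show "AE \<omega> in M. \<forall>t\<in>{0..real K}. (1 + norm (started_at p B t \<omega>)) ^ 16 \<le> 2 ^ 16 * (1 + enn2real (?R \<omega>))"
      using ae AE_space
    proof (eventually_elim, intro ballI)
      fix \<omega> t assume \<omega>: "?R \<omega> \<noteq> \<infinity>" "\<omega> \<in> space M" and t: "t \<in> {0..real K}"
      have "ennreal (norm (started_at p B t \<omega>) ^ (4 * Suc 3)) \<le> ?R \<omega>"
        using \<omega> t by (intro runsup_path) auto
      then have "norm (started_at p B t \<omega>) ^ 16 \<le> enn2real (?R \<omega>)"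
        using \<omega> by (cases "?R \<omega>") (auto simp: top_unique)
      moreover have "(1 + norm (started_at p B t \<omega>)) ^ 16 \<le> 2 ^ 16 * (1 ^ 16 + norm (started_at p B t \<omega>) ^ 16)"
        by (rule power_add_le) auto
      ultimately show "(1 + norm (started_at p B t \<omega>)) ^ 16 \<le> 2 ^ 16 * (1 + enn2real (?R \<omega>))"
        by simp
    qed
  qed
qed

section \<open>A class of bounded times closed under limits\<close>

text \<open>Optional stopping and the maximal inequality are the definition itself, because they
  survive pointwise limits of the times; no filtration in continuous time enters. The maximal
  inequality is kept for the power 4 (\<open>r = 0\<close>), the one bounded uniformly in
  \<open>K\<close> in the unbounded domains.\<close>

definition stopping :: "nat \<Rightarrow> nat set \<Rightarrow> real \<times> real \<Rightarrow> ('w \<Rightarrow> real) \<Rightarrow> bool" where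
  "stopping K L p \<theta> \<longleftrightarrow> \<theta> \<in> borel_measurable M \<and> (\<forall>\<omega>\<in>space M. 0 \<le> \<theta> \<omega> \<and> \<theta> \<omega> \<le> real K) \<and>
    (\<forall>f. caloric f \<longrightarrow> (\<integral>\<omega>. f (\<theta> \<omega>) (started_at p B (\<theta> \<omega>) \<omega>) \<partial>M) = f 0 p) \<and>
    (\<integral>\<^sup>+\<omega>. runsup p 0 L \<theta> \<omega> \<partial>M) \<le> ennreal (4 * (\<integral>\<omega>. norm (started_at p B (\<theta> \<omega>) \<omega>) ^ 4 \<partial>M))"

lemma stopped_dominated_convergence:
  fixes g :: "real \<times> real \<times> real \<Rightarrow> real"
  assumes g: "continuous_on UNIV g" "\<And>t z. t \<in> {0..real K} \<Longrightarrow> \<bar>g (t, z)\<bar> \<le> C * (1 + norm z) ^ 16"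
    and \<theta>: "\<And>n. \<theta> n \<in> borel_measurable M" "\<And>n \<omega>. \<omega> \<in> space M \<Longrightarrow> 0 \<le> \<theta> n \<omega> \<and> \<theta> n \<omega> \<le> real K"
    and lim: "\<And>\<omega>. \<omega> \<in> space M \<Longrightarrow> (\<lambda>n. \<theta> n \<omega>) \<longlonglongrightarrow> \<theta>' \<omega>"
  shows "(\<lambda>n. \<integral>\<omega>. g (\<theta> n \<omega>, started_at p B (\<theta> n \<omega>) \<omega>) \<partial>M) \<longlonglongrightarrow> (\<integral>\<omega>. g (\<theta>' \<omega>, started_at p B (\<theta>' \<omega>) \<omega>) \<partial>M)"
proof -
  obtain D where D: "integrable M D" "AE \<omega> in M. \<forall>t\<in>{0..real K}. (1 + norm (started_at p B t \<omega>)) ^ 16 \<le> D \<omega>"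
    using dominating_path[of K p] by blast
  have C: "0 \<le> C"
    using g(2)[of 0 0] by (auto dest: order_trans[OF abs_ge_zero])
  have gm: "g \<in> borel_measurable borel"
    by (rule borel_measurable_continuous_onI[OF g(1)])
  have m: "(\<lambda>\<omega>. g (\<theta> \<omega>, started_at p B (\<theta> \<omega>) \<omega>)) \<in> borel_measurable M"
    if "\<theta> \<in> borel_measurable M" "\<And>\<omega>. \<omega> \<in> space M \<Longrightarrow> 0 \<le> \<theta> \<omega>" for \<theta>
    using that by (intro measurable_compose[OF _ gm] borel_measurable_Pair measurable_stopped)
  have \<theta>': "\<theta>' \<in> borel_measurable M"
    by (rule borel_measurable_LIMSEQ_metric[OF \<theta>(1) lim])
  have \<theta>'0: "0 \<le> \<theta>' \<omega>" if "\<omega> \<in> space M" for \<omega>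
    using \<theta>(2)[OF that] by (intro LIMSEQ_le_const[OF lim[OF that]]) auto
  show ?thesis
  proof (rule integral_dominated_convergence)
    show "integrable M (\<lambda>\<omega>. C * D \<omega>)"
      using D by auto
    show "AE \<omega> in M. (\<lambda>n. g (\<theta> n \<omega>, started_at p B (\<theta> n \<omega>) \<omega>)) \<longlonglongrightarrow> g (\<theta>' \<omega>, started_at p B (\<theta>' \<omega>) \<omega>)"
      using \<theta>(2) lim
      by (intro AE_I2 continuous_on_tendsto_compose[OF g(1)] tendsto_Pair start_tendsto) auto
    show "AE \<omega> in M. norm (g (\<theta> n \<omega>, started_at p B (\<theta> n \<omega>) \<omega>)) \<le> C * D \<omega>" for n
      using D(2) AE_space
    proof eventually_elim
      fix \<omega> assume \<omega>: "\<forall>t\<in>{0..real K}. (1 + norm (started_at p B t \<omega>)) ^ 16 \<le> D \<omega>" "\<omega> \<in> space M"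
      have "\<bar>g (\<theta> n \<omega>, started_at p B (\<theta> n \<omega>) \<omega>)\<bar> \<le> C * (1 + norm (started_at p B (\<theta> n \<omega>) \<omega>)) ^ 16"
        using \<theta>(2)[OF \<omega>(2)] by (intro g(2)) auto
      also have "\<dots> \<le> C * D \<omega>"
        using \<omega> \<theta>(2)[OF \<omega>(2)] C by (intro mult_left_mono) auto
      finally show "norm (g (\<theta> n \<omega>, started_at p B (\<theta> n \<omega>) \<omega>)) \<le> C * D \<omega>" by simp
    qed
  qed (use m \<theta> \<theta>' \<theta>'0 in auto)
qed

text \<open>Expectations at the stopped position converge by dominated convergence, on the bounded
  time interval up to \<open>K\<close>; the running supremum stands on the smaller side of its
  inequality, so Fatou's lemma suffices for it.\<close>

lemma stopping_limit:
  assumes st: "\<And>n. stopping K (L n) p (\<theta> n)"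
    and lim: "\<And>\<omega>. \<omega> \<in> space M \<Longrightarrow> (\<lambda>n. \<theta> n \<omega>) \<longlonglongrightarrow> \<theta>' \<omega>"
    and L: "\<And>m. m \<in> L' \<Longrightarrow> \<forall>\<^sub>F n in sequentially. m \<in> L n"
  shows "stopping K L' p \<theta>'"
  unfolding stopping_def
proof (intro conjI allI impI ballI)
  have \<theta>: "\<And>n. \<theta> n \<in> borel_measurable M" "\<And>n \<omega>. \<omega> \<in> space M \<Longrightarrow> 0 \<le> \<theta> n \<omega> \<and> \<theta> n \<omega> \<le> real K"
    using st unfolding stopping_def by blast+
  show "\<theta>' \<in> borel_measurable M"
    by (rule borel_measurable_LIMSEQ_metric[OF \<theta>(1) lim])
  show "0 \<le> \<theta>' \<omega>" "\<theta>' \<omega> \<le> real K" if "\<omega> \<in> space M" for \<omega>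
    using \<theta>(2)[OF that] by (intro LIMSEQ_le_const[OF lim[OF that]] LIMSEQ_le_const2[OF lim[OF that]]; auto)+
  show "(\<integral>\<omega>. f (\<theta>' \<omega>) (started_at p B (\<theta>' \<omega>) \<omega>) \<partial>M) = f 0 p" if f: "caloric f" for f
  proof -
    obtain C where C: "\<And>t z. t \<in> {0..real K} \<Longrightarrow> \<bar>f t z\<bar> \<le> C * (1 + norm z) ^ 16"
      using f unfolding caloric_def by blast
    have "(\<lambda>n. \<integral>\<omega>. case_prod f (\<theta> n \<omega>, started_at p B (\<theta> n \<omega>) \<omega>) \<partial>M) \<longlonglongrightarrow>
        (\<integral>\<omega>. case_prod f (\<theta>' \<omega>, started_at p B (\<theta>' \<omega>) \<omega>) \<partial>M)"
      using f C by (intro stopped_dominated_convergence[OF _ _ \<theta> lim]) (auto simp: caloric_def)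
    then show ?thesis
      using st f unfolding stopping_def by (simp add: LIMSEQ_const_iff)
  qed
  have "(\<lambda>n. \<integral>\<omega>. (\<lambda>(t, z). norm z ^ 4) (\<theta> n \<omega>, started_at p B (\<theta> n \<omega>) \<omega>) \<partial>M) \<longlonglongrightarrow>
      (\<integral>\<omega>. (\<lambda>(t, z). norm z ^ 4) (\<theta>' \<omega>, started_at p B (\<theta>' \<omega>) \<omega>) \<partial>M)"
  proof (rule stopped_dominated_convergence[OF _ _ \<theta> lim])
    show "continuous_on UNIV (\<lambda>(t :: real, z :: real \<times> real). norm z ^ 4)"
      unfolding case_prod_unfold by (intro continuous_intros)
    show "\<bar>case (t, z) of (t :: real, z :: real \<times> real) \<Rightarrow> norm z ^ 4\<bar> \<le> 1 * (1 + norm z) ^ 16" for t z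
    proof -
      have "norm z ^ 4 \<le> (1 + norm z) ^ 4"
        by (intro power_mono) auto
      also have "\<dots> \<le> (1 + norm z) ^ 16"
        by (intro power_increasing) auto
      finally show ?thesis by simp
    qed
  qed auto
  then have l: "(\<lambda>n. ennreal (4 * (\<integral>\<omega>. norm (started_at p B (\<theta> n \<omega>) \<omega>) ^ 4 \<partial>M))) \<longlonglongrightarrow>
      ennreal (4 * (\<integral>\<omega>. norm (started_at p B (\<theta>' \<omega>) \<omega>) ^ 4 \<partial>M))"
    by (intro tendsto_ennrealI tendsto_intros) simp
  have "(\<integral>\<^sup>+\<omega>. runsup p 0 L' \<theta>' \<omega> \<partial>M) \<le> (\<integral>\<^sup>+\<omega>. liminf (\<lambda>n. runsup p 0 (L n) (\<theta> n) \<omega>) \<partial>M)"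
    using \<theta>(2) lim L by (intro nn_integral_mono runsup_liminf) auto
  also have "\<dots> \<le> liminf (\<lambda>n. \<integral>\<^sup>+\<omega>. runsup p 0 (L n) (\<theta> n) \<omega> \<partial>M)"
    using \<theta> by (intro nn_integral_liminf measurable_runsup) auto
  also have "\<dots> \<le> liminf (\<lambda>n. ennreal (4 * (\<integral>\<omega>. norm (started_at p B (\<theta> n \<omega>) \<omega>) ^ 4 \<partial>M)))"
    using st unfolding stopping_def by (intro Liminf_mono always_eventually) blast
  also have "\<dots> = ennreal (4 * (\<integral>\<omega>. norm (started_at p B (\<theta>' \<omega>) \<omega>) ^ 4 \<partial>M))"
    by (rule lim_imp_Liminf[OF trivial_limit_sequentially l])
  finally show "(\<integral>\<^sup>+\<omega>. runsup p 0 L' \<theta>' \<omega> \<partial>M) \<le> ennreal (4 * (\<integral>\<omega>. norm (started_at p B (\<theta>' \<omega>) \<omega>) ^ 4 \<partial>M))" .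
qed

text \<open>\<open>N\<close> is only bounded by \<open>K * 2 ^ n\<close>, so that grid exits cut off
  at an earlier fixed time are covered too.\<close>

lemma stopping_grid:
  fixes K n N :: nat
  assumes U: "U \<in> sets borel" and N: "N \<le> K * 2 ^ n"
  shows "stopping K {..n} p (\<lambda>\<omega>. real (exit_step U n N p \<omega>) / 2 ^ n)"
  unfolding stopping_def
proof (intro conjI allI impI ballI)
  have "(\<lambda>\<omega>. real (exit_step U n N p \<omega>)) = (\<lambda>\<omega>. \<Sum>k<N. of_bool (k < exit_step U n N p \<omega>))"
    using sum_stopped_telescope[OF exit_step_le, of real U n N p] by (auto simp: fun_eq_iff)
  also have "\<dots> \<in> borel_measurable M"
    by (intro borel_measurable_sum alive_measurable(2)[OF U])
  finally show "(\<lambda>\<omega>. real (exit_step U n N p \<omega>) / 2 ^ n) \<in> borel_measurable M"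
    by measurable
  show "0 \<le> real (exit_step U n N p \<omega>) / 2 ^ n" for \<omega> by simp
  show "real (exit_step U n N p \<omega>) / 2 ^ n \<le> real K" for \<omega>
  proof -
    have "real (exit_step U n N p \<omega>) \<le> real (K * 2 ^ n)"
      using order_trans[OF exit_step_le[of U n N p \<omega>] N] by (simp only: of_nat_le_iff)
    then show ?thesis
      by (simp add: divide_le_eq)
  qed
  show "(\<integral>\<omega>. f (real (exit_step U n N p \<omega>) / 2 ^ n) (started_at p B (real (exit_step U n N p \<omega>) / 2 ^ n) \<omega>) \<partial>M) = f 0 p"
    if "caloric f" for f
    by (rule optional_stopping_grid[OF U that])
  show "(\<integral>\<^sup>+\<omega>. runsup p 0 {..n} (\<lambda>\<omega>. real (exit_step U n N p \<omega>) / 2 ^ n) \<omega> \<partial>M) \<le>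
      ennreal (4 * (\<integral>\<omega>. norm (started_at p B (real (exit_step U n N p \<omega>) / 2 ^ n) \<omega>) ^ 4 \<partial>M))"
    using runsup_grid[OF U, of p 0 n N] by simp
qed

end

subsection \<open>Stopping at the exit time\<close>

context planar_brownian_motion
begin

definition exit_upto :: "nat \<Rightarrow> (real \<times> real) set \<Rightarrow> real \<times> real \<Rightarrow> 'w \<Rightarrow> real" where
  "exit_upto K D p \<omega> = enn2real (min (ennreal (real K)) (exit_time D (started_at p B) \<omega>))"

lemma ennreal_exit_upto: "ennreal (exit_upto K D p \<omega>) = min (ennreal (real K)) (exit_time D (started_at p B) \<omega>)"
  unfolding exit_upto_def by (rule ennreal_enn2real) (simp add: min_less_iff_disj)

lemma exit_upto_bounds: "0 \<le> exit_upto K D p \<omega>" "exit_upto K D p \<omega> \<le> real K"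
proof -
  show 0: "0 \<le> exit_upto K D p \<omega>"
    by (simp add: exit_upto_def)
  have "ennreal (exit_upto K D p \<omega>) \<le> ennreal (real K)"
    by (simp add: ennreal_exit_upto)
  then show "exit_upto K D p \<omega> \<le> real K"
    by (subst (asm) ennreal_le_iff) auto
qed

lemma before_exit_upto:
  assumes "0 \<le> t" "t < exit_upto K D p \<omega>"
  shows "started_at p B t \<omega> \<in> D"
proof (rule ccontr)
  assume "started_at p B t \<omega> \<notin> D"
  then have "exit_time D (started_at p B) \<omega> \<le> ennreal t"
    unfolding exit_time_def using assms(1) by (intro INF_lower) auto
  then have "ennreal (exit_upto K D p \<omega>) \<le> ennreal t"
    by (simp add: ennreal_exit_upto min.coboundedI2)
  then show False
    using assms by (subst (asm) ennreal_le_iff) auto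
qed

text \<open>If the path were inside the open set at the infimum, continuity would keep it there for
  a further time \<open>e\<close>, and the infimum would be at least \<open>?t + e\<close>.\<close>

lemma at_exit_upto:
  assumes D: "open D" and \<omega>: "\<omega> \<in> space M" and less: "exit_upto K D p \<omega> < real K"
  shows "started_at p B (exit_upto K D p \<omega>) \<omega> \<notin> D"
    "exit_time D (started_at p B) \<omega> = ennreal (exit_upto K D p \<omega>)"
proof -
  let ?t = "exit_upto K D p \<omega>"
  have "ennreal ?t < ennreal (real K)"
    using less exit_upto_bounds(1)[of K D p \<omega>] by (intro ennreal_lessI) linarith+
  then show e: "exit_time D (started_at p B) \<omega> = ennreal ?t"
    unfolding ennreal_exit_upto by (simp add: min_def split: if_splits)
  show "started_at p B ?t \<omega> \<notin> D"
  proof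
    assume "started_at p B ?t \<omega> \<in> D"
    moreover have "continuous_on {0..} (\<lambda>t. started_at p B t \<omega>)"
      by (rule start_continuous[OF \<omega>])
    ultimately obtain A where A: "open A" "?t \<in> A" "\<And>s. s \<in> {0..} \<inter> A \<Longrightarrow> started_at p B s \<omega> \<in> D"
      using exit_upto_bounds(1)[of K D p \<omega>] unfolding continuous_on_topological
      by (metis D IntE atLeast_iff)
    then obtain e where e': "0 < e" "\<And>s. \<bar>s - ?t\<bar> < e \<Longrightarrow> s \<in> A"
      by (metis dist_real_def open_dist)
    have "ennreal (?t + e) \<le> exit_time D (started_at p B) \<omega>"
      unfolding exit_time_def
    proof (rule INF_greatest)
      fix s assume s: "s \<in> {t. 0 \<le> t \<and> started_at p B t \<omega> \<notin> D}"
      have "?t \<le> s"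
        using before_exit_upto[of s K D p \<omega>] s by force
      moreover have "\<not> \<bar>s - ?t\<bar> < e"
        using A(3)[of s] e'(2)[of s] s by auto
      ultimately show "ennreal (?t + e) \<le> ennreal s"
        by (intro ennreal_leI) linarith
    qed
    then show False
      unfolding e using exit_upto_bounds(1)[of K D p \<omega>] e'(1) by (subst (asm) ennreal_le_iff) auto
  qed
qed

text \<open>The finer grid contains the coarser one, where step \<open>?s\<close> is step
  \<open>2 * ?s\<close>, so it detects an exit no later.\<close>

lemma exit_step_antimono:
  "real (exit_step U (Suc n) (K * 2 ^ Suc n) p \<omega>) / 2 ^ Suc n \<le> real (exit_step U n (K * 2 ^ n) p \<omega>) / 2 ^ n"
proof -
  let ?s = "exit_step U n (K * 2 ^ n) p \<omega>"
  have *: "real (2 * ?s) / 2 ^ Suc n = real ?s / 2 ^ n"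
    by simp
  have "exit_step U (Suc n) (K * 2 ^ Suc n) p \<omega> \<le> 2 * ?s"
    unfolding exit_step_def[of U "Suc n"]
    using exit_step_cases[of U n "K * 2 ^ n" p \<omega>]
    by (intro Least_le[of "\<lambda>k. k = K * 2 ^ Suc n \<or> started_at p B (real k / 2 ^ Suc n) \<omega> \<notin> U"]) (unfold *, auto)
  then have "real (exit_step U (Suc n) (K * 2 ^ Suc n) p \<omega>) / 2 ^ Suc n \<le> real (2 * ?s) / 2 ^ Suc n"
    by (intro divide_right_mono) (simp_all only: of_nat_le_iff, simp)
  then show ?thesis unfolding * .
qed

text \<open>Grid exits decrease under refinement, hence converge. The margin \<open>e\<close> bounds
  the limit by the true exit time: there the distance to the complement is 0, so it is below
  \<open>e\<close> at all grid times shortly afterwards. A limit below \<open>K\<close> is a limit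
  of genuine grid exits, so by continuity the path is then within \<open>e\<close> of the
  complement.\<close>

lemma infdist_grid_exit:
  fixes K :: nat and p :: "real \<times> real"
  assumes D: "open D" "D \<noteq> UNIV" and \<omega>: "\<omega> \<in> space M" and e: "0 < e"
  defines "\<theta> \<equiv> \<lambda>n. real (exit_step {z. e < infdist z (- D)} n (K * 2 ^ n) p \<omega>) / 2 ^ n"
  shows "\<theta> \<longlonglongrightarrow> lim \<theta>" "0 \<le> lim \<theta>" "lim \<theta> \<le> exit_upto K D p \<omega>"
    "lim \<theta> < real K \<Longrightarrow> infdist (started_at p B (lim \<theta>) \<omega>) (- D) \<le> e"
proof -
  let ?U = "{z. e < infdist z (- D)}" and ?X = "\<lambda>t. started_at p B t \<omega>" and ?t = "exit_upto K D p \<omega>"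
  have K: "\<theta> n \<le> real K" for n
  proof -
    have "real (exit_step ?U n (K * 2 ^ n) p \<omega>) \<le> real (K * 2 ^ n)"
      using exit_step_le[of ?U n "K * 2 ^ n" p \<omega>] by (simp only: of_nat_le_iff)
    then show ?thesis
      by (simp add: \<theta>_def divide_le_eq)
  qed
  have pos: "0 \<le> \<theta> n" for n
    by (simp add: \<theta>_def)
  have "decseq \<theta>"
    unfolding \<theta>_def by (rule decseq_SucI exit_step_antimono)+
  then obtain l where "\<theta> \<longlonglongrightarrow> l"
    using decseq_convergent[of \<theta> 0] pos by blast
  then have "convergent \<theta>"
    by (rule convergentI)
  then show lim: "\<theta> \<longlonglongrightarrow> lim \<theta>"
    by (simp add: convergent_LIMSEQ_iff)
  show l0: "0 \<le> lim \<theta>"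
    using pos by (intro LIMSEQ_le_const[OF lim]) auto
  have cont: "continuous_on {0..} (\<lambda>t. infdist (?X t) (- D))"
    by (intro continuous_intros start_continuous[OF \<omega>])
  show "lim \<theta> \<le> ?t"
  proof (cases "?t < real K")
    case True
    have "infdist (?X ?t) (- D) < e"
      using at_exit_upto(1)[OF D(1) \<omega> True] e by (simp add: infdist_zero)
    then have "0 < e - infdist (?X ?t) (- D)" by simp
    moreover have "?t \<in> {0..}"
      using exit_upto_bounds(1) by auto
    ultimately obtain d where d': "0 < d"
      "\<forall>s\<in>{0..}. dist s ?t < d \<longrightarrow> dist (infdist (?X s) (- D)) (infdist (?X ?t) (- D)) < e - infdist (?X ?t) (- D)"
      using cont[unfolded continuous_on_iff] by blast
    have d: "infdist (?X s) (- D) < e" if "0 \<le> s" "\<bar>s - ?t\<bar> < d" for s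
      using d'(2)[rule_format, of s] that unfolding dist_real_def by simp
    have "(\<lambda>n. (1 / 2) ^ n) \<longlonglongrightarrow> (0 :: real)"
      by (rule LIMSEQ_realpow_zero) auto
    then have ev: "\<forall>\<^sub>F n in sequentially. (1 / 2) ^ n < d"
      using d'(1) by (rule order_tendstoD)
    have "\<forall>\<^sub>F n in sequentially. \<theta> n \<le> ?t + (1 / 2) ^ n"
      using ev
    proof eventually_elim
      case (elim n)
      \<comment> \<open>The first grid time not before the exit; it comes at most one mesh width
        later.\<close>
      define k where "k = nat \<lceil>?t * 2 ^ n\<rceil>"
      have "?t * 2 ^ n \<le> real k" "real k \<le> ?t * 2 ^ n + 1"
        using exit_upto_bounds(1)[of K D p \<omega>] unfolding k_def by auto
      then have "?t \<le> real k / 2 ^ n" "real k / 2 ^ n \<le> (?t * 2 ^ n + 1) / 2 ^ n"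
        by (simp add: le_divide_eq, intro divide_right_mono) auto
      then have k: "?t \<le> real k / 2 ^ n" "real k / 2 ^ n \<le> ?t + (1 / 2) ^ n"
        by (auto simp: add_divide_distrib power_one_over)
      then have "?X (real k / 2 ^ n) \<notin> ?U"
        using d[of "real k / 2 ^ n"] elim by auto
      then have "exit_step ?U n (K * 2 ^ n) p \<omega> \<le> k"
        unfolding exit_step_def by (intro Least_le) auto
      then have "\<theta> n \<le> real k / 2 ^ n"
        unfolding \<theta>_def by (intro divide_right_mono) auto
      then show ?case using k by linarith
    qed
    moreover have "(\<lambda>n. ?t + (1 / 2) ^ n) \<longlonglongrightarrow> ?t + 0"
      by (intro tendsto_intros LIMSEQ_realpow_zero) auto
    ultimately show ?thesis
      using tendsto_le[OF trivial_limit_sequentially _ lim] by fastforce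
  next
    case False
    then show ?thesis
      using exit_upto_bounds(2)[of K D p \<omega>] K by (intro LIMSEQ_le_const2[OF lim]) auto
  qed
  show "infdist (?X (lim \<theta>)) (- D) \<le> e" if "lim \<theta> < real K"
  proof -
    have "\<forall>\<^sub>F n in sequentially. \<theta> n < real K"
      by (rule order_tendstoD(2)[OF lim that])
    then have "\<forall>\<^sub>F n in sequentially. infdist (?X (\<theta> n)) (- D) \<le> e"
    proof eventually_elim
      case (elim n)
      then have "exit_step ?U n (K * 2 ^ n) p \<omega> \<noteq> K * 2 ^ n"
        by (auto simp: \<theta>_def)
      then show ?case
        using exit_step_cases[of ?U n "K * 2 ^ n" p \<omega>] by (auto simp: \<theta>_def)
    qed
    moreover have "(\<lambda>n. infdist (?X (\<theta> n)) (- D)) \<longlonglongrightarrow> infdist (?X (lim \<theta>)) (- D)"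
      by (intro tendsto_infdist start_tendsto[OF \<omega> pos lim])
    ultimately show ?thesis
      by (intro tendsto_upperbound) auto
  qed
qed

lemma exit_step_min:
  assumes "N \<le> N'"
  shows "exit_step U n N p \<omega> = min N (exit_step U n N' p \<omega>)"
proof (rule ccontr)
  have *: "k < exit_step U n N p \<omega> \<longleftrightarrow> k < min N (exit_step U n N' p \<omega>)" for k
    using assms by (auto simp: less_exit_step_iff)
  assume "\<not> ?thesis"
  then show False
    using *[of "exit_step U n N p \<omega>"] *[of "min N (exit_step U n N' p \<omega>)"] by linarith
qed

text \<open>Two successive limits: grids for a fixed margin, then margins \<open>e m\<close> tending
  to 0. The fixed time \<open>T\<close> enters through its dyadic approximations; the minimum with
  \<open>T\<close> is what later describes the killed path at time \<open>T\<close>.\<close>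

theorem stopping_exit_min:
  assumes D: "open D" "D \<noteq> UNIV" and T: "0 \<le> T" "T \<le> real K"
  shows "stopping K UNIV p (\<lambda>\<omega>. min T (exit_upto K D p \<omega>))"
proof -
  define e where "e m = 1 / real (Suc m)" for m
  have e: "0 < e m" for m by (simp add: e_def)
  define \<theta> where "\<theta> m n \<omega> = real (exit_step {z. e m < infdist z (- D)} n (K * 2 ^ n) p \<omega>) / 2 ^ n" for m n \<omega>
  define L where "L m \<omega> = lim (\<lambda>n. \<theta> m n \<omega>)" for m \<omega>
  note grid = infdist_grid_exit[OF D _ e, where p = p and K = K, folded \<theta>_def, folded L_def]
  have U: "{z. e m < infdist z (- D)} \<in> sets borel" for m
    by (intro borel_open open_Collect_less continuous_intros)
  have "stopping K UNIV p (\<lambda>\<omega>. min T (L m \<omega>))" for m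
  proof (rule stopping_limit)
    let ?N = "\<lambda>n. nat \<lfloor>2 ^ n * T\<rfloor>"
    have N: "?N n \<le> K * 2 ^ n" for n
    proof -
      have "2 ^ n * T \<le> real (K * 2 ^ n)"
        using T by (simp add: mult.commute)
      then have "\<lfloor>2 ^ n * T\<rfloor> \<le> int (K * 2 ^ n)"
        by linarith
      then show ?thesis by (simp only: nat_le_iff)
    qed
    show "stopping K {..n} p (\<lambda>\<omega>. min (real (?N n) / 2 ^ n) (\<theta> m n \<omega>))" for n
    proof -
      have "min (real i / 2 ^ n) (real j / 2 ^ n) = real (min i j) / 2 ^ n" for i j :: nat
        by (auto simp: min_def divide_le_cancel)
      then have "(\<lambda>\<omega>. min (real (?N n) / 2 ^ n) (\<theta> m n \<omega>)) =
          (\<lambda>\<omega>. real (exit_step {z. e m < infdist z (- D)} n (?N n) p \<omega>) / 2 ^ n)"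
        unfolding \<theta>_def exit_step_min[OF N] by simp
      then show ?thesis
        using stopping_grid[OF U N] by simp
    qed
    show "(\<lambda>n. min (real (?N n) / 2 ^ n) (\<theta> m n \<omega>)) \<longlonglongrightarrow> min T (L m \<omega>)" if "\<omega> \<in> space M" for \<omega>
      by (intro tendsto_min floor_dyadic_tendsto(1)[OF T(1)] grid(1)[OF that])
  qed (auto intro: eventually_ge_at_top)
  then show ?thesis
  proof (rule stopping_limit)
    fix \<omega> assume \<omega>: "\<omega> \<in> space M"
    let ?t = "exit_upto K D p \<omega>" and ?X = "\<lambda>t. started_at p B t \<omega>"
    have "(\<lambda>m. L m \<omega>) \<longlonglongrightarrow> ?t"
    proof (rule order_tendstoI)
      fix a assume "?t < a"
      then show "\<forall>\<^sub>F m in sequentially. L m \<omega> < a"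
        using grid(3)[OF \<omega>] by (auto intro: always_eventually le_less_trans)
    next
      fix s assume s: "s < ?t"
      show "\<forall>\<^sub>F m in sequentially. s < L m \<omega>"
      proof (cases "0 \<le> s")
        case True
        \<comment> \<open>Up to \<open>s\<close> the path stays in the open set, so its distance to
          the complement has a positive minimum there; once \<open>e m\<close> is below this
          minimum, the approximation cannot have stopped by time \<open>s\<close>.\<close>
        have "compact ((\<lambda>t. infdist (?X t) (- D)) ` {0..s})"
          by (intro compact_continuous_image continuous_intros continuous_on_subset[OF start_continuous[OF \<omega>]]) auto
        then obtain t where t: "t \<in> {0..s}" "\<And>t'. t' \<in> {0..s} \<Longrightarrow> infdist (?X t) (- D) \<le> infdist (?X t') (- D)"
          using True compact_attains_inf[of "(\<lambda>t. infdist (?X t) (- D)) ` {0..s}"] by auto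
        have "?X t \<in> D"
          using t(1) s before_exit_upto[of t K D p \<omega>] by auto
        then have "0 < infdist (?X t) (- D)"
          using D in_closed_iff_infdist_zero[of "- D" "?X t"] infdist_nonneg[of "?X t" "- D"]
          by (auto simp: closed_Compl less_le)
        moreover have "e \<longlonglongrightarrow> 0"
          unfolding e_def by (rule LIMSEQ_Suc[OF lim_1_over_n])
        ultimately have "\<forall>\<^sub>F m in sequentially. e m < infdist (?X t) (- D)"
          by (intro order_tendstoD)
        then show ?thesis
        proof eventually_elim
          case (elim m)
          show ?case
          proof (rule ccontr)
            assume "\<not> s < L m \<omega>"
            then have "L m \<omega> \<in> {0..s}"
              using grid(2)[OF \<omega>, of m] by simp
            moreover have "L m \<omega> < real K"
              using \<open>\<not> s < L m \<omega>\<close> s exit_upto_bounds(2)[of K D p \<omega>] by linarith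
            ultimately show False
              using grid(4)[OF \<omega>, of m] t(2)[of "L m \<omega>"] elim by linarith
          qed
        qed
      next
        case False
        then show ?thesis
          using grid(2)[OF \<omega>] by (intro always_eventually) (auto intro: less_le_trans[of s 0])
      qed
    qed
    then show "(\<lambda>m. min T (L m \<omega>)) \<longlonglongrightarrow> min T ?t"
      by (intro tendsto_min tendsto_const)
  qed auto
qed

lemma stopping_exit_upto:
  assumes "open D" "D \<noteq> UNIV"
  shows "stopping K UNIV p (exit_upto K D p)"
proof -
  have "(\<lambda>\<omega>. min (real K) (exit_upto K D p \<omega>)) = exit_upto K D p"
    by (intro ext min_absorb2 exit_upto_bounds)
  then show ?thesis
    using stopping_exit_min[OF assms, of "real K" K p] by simp
qed

end

subsection \<open>Exit moments given by polynomials\<close>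

lemma caloric_heat_prod:
  "i \<le> 5 \<Longrightarrow> j \<le> 5 \<Longrightarrow> caloric (\<lambda>t z. c * (heat_poly i t (fst z) * heat_poly j t (snd z)))"
  using caloric_scale[OF caloric_prod[OF caloric1_heat_poly[of i] caloric1_heat_poly[of j]], of c]
  by (simp add: case_prod_unfold)

text \<open>The real part of \<open>(x + i y) ^ 4\<close>.\<close>

definition quartic :: "real \<times> real \<Rightarrow> real"
  where "quartic z = fst z ^ 4 - 6 * (fst z)\<^sup>2 * (snd z)\<^sup>2 + snd z ^ 4"

lemma caloric_quartic: "caloric (\<lambda>t. quartic)"
proof -
  have "caloric (\<lambda>t z. 1 * (heat_poly 4 t (fst z) * heat_poly 0 t (snd z)) +
      ((-6) * (heat_poly 2 t (fst z) * heat_poly 2 t (snd z)) + 1 * (heat_poly 0 t (fst z) * heat_poly 4 t (snd z))))"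
    by (intro caloric_add caloric_heat_prod) auto
  also have "(\<lambda>t z. 1 * (heat_poly 4 t (fst z) * heat_poly 0 t (snd z)) +
      ((-6) * (heat_poly 2 t (fst z) * heat_poly 2 t (snd z)) + 1 * (heat_poly 0 t (fst z) * heat_poly 4 t (snd z)))) = (\<lambda>t. quartic)"
    by (intro ext) (simp only: heat_poly_simps quartic_def, algebra)
  finally show ?thesis .
qed

context planar_brownian_motion
begin

lemma exit_upto_measurable:
  assumes "open D" "D \<noteq> UNIV"
  shows "exit_upto K D p \<in> borel_measurable M"
  using stopping_exit_upto[OF assms] unfolding stopping_def by blast

lemma measurable_at_exit:
  assumes "open D" "D \<noteq> UNIV"
  shows "(\<lambda>\<omega>. started_at p B (exit_upto K D p \<omega>) \<omega>) \<in> borel_measurable M"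
  by (intro measurable_stopped exit_upto_measurable assms exit_upto_bounds)

lemma integrable_at_exit:
  fixes g :: "real \<times> real \<times> real \<Rightarrow> real"
  assumes D: "open D" "D \<noteq> UNIV"
    and g: "g \<in> borel_measurable borel" "\<And>t z. t \<in> {0..real K} \<Longrightarrow> \<bar>g (t, z)\<bar> \<le> C * (1 + norm z) ^ 16"
  shows "integrable M (\<lambda>\<omega>. g (exit_upto K D p \<omega>, started_at p B (exit_upto K D p \<omega>) \<omega>))"
proof -
  obtain E where E: "integrable M E" "AE \<omega> in M. \<forall>t\<in>{0..real K}. (1 + norm (started_at p B t \<omega>)) ^ 16 \<le> E \<omega>"
    using dominating_path[of K p] by blast
  have C: "0 \<le> C"
    using g(2)[of 0 0] by (auto dest: order_trans[OF abs_ge_zero])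
  show ?thesis
  proof (rule Bochner_Integration.integrable_bound)
    show "integrable M (\<lambda>\<omega>. C * E \<omega>)" using E by auto
    show "(\<lambda>\<omega>. g (exit_upto K D p \<omega>, started_at p B (exit_upto K D p \<omega>) \<omega>)) \<in> borel_measurable M"
      by (rule measurable_compose[OF _ g(1)]) (intro borel_measurable_Pair exit_upto_measurable measurable_at_exit D)
    show "AE \<omega> in M. norm (g (exit_upto K D p \<omega>, started_at p B (exit_upto K D p \<omega>) \<omega>)) \<le> norm (C * E \<omega>)"
      using E(2)
    proof eventually_elim
      case (elim \<omega>)
      have t: "exit_upto K D p \<omega> \<in> {0..real K}" using exit_upto_bounds by auto
      have "\<bar>g (exit_upto K D p \<omega>, started_at p B (exit_upto K D p \<omega>) \<omega>)\<bar> \<le> C * (1 + norm (started_at p B (exit_upto K D p \<omega>) \<omega>)) ^ 16"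
        by (rule g(2)[OF t])
      also have "\<dots> \<le> C * E \<omega>"
        using elim t C by (intro mult_left_mono) auto
      finally show ?case
        unfolding real_norm_def by (rule order_trans[OF _ abs_ge_self])
    qed
  qed
qed

lemma integrable_caloric_at_exit:
  assumes D: "open D" "D \<noteq> UNIV" and f: "caloric f"
  shows "integrable M (\<lambda>\<omega>. f (exit_upto K D p \<omega>) (started_at p B (exit_upto K D p \<omega>) \<omega>))"
    "(\<integral>\<omega>. f (exit_upto K D p \<omega>) (started_at p B (exit_upto K D p \<omega>) \<omega>) \<partial>M) = f 0 p"
proof -
  obtain C where C: "\<And>t z. t \<in> {0..real K} \<Longrightarrow> \<bar>f t z\<bar> \<le> C * (1 + norm z) ^ 16"
    using f unfolding caloric_def by blast
  show "integrable M (\<lambda>\<omega>. f (exit_upto K D p \<omega>) (started_at p B (exit_upto K D p \<omega>) \<omega>))"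
    using integrable_at_exit[OF D caloric_measurable(1)[OF f], of K C p] C by simp
  show "(\<integral>\<omega>. f (exit_upto K D p \<omega>) (started_at p B (exit_upto K D p \<omega>) \<omega>) \<partial>M) = f 0 p"
    using stopping_exit_upto[OF D] f unfolding stopping_def by blast
qed

lemma exit_upto_eq:
  assumes "exit_time D (started_at p B) \<omega> = ennreal r" "0 \<le> r" "r \<le> real K"
  shows "exit_upto K D p \<omega> = r"
proof -
  have "min (ennreal (real K)) (ennreal r) = ennreal r"
    using assms by (intro min_absorb2 ennreal_leI) auto
  then show ?thesis
    unfolding exit_upto_def using assms by simp
qed

lemma exit_upto_mono: "K \<le> K' \<Longrightarrow> exit_upto K D p \<omega> \<le> exit_upto K' D p \<omega>"
  unfolding exit_upto_def
  by (intro enn2real_mono min.mono ennreal_leI order_refl) (auto simp: min_less_iff_disj)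

text \<open>Covers paths that never exit: their truncated times are the integers \<open>K\<close>,
  whose powers are unbounded because \<open>0 < k\<close>.\<close>

lemma exit_time_power_SUP:
  assumes "0 < k"
  shows "exit_time D (started_at p B) \<omega> ^ k = (SUP K. ennreal (exit_upto K D p \<omega> ^ k))"
proof (rule antisym)
  let ?e = "exit_time D (started_at p B) \<omega>"
  show "(SUP K. ennreal (exit_upto K D p \<omega> ^ k)) \<le> ?e ^ k"
  proof (rule SUP_least)
    fix K
    have "ennreal (exit_upto K D p \<omega>) ^ k \<le> ?e ^ k"
      by (intro power_mono) (auto simp: ennreal_exit_upto)
    then show "ennreal (exit_upto K D p \<omega> ^ k) \<le> ?e ^ k"
      by (simp add: ennreal_power exit_upto_bounds)
  qed
  show "?e ^ k \<le> (SUP K. ennreal (exit_upto K D p \<omega> ^ k))"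
  proof (cases ?e)
    case (real r)
    obtain K :: nat where "r \<le> real K"
      using real_arch_simple by blast
    then have "exit_upto K D p \<omega> = r"
      using real by (intro exit_upto_eq) auto
    then show ?thesis
      using real by (intro SUP_upper2[of K]) (auto simp: ennreal_power)
  next
    case top
    have "(SUP K :: nat. of_nat K :: ennreal) \<le> (SUP K. ennreal (exit_upto K D p \<omega> ^ k))"
    proof (rule SUP_mono)
      fix K :: nat
      have e: "exit_upto K D p \<omega> = real K"
        by (simp add: exit_upto_def top)
      have "real K \<le> real K ^ k"
        using assms by (cases "K = 0") (auto intro: self_le_power)
      then have "of_nat K \<le> ennreal (exit_upto K D p \<omega> ^ k)"
        unfolding e ennreal_of_nat_eq_real_of_nat by (rule ennreal_leI)
      then show "\<exists>m\<in>UNIV. of_nat K \<le> ennreal (exit_upto m D p \<omega> ^ k)" by blast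
    qed
    then have "(SUP K. ennreal (exit_upto K D p \<omega> ^ k)) = top"
      unfolding ennreal_SUP_of_nat_eq_top by (rule top_le)
    then show ?thesis by (simp only: top_greatest)
  qed
qed

lemma exit_time_measurable:
  assumes "open D" "D \<noteq> UNIV"
  shows "exit_time D (started_at p B) \<in> borel_measurable M"
proof -
  have "(\<lambda>\<omega>. SUP K. ennreal (exit_upto K D p \<omega> ^ 1)) \<in> borel_measurable M"
    using exit_upto_measurable[OF assms] by measurable
  also have "(\<lambda>\<omega>. SUP K. ennreal (exit_upto K D p \<omega> ^ 1)) = exit_time D (started_at p B)"
    using exit_time_power_SUP[of 1 D p] by (intro ext) simp
  finally show ?thesis .
qed

lemma exit_moment_SUP:
  assumes "open D" "D \<noteq> UNIV" "0 < k"
  shows "exit_moment M B D k p = (SUP K. \<integral>\<^sup>+\<omega>. ennreal (exit_upto K D p \<omega> ^ k) \<partial>M)"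
    "incseq (\<lambda>K. \<integral>\<^sup>+\<omega>. ennreal (exit_upto K D p \<omega> ^ k) \<partial>M)"
proof -
  have mono: "exit_upto K D p \<omega> ^ k \<le> exit_upto K' D p \<omega> ^ k" if "K \<le> K'" for K K' \<omega>
    by (intro power_mono exit_upto_mono exit_upto_bounds that)
  note [measurable] = exit_upto_measurable[OF assms(1,2)]
  show "exit_moment M B D k p = (SUP K. \<integral>\<^sup>+\<omega>. ennreal (exit_upto K D p \<omega> ^ k) \<partial>M)"
    unfolding exit_moment_def exit_time_power_SUP[OF assms(3)]
    by (intro nn_integral_monotone_convergence_SUP) (auto simp: incseq_def le_fun_def intro!: ennreal_leI mono)
  show "incseq (\<lambda>K. \<integral>\<^sup>+\<omega>. ennreal (exit_upto K D p \<omega> ^ k) \<partial>M)"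
    by (auto simp: incseq_def intro!: nn_integral_mono ennreal_leI mono)
qed

lemma exit_moment_limit:
  assumes D: "open D" "D \<noteq> UNIV" "0 < k"
    and lim: "(\<lambda>K. \<integral>\<omega>. exit_upto K D p \<omega> ^ k \<partial>M) \<longlonglongrightarrow> c"
  shows "exit_moment M B D k p = ennreal c"
proof -
  have int: "integrable M (\<lambda>\<omega>. exit_upto K D p \<omega> ^ k)" for K
    using exit_upto_measurable[OF D(1,2), of K p] power_mono[OF exit_upto_bounds(2,1), of K D p _ k]
    by (intro integrable_const_bound[where B = "real K ^ k"]) (auto simp: exit_upto_bounds(1))
  have "(\<integral>\<^sup>+\<omega>. ennreal (exit_upto K D p \<omega> ^ k) \<partial>M) = ennreal (\<integral>\<omega>. exit_upto K D p \<omega> ^ k \<partial>M)" for K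
    by (intro nn_integral_eq_integral int) (auto simp: exit_upto_bounds)
  then have "(\<lambda>K. \<integral>\<^sup>+\<omega>. ennreal (exit_upto K D p \<omega> ^ k) \<partial>M) \<longlonglongrightarrow> ennreal c"
    using tendsto_ennrealI[OF lim] by simp
  then show ?thesis
    using LIMSEQ_unique[OF LIMSEQ_SUP[OF exit_moment_SUP(2)[OF D]]] exit_moment_SUP(1)[OF D] by simp
qed

lemma at_exit_closed:
  assumes D: "open D" and p: "p \<in> D" and E: "closed E" "D \<subseteq> E" and \<omega>: "\<omega> \<in> space M"
  shows "started_at p B (exit_upto K D p \<omega>) \<omega> \<in> E"
proof (cases "exit_upto K D p \<omega> = 0")
  case True
  then show ?thesis
    using p E starts_at_origin[OF \<omega>] by (auto simp: started_at_def)
next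
  case False
  then have pos: "0 < exit_upto K D p \<omega>"
    using exit_upto_bounds(1)[of K D p \<omega>] by simp
  let ?s = "\<lambda>n. exit_upto K D p \<omega> * (1 - 1 / real (Suc n))"
  have "?s \<longlonglongrightarrow> exit_upto K D p \<omega> * (1 - 0)"
    by (intro tendsto_intros LIMSEQ_Suc[OF lim_1_over_n])
  then have lim: "(\<lambda>n. started_at p B (?s n) \<omega>) \<longlonglongrightarrow> started_at p B (exit_upto K D p \<omega>) \<omega>"
    using pos by (intro start_tendsto[OF \<omega>]) auto
  have "started_at p B (?s n) \<omega> \<in> E" for n
    using pos by (intro subsetD[OF E(2)] before_exit_upto[of _ K D p]) (auto simp: field_simps)
  then show ?thesis
    by (rule closed_sequentially[OF E(1) _ lim])
qed

text \<open>Optional stopping for \<open>quartic\<close> bounds the fourth moment at every truncated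
  exit by the same constant. The maximal inequality extends this to the running suprema, and Fatou's
  lemma to their limes inferior over \<open>K\<close>, which dominates all truncated exits at
  once.\<close>

lemma exit_path_dominated:
  assumes D: "open D" "D \<noteq> UNIV" and p: "p \<in> D" and E: "closed E" "D \<subseteq> E"
    and \<kappa>: "0 < \<kappa>" "\<And>z. z \<in> E \<Longrightarrow> \<kappa> * norm z ^ 4 \<le> quartic z + C"
  obtains S where "integrable M S" "AE \<omega> in M. \<forall>K. norm (started_at p B (exit_upto K D p \<omega>) \<omega>) ^ 4 \<le> S \<omega>"
proof -
  let ?X = "\<lambda>K \<omega>. started_at p B (exit_upto K D p \<omega>) \<omega>"
  define Q where "Q = 4 * ((quartic p + C) / \<kappa>)"
  have b: "4 * (\<integral>\<omega>. norm (?X K \<omega>) ^ 4 \<partial>M) \<le> Q" for K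
  proof -
    have q: "integrable M (\<lambda>\<omega>. quartic (?X K \<omega>))" "(\<integral>\<omega>. quartic (?X K \<omega>) \<partial>M) = quartic p"
      using integrable_caloric_at_exit[OF D caloric_quartic] by auto
    have i: "integrable M (\<lambda>\<omega>. norm (?X K \<omega>) ^ 4)"
    proof -
      have "norm z ^ 4 \<le> (1 + norm z) ^ 16" for z :: "real \<times> real"
        by (rule order_trans[OF power_mono[of _ "1 + norm z"] power_increasing]) auto
      moreover have "(\<lambda>(t :: real, z :: real \<times> real). norm z ^ 4) \<in> borel_measurable borel"
        unfolding case_prod_unfold by (intro borel_measurable_continuous_onI continuous_intros)
      ultimately show ?thesis
        using integrable_at_exit[OF D, of "\<lambda>(t, z). norm z ^ 4" K 1 p] by simp
    qed
    have "(\<integral>\<omega>. \<kappa> * norm (?X K \<omega>) ^ 4 \<partial>M) \<le> (\<integral>\<omega>. quartic (?X K \<omega>) + C \<partial>M)"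
      using i q \<kappa> at_exit_closed[OF D(1) p E] by (intro integral_mono) auto
    also have "\<dots> = quartic p + C"
      using q prob_space by simp
    finally have "\<kappa> * (\<integral>\<omega>. norm (?X K \<omega>) ^ 4 \<partial>M) \<le> quartic p + C"
      by simp
    then show ?thesis
      using \<kappa>(1) by (simp add: Q_def field_simps)
  qed
  let ?R = "\<lambda>\<omega>. liminf (\<lambda>K. runsup p 0 UNIV (exit_upto K D p) \<omega>)"
  have m: "runsup p 0 UNIV (exit_upto K D p) \<in> borel_measurable M" for K
    by (intro measurable_runsup exit_upto_measurable D exit_upto_bounds)
  note [measurable] = m
  have mR: "?R \<in> borel_measurable M"
    by measurable
  have "(\<integral>\<^sup>+\<omega>. ?R \<omega> \<partial>M) \<le> liminf (\<lambda>K. \<integral>\<^sup>+\<omega>. runsup p 0 UNIV (exit_upto K D p) \<omega> \<partial>M)"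
    by (rule nn_integral_liminf) (rule m)
  also have "\<dots> \<le> liminf (\<lambda>K :: nat. ennreal Q)"
  proof (intro Liminf_mono always_eventually allI)
    fix K
    have "(\<integral>\<^sup>+\<omega>. runsup p 0 UNIV (exit_upto K D p) \<omega> \<partial>M) \<le> ennreal (4 * (\<integral>\<omega>. norm (?X K \<omega>) ^ 4 \<partial>M))"
      using stopping_exit_upto[OF D] unfolding stopping_def by blast
    also have "\<dots> \<le> ennreal Q"
      by (rule ennreal_leI[OF b])
    finally show "(\<integral>\<^sup>+\<omega>. runsup p 0 UNIV (exit_upto K D p) \<omega> \<partial>M) \<le> ennreal Q" .
  qed
  also have "\<dots> = ennreal Q"
    by (rule Liminf_const) simp
  finally have fin: "(\<integral>\<^sup>+\<omega>. ?R \<omega> \<partial>M) < \<infinity>"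
    by (simp add: le_less_trans)
  \<comment> \<open>\<open>exit_upto\<close> increases with \<open>K\<close>, so the position at one
    truncated exit is met by the running suprema of all later ones.\<close>
  have path: "ennreal (norm (?X K \<omega>) ^ 4) \<le> ?R \<omega>" if "\<omega> \<in> space M" for K \<omega>
  proof (rule Liminf_bounded)
    have "ennreal (norm (?X K \<omega>) ^ 4) \<le> runsup p 0 UNIV (exit_upto K' D p) \<omega>" if "K \<le> K'" for K'
      using runsup_path[OF \<open>\<omega> \<in> space M\<close>, of "exit_upto K D p \<omega>" "exit_upto K' D p" p 0]
        exit_upto_bounds(1) exit_upto_mono[OF that] by simp
    then show "\<forall>\<^sub>F K' in sequentially. ennreal (norm (?X K \<omega>) ^ 4) \<le> runsup p 0 UNIV (exit_upto K' D p) \<omega>"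
      by (rule eventually_sequentiallyI)
  qed
  have ae: "AE \<omega> in M. ?R \<omega> \<noteq> \<infinity>"
    using fin by (intro nn_integral_PInf_AE mR) auto
  have "integrable M (\<lambda>\<omega>. enn2real (?R \<omega>))"
  proof (rule integrableI_nonneg)
    have "(\<integral>\<^sup>+\<omega>. ennreal (enn2real (?R \<omega>)) \<partial>M) \<le> (\<integral>\<^sup>+\<omega>. ?R \<omega> \<partial>M)"
      by (intro nn_integral_mono) (auto simp: ennreal_enn2real_if)
    then show "(\<integral>\<^sup>+\<omega>. ennreal (enn2real (?R \<omega>)) \<partial>M) < \<infinity>"
      using fin by (rule le_less_trans)
  qed (use mR in measurable)
  moreover have "AE \<omega> in M. \<forall>K. norm (?X K \<omega>) ^ 4 \<le> enn2real (?R \<omega>)"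
    using ae AE_space
  proof (eventually_elim, intro allI)
    fix \<omega> K assume "?R \<omega> \<noteq> \<infinity>" "\<omega> \<in> space M"
    then show "norm (?X K \<omega>) ^ 4 \<le> enn2real (?R \<omega>)"
      using path[of \<omega> K] by (cases "?R \<omega>") auto
  qed
  ultimately show ?thesis
    by (rule that)
qed

text \<open>For the truncated exit \<open>T\<close>, optional stopping gives
  \<open>E T = u1 p - E u1 (X_T)\<close> and
  \<open>E T^2 = u2 p - E u2 (X_T) - 2 E (T u1 (X_T))\<close>. The remainders tend to 0, since
  almost every path ends where \<open>u1\<close> and \<open>u2\<close> vanish. The cross term is the
  difficulty: its dominating function contains the squared exit time, whose integrability has to be
  proved first.\<close>

theorem exit_moments_polynomial:
  assumes D: "open D" "D \<noteq> UNIV" and p: "p \<in> D" and E: "closed E" "D \<subseteq> E"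
    and \<kappa>: "0 < \<kappa>" "\<And>z. z \<in> E \<Longrightarrow> \<kappa> * norm z ^ 4 \<le> quartic z + C"
    and u1: "caloric (\<lambda>t z. u1 z + t)" and u2: "caloric (\<lambda>t z. u2 z + 2 * t * u1 z + t\<^sup>2)"
    and zero: "\<And>z. z \<in> E \<Longrightarrow> z \<notin> D \<Longrightarrow> u1 z = 0 \<and> u2 z = 0"
    and growth: "\<And>z. z \<in> E \<Longrightarrow> \<bar>u1 z\<bar> \<le> A * (1 + (norm z)\<^sup>2)" "\<And>z. z \<in> E \<Longrightarrow> \<bar>u2 z\<bar> \<le> A * (1 + norm z ^ 4)"
  shows "exit_moment M B D 1 p = ennreal (u1 p)" "exit_moment M B D 2 p = ennreal (u2 p)"
proof -
  let ?T = "\<lambda>K. exit_upto K D p"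
  let ?X = "\<lambda>K \<omega>. started_at p B (exit_upto K D p \<omega>) \<omega>"
  obtain S where S: "integrable M S" "AE \<omega> in M. \<forall>K. norm (?X K \<omega>) ^ 4 \<le> S \<omega>"
    using exit_path_dominated[OF D p E \<kappa>] by blast
  have A: "0 \<le> A"
  proof (rule ccontr)
    assume "\<not> 0 \<le> A"
    then have "A * (1 + (norm p)\<^sup>2) < 0"
      by (intro mult_neg_pos) (auto intro: add_pos_nonneg)
    then show False
      using growth(1)[of p] p E(2) by auto
  qed
  have meas: "u1 \<in> borel_measurable borel" "u2 \<in> borel_measurable borel"
    using caloric_measurable(2)[OF u1, of 0] caloric_measurable(2)[OF u2, of 0] by auto
  note [measurable] = meas exit_upto_measurable[OF D] measurable_at_exit[OF D]
  have sq: "(norm z)\<^sup>2 \<le> 1 + norm z ^ 4" for z :: "real \<times> real"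
  proof -
    have "0 \<le> ((norm z)\<^sup>2 - 1)\<^sup>2 + (norm z)\<^sup>2" by simp
    then show ?thesis by (simp add: power2_eq_square eval_nat_numeral algebra_simps)
  qed
  have sq4: "1 + (norm z)\<^sup>2 \<le> 2 * (1 + norm z ^ 4)" for z :: "real \<times> real"
    using sq[of z] zero_le_power[OF norm_ge_zero[of z], of 4] unfolding distrib_left by linarith
  have g1: "\<bar>u1 z\<bar> \<le> 2 * A * (1 + norm z ^ 4)" if "z \<in> E" for z
  proof -
    have "A * (1 + (norm z)\<^sup>2) \<le> A * (2 * (1 + norm z ^ 4))"
      using sq4[of z] A by (rule mult_left_mono)
    then show ?thesis using growth(1)[OF that] by (simp add: mult_ac)
  qed
  have g12: "(u1 z)\<^sup>2 \<le> 2 * A\<^sup>2 * (1 + norm z ^ 4)" if "z \<in> E" for z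
  proof -
    have "\<bar>u1 z\<bar>\<^sup>2 \<le> (A * (1 + (norm z)\<^sup>2))\<^sup>2"
      using growth(1)[OF that] by (intro power_mono) auto
    also have "\<dots> \<le> A\<^sup>2 * (2 * (1 + norm z ^ 4))"
    proof -
      have "0 \<le> ((norm z)\<^sup>2 - 1)\<^sup>2" by simp
      then have "(1 + (norm z)\<^sup>2)\<^sup>2 \<le> 2 * (1 + norm z ^ 4)"
        by (simp add: power2_eq_square eval_nat_numeral algebra_simps)
      then show ?thesis unfolding power_mult_distrib by (intro mult_left_mono) auto
    qed
    finally show ?thesis by (simp add: algebra_simps)
  qed
  let ?b = "\<lambda>\<omega>. 1 + S \<omega>"
  have bi: "integrable M ?b" using S(1) by auto
  have XE: "?X K \<omega> \<in> E" if "\<omega> \<in> space M" for K \<omega>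
    by (rule at_exit_closed[OF D(1) p E that])
  have ae: "AE \<omega> in M. \<forall>K. \<bar>u1 (?X K \<omega>)\<bar> \<le> 2 * A * ?b \<omega> \<and> (u1 (?X K \<omega>))\<^sup>2 \<le> 2 * A\<^sup>2 * ?b \<omega> \<and> \<bar>u2 (?X K \<omega>)\<bar> \<le> A * ?b \<omega>"
    using S(2) AE_space
  proof (eventually_elim, intro allI)
    fix \<omega> K assume *: "\<forall>K. norm (?X K \<omega>) ^ 4 \<le> S \<omega>" "\<omega> \<in> space M"
    have le: "1 + norm (?X K \<omega>) ^ 4 \<le> ?b \<omega>" using * by auto
    show "\<bar>u1 (?X K \<omega>)\<bar> \<le> 2 * A * ?b \<omega> \<and> (u1 (?X K \<omega>))\<^sup>2 \<le> 2 * A\<^sup>2 * ?b \<omega> \<and> \<bar>u2 (?X K \<omega>)\<bar> \<le> A * ?b \<omega>"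
      using A by (intro conjI order_trans[OF g1[OF XE[OF *(2)]]] order_trans[OF g12[OF XE[OF *(2)]]]
        order_trans[OF growth(2)[OF XE[OF *(2)]]] mult_left_mono le) auto
  qed
  have int_u1: "integrable M (\<lambda>\<omega>. u1 (?X K \<omega>))" for K
    by (rule Bochner_Integration.integrable_bound[OF integrable_mult_right[OF bi, of "2 * A"]])
      (measurable, use ae in \<open>auto elim!: eventually_mono intro: order_trans[OF _ abs_ge_self]\<close>)
  have int_u2: "integrable M (\<lambda>\<omega>. u2 (?X K \<omega>))" for K
    by (rule Bochner_Integration.integrable_bound[OF integrable_mult_right[OF bi, of "A"]])
      (measurable, use ae in \<open>auto elim!: eventually_mono intro: order_trans[OF _ abs_ge_self]\<close>)
  have int_u12: "integrable M (\<lambda>\<omega>. (u1 (?X K \<omega>))\<^sup>2)" for K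
    by (rule Bochner_Integration.integrable_bound[OF integrable_mult_right[OF bi, of "2 * A\<^sup>2"]])
      (measurable, use ae in \<open>auto elim!: eventually_mono intro: order_trans[OF _ abs_ge_self]\<close>)
  have int_T: "integrable M (\<lambda>\<omega>. ?T K \<omega> ^ k)" for K k
    using power_mono[OF exit_upto_bounds(2,1), of K D p _ k]
    by (intro integrable_const_bound[where B = "real K ^ k"]) (auto simp: exit_upto_bounds(1))
  have int_Tu: "integrable M (\<lambda>\<omega>. ?T K \<omega> * u1 (?X K \<omega>))" for K
  proof (rule Bochner_Integration.integrable_bound)
    show "integrable M (\<lambda>\<omega>. real K * u1 (?X K \<omega>))" using int_u1 by auto
    show "AE \<omega> in M. norm (?T K \<omega> * u1 (?X K \<omega>)) \<le> norm (real K * u1 (?X K \<omega>))"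
      by (intro AE_I2) (auto simp: abs_mult exit_upto_bounds intro!: mult_right_mono)
  qed measurable
  have E1: "(\<integral>\<omega>. ?T K \<omega> \<partial>M) = u1 p - (\<integral>\<omega>. u1 (?X K \<omega>) \<partial>M)" for K
    using integrable_caloric_at_exit(2)[OF D u1, of p K] int_u1 int_T[of K 1] by simp
  have E2: "(\<integral>\<omega>. (?T K \<omega>)\<^sup>2 \<partial>M) = u2 p - (\<integral>\<omega>. u2 (?X K \<omega>) \<partial>M) - 2 * (\<integral>\<omega>. ?T K \<omega> * u1 (?X K \<omega>) \<partial>M)" for K
    using integrable_caloric_at_exit(2)[OF D u2, of p K] int_u2[of K] int_Tu[of K] int_T[of K 2]
    by (simp add: mult.assoc)
  define I where "I = (\<integral>\<omega>. ?b \<omega> \<partial>M)"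
  have bu2: "\<bar>\<integral>\<omega>. u2 (?X K \<omega>) \<partial>M\<bar> \<le> A * I" for K
  proof -
    have "\<bar>\<integral>\<omega>. u2 (?X K \<omega>) \<partial>M\<bar> \<le> (\<integral>\<omega>. \<bar>u2 (?X K \<omega>)\<bar> \<partial>M)"
      by (rule integral_abs_bound)
    also have "\<dots> \<le> (\<integral>\<omega>. A * ?b \<omega> \<partial>M)"
      using ae bi int_u2 by (intro integral_mono_AE) (auto elim!: eventually_mono)
    finally show ?thesis by (simp add: I_def)
  qed
  have bu12: "(\<integral>\<omega>. (u1 (?X K \<omega>))\<^sup>2 \<partial>M) \<le> 2 * A\<^sup>2 * I" for K
  proof -
    have "(\<integral>\<omega>. (u1 (?X K \<omega>))\<^sup>2 \<partial>M) \<le> (\<integral>\<omega>. 2 * A\<^sup>2 * ?b \<omega> \<partial>M)"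
      using ae bi int_u12 by (intro integral_mono_AE) (auto elim!: eventually_mono)
    then show ?thesis by (simp add: I_def)
  qed
  \<comment> \<open>From \<open>- 2 T u \<le> T^2 / 2 + 2 u^2\<close>: half of \<open>E T^2\<close>
    is absorbed on the left, which doubles the remaining terms.\<close>
  define Q where "Q = 2 * (u2 p + A * I + 4 * A\<^sup>2 * I)"
  have bT2: "(\<integral>\<omega>. (?T K \<omega>)\<^sup>2 \<partial>M) \<le> Q" for K
  proof -
    have "- 2 * (\<integral>\<omega>. ?T K \<omega> * u1 (?X K \<omega>) \<partial>M) = (\<integral>\<omega>. - 2 * (?T K \<omega> * u1 (?X K \<omega>)) \<partial>M)"
      by (subst Bochner_Integration.integral_mult_right_zero) simp
    also have "\<dots> \<le> (\<integral>\<omega>. (?T K \<omega>)\<^sup>2 / 2 + 2 * (u1 (?X K \<omega>))\<^sup>2 \<partial>M)"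
    proof (rule integral_mono)
      fix \<omega>
      have "0 \<le> (?T K \<omega> / 2 + u1 (?X K \<omega>))\<^sup>2" by simp
      then show "- 2 * (?T K \<omega> * u1 (?X K \<omega>)) \<le> (?T K \<omega>)\<^sup>2 / 2 + 2 * (u1 (?X K \<omega>))\<^sup>2"
        by (simp add: power2_eq_square algebra_simps)
    qed (use int_Tu int_T[of K 2] int_u12 in auto)
    also have "\<dots> = (\<integral>\<omega>. (?T K \<omega>)\<^sup>2 \<partial>M) / 2 + 2 * (\<integral>\<omega>. (u1 (?X K \<omega>))\<^sup>2 \<partial>M)"
      using int_T[of K 2] int_u12[of K] by simp
    finally have "- 2 * (\<integral>\<omega>. ?T K \<omega> * u1 (?X K \<omega>) \<partial>M) \<le>
        (\<integral>\<omega>. (?T K \<omega>)\<^sup>2 \<partial>M) / 2 + 2 * (\<integral>\<omega>. (u1 (?X K \<omega>))\<^sup>2 \<partial>M)" .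
    moreover have "- (\<integral>\<omega>. u2 (?X K \<omega>) \<partial>M) \<le> A * I"
      using bu2[of K] by linarith
    ultimately show ?thesis
      using E2[of K] bu12[of K] unfolding Q_def mult.assoc by argo
  qed
  let ?e = "exit_time D (started_at p B)"
  note [measurable] = exit_time_measurable[OF D]
  have "(\<integral>\<^sup>+\<omega>. ?e \<omega> ^ 2 \<partial>M) \<le> ennreal Q"
  proof -
    have "(\<integral>\<^sup>+\<omega>. ennreal (?T K \<omega> ^ 2) \<partial>M) \<le> ennreal Q" for K
      using int_T[of K 2] bT2[of K] by (subst nn_integral_eq_integral) (auto intro: ennreal_leI)
    then show ?thesis
      using exit_moment_SUP(1)[OF D, of 2 p] unfolding exit_moment_def by (auto intro: SUP_least)
  qed
  then have fin2: "(\<integral>\<^sup>+\<omega>. ?e \<omega> ^ 2 \<partial>M) < \<infinity>"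
    by (simp add: le_less_trans)
  have ae_fin: "AE \<omega> in M. ?e \<omega> \<noteq> \<infinity>"
  proof -
    have "AE \<omega> in M. ?e \<omega> ^ 2 \<noteq> \<infinity>"
      using fin2 by (intro nn_integral_PInf_AE) auto
    then show ?thesis
      by (auto elim!: eventually_mono simp: power2_eq_square ennreal_top_mult)
  qed
  have ev: "AE \<omega> in M. \<forall>\<^sub>F K in sequentially. u1 (?X K \<omega>) = 0 \<and> u2 (?X K \<omega>) = 0"
    using ae_fin AE_space
  proof eventually_elim
    case (elim \<omega>)
    then obtain r where r: "?e \<omega> = ennreal r" "0 \<le> r"
      by (cases "?e \<omega>") auto
    \<comment> \<open>Strict, so that from \<open>N\<close> on the truncated time is below
      \<open>K\<close> and the path has really left the domain.\<close>
    obtain N :: nat where N: "r < real N"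
      using reals_Archimedean2 by blast
    have "u1 (?X K \<omega>) = 0 \<and> u2 (?X K \<omega>) = 0" if "N \<le> K" for K
    proof -
      have "exit_upto K D p \<omega> = r"
        using r N that by (intro exit_upto_eq) auto
      then have "exit_upto K D p \<omega> < real K"
        using N that by simp
      from at_exit_upto(1)[OF D(1) elim(2) this] show ?thesis
        by (intro zero XE elim)
    qed
    then show ?case
      by (rule eventually_sequentiallyI)
  qed
  have l1: "(\<lambda>K. \<integral>\<omega>. u1 (?X K \<omega>) \<partial>M) \<longlonglongrightarrow> (\<integral>\<omega>. 0 \<partial>M)"
  proof (rule integral_dominated_convergence)
    show "integrable M (\<lambda>\<omega>. 2 * A * ?b \<omega>)" using bi by auto
    show "AE \<omega> in M. (\<lambda>K. u1 (?X K \<omega>)) \<longlonglongrightarrow> 0"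
      using ev by eventually_elim (auto intro!: tendsto_eventually elim: eventually_mono)
    show "AE \<omega> in M. norm (u1 (?X K \<omega>)) \<le> 2 * A * ?b \<omega>" for K
      using ae by (auto elim!: eventually_mono)
  qed measurable
  have l2: "(\<lambda>K. \<integral>\<omega>. u2 (?X K \<omega>) \<partial>M) \<longlonglongrightarrow> (\<integral>\<omega>. 0 \<partial>M)"
  proof (rule integral_dominated_convergence)
    show "integrable M (\<lambda>\<omega>. A * ?b \<omega>)" using bi by auto
    show "AE \<omega> in M. (\<lambda>K. u2 (?X K \<omega>)) \<longlonglongrightarrow> 0"
      using ev by eventually_elim (auto intro!: tendsto_eventually elim: eventually_mono)
    show "AE \<omega> in M. norm (u2 (?X K \<omega>)) \<le> A * ?b \<omega>" for K
      using ae by (auto elim!: eventually_mono)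
  qed measurable
  have int_e2: "integrable M (\<lambda>\<omega>. (enn2real (?e \<omega>))\<^sup>2)"
  proof (rule integrableI_nonneg)
    have "(\<integral>\<^sup>+\<omega>. ennreal ((enn2real (?e \<omega>))\<^sup>2) \<partial>M) \<le> (\<integral>\<^sup>+\<omega>. ?e \<omega> ^ 2 \<partial>M)"
      by (intro nn_integral_mono) (auto simp: ennreal_power[symmetric] ennreal_enn2real_if)
    then show "(\<integral>\<^sup>+\<omega>. ennreal ((enn2real (?e \<omega>))\<^sup>2) \<partial>M) < \<infinity>"
      using fin2 by (rule le_less_trans)
  qed auto
  have l3: "(\<lambda>K. \<integral>\<omega>. ?T K \<omega> * u1 (?X K \<omega>) \<partial>M) \<longlonglongrightarrow> (\<integral>\<omega>. 0 \<partial>M)"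
  proof (rule integral_dominated_convergence)
    show "integrable M (\<lambda>\<omega>. (enn2real (?e \<omega>))\<^sup>2 + 2 * A\<^sup>2 * ?b \<omega>)" using bi int_e2 by auto
    show "AE \<omega> in M. (\<lambda>K. ?T K \<omega> * u1 (?X K \<omega>)) \<longlonglongrightarrow> 0"
      using ev by eventually_elim (auto intro!: tendsto_eventually elim: eventually_mono)
    show "AE \<omega> in M. norm (?T K \<omega> * u1 (?X K \<omega>)) \<le> (enn2real (?e \<omega>))\<^sup>2 + 2 * A\<^sup>2 * ?b \<omega>" for K
      using ae ae_fin
    proof eventually_elim
      case (elim \<omega>)
      have "?T K \<omega> \<le> enn2real (?e \<omega>)"
        using elim(2) unfolding exit_upto_def by (intro enn2real_mono) (auto simp: less_top)
      then have "(?T K \<omega>)\<^sup>2 \<le> (enn2real (?e \<omega>))\<^sup>2"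
        by (intro power_mono exit_upto_bounds)
      moreover have "\<bar>?T K \<omega> * u1 (?X K \<omega>)\<bar> \<le> (?T K \<omega>)\<^sup>2 + (u1 (?X K \<omega>))\<^sup>2"
      proof -
        have "0 \<le> (\<bar>?T K \<omega>\<bar> - \<bar>u1 (?X K \<omega>)\<bar>)\<^sup>2" by simp
        then have "2 * \<bar>?T K \<omega> * u1 (?X K \<omega>)\<bar> \<le> (?T K \<omega>)\<^sup>2 + (u1 (?X K \<omega>))\<^sup>2"
          unfolding abs_mult by (simp add: power2_eq_square algebra_simps)
        then show ?thesis
          using abs_ge_zero[of "?T K \<omega> * u1 (?X K \<omega>)"] by linarith
      qed
      moreover have "(u1 (?X K \<omega>))\<^sup>2 \<le> 2 * A\<^sup>2 * ?b \<omega>"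
        using elim(1) by blast
      ultimately show ?case unfolding real_norm_def by linarith
    qed
  qed measurable
  have "(\<lambda>K. \<integral>\<omega>. ?T K \<omega> ^ 1 \<partial>M) \<longlonglongrightarrow> u1 p - 0"
    using tendsto_diff[OF tendsto_const l1, of "u1 p"] by (simp add: E1)
  then show "exit_moment M B D 1 p = ennreal (u1 p)"
    by (intro exit_moment_limit D) auto
  have "(\<lambda>K. \<integral>\<omega>. ?T K \<omega> ^ 2 \<partial>M) \<longlonglongrightarrow> u2 p - 0 - 2 * 0"
    unfolding E2 using l2 l3 by (intro tendsto_intros) auto
  then show "exit_moment M B D 2 p = ennreal (u2 p)"
    by (intro exit_moment_limit D) auto
qed

end

subsection \<open>Conics symmetric in both axes\<close>

text \<open>A certificate that \<open>u1\<close> and \<open>u2\<close> are the first two exit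
  moments: \<open>\<Delta> u1 = - 1\<close> and \<open>\<Delta> u2 = - 2 u1\<close> in caloric form,
  zero values outside \<open>D\<close>, and the comparison with \<open>quartic\<close> on a closed
  set \<open>E\<close> that contains the path up to its exit.\<close>

definition polynomial_exit :: "(real \<times> real) set \<Rightarrow> (real \<times> real \<Rightarrow> real) \<Rightarrow> (real \<times> real \<Rightarrow> real) \<Rightarrow> bool" where
  "polynomial_exit D u1 u2 \<longleftrightarrow> open D \<and> D \<noteq> UNIV \<and>
    caloric (\<lambda>t z. u1 z + t) \<and> caloric (\<lambda>t z. u2 z + 2 * t * u1 z + t\<^sup>2) \<and>
    (\<exists>E. closed E \<and> D \<subseteq> E \<and> (\<forall>z\<in>E - D. u1 z = 0 \<and> u2 z = 0) \<and>
      (\<exists>\<kappa>>0. \<exists>C. \<forall>z\<in>E. \<kappa> * norm z ^ 4 \<le> quartic z + C) \<and>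
      (\<exists>A. \<forall>z\<in>E. \<bar>u1 z\<bar> \<le> A * (1 + (norm z)\<^sup>2) \<and> \<bar>u2 z\<bar> \<le> A * (1 + norm z ^ 4)))"

lemma ennreal_eq_pos_iff: "0 < c \<Longrightarrow> ennreal x = ennreal c \<longleftrightarrow> x = c"
  by (cases "0 \<le> x") (auto simp: ennreal_neg)

lemma level_curves_polynomial_exit:
  assumes "planar_brownian_motion M B" and pe: "polynomial_exit D u1 u2" and c: "0 < c1" "0 < c2"
  shows "level_curve M B D 1 c1 \<inter> level_curve M B D 2 c2 = {p \<in> D. u1 p = c1 \<and> u2 p = c2}"
proof -
  interpret planar_brownian_motion M B by fact
  obtain E \<kappa> C A where E: "closed E" "D \<subseteq> E" "\<forall>z\<in>E - D. u1 z = 0 \<and> u2 z = 0"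
      "0 < \<kappa>" "\<forall>z\<in>E. \<kappa> * norm z ^ 4 \<le> quartic z + C"
      "\<forall>z\<in>E. \<bar>u1 z\<bar> \<le> A * (1 + (norm z)\<^sup>2) \<and> \<bar>u2 z\<bar> \<le> A * (1 + norm z ^ 4)"
    using pe unfolding polynomial_exit_def by blast
  have D: "open D" "D \<noteq> UNIV" "caloric (\<lambda>t z. u1 z + t)" "caloric (\<lambda>t z. u2 z + 2 * t * u1 z + t\<^sup>2)"
    using pe unfolding polynomial_exit_def by blast+
  have "exit_moment M B D 1 p = ennreal (u1 p) \<and> exit_moment M B D 2 p = ennreal (u2 p)" if "p \<in> D" for p
    using exit_moments_polynomial[OF D(1,2) that E(1,2) E(4) _ D(3,4), of C A] E(3,5,6) by blast
  then show ?thesis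
    using c by (auto simp: level_curve_def ennreal_eq_pos_iff)
qed

text \<open>The witness is the number of solutions of \<open>u1 = c1\<close> and
  \<open>u2 = c2\<close> in \<open>D\<close>, which mentions neither \<open>M\<close> nor
  \<open>B\<close>. What remains for each domain is to count the points sharing both values with a
  given point.\<close>

lemma level_curves_card:
  assumes pe: "polynomial_exit D u1 u2"
    and card: "\<And>p. p \<in> D \<Longrightarrow> 0 < u1 p \<Longrightarrow> 0 < u2 p \<Longrightarrow> card {q \<in> D. u1 q = u1 p \<and> u2 q = u2 p} \<in> S"
  shows "\<exists>N :: real \<Rightarrow> real \<Rightarrow> nat. \<forall>(M :: 'w measure) B c\<^sub>1 c\<^sub>2.
        planar_brownian_motion M B \<and> c\<^sub>1 > 0 \<and> c\<^sub>2 > 0 \<and>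
        level_curve M B D 1 c\<^sub>1 \<inter> level_curve M B D 2 c\<^sub>2 \<noteq> {} \<longrightarrow>
        card (level_curve M B D 1 c\<^sub>1 \<inter> level_curve M B D 2 c\<^sub>2) = N c\<^sub>1 c\<^sub>2 \<and> N c\<^sub>1 c\<^sub>2 \<in> S"
proof (intro exI allI impI)
  fix M :: "'w measure" and B c1 c2
  assume *: "planar_brownian_motion M B \<and> c1 > 0 \<and> c2 > 0 \<and> level_curve M B D 1 c1 \<inter> level_curve M B D 2 c2 \<noteq> {}"
  have eq: "level_curve M B D 1 c1 \<inter> level_curve M B D 2 c2 = {p \<in> D. u1 p = c1 \<and> u2 p = c2}"
    using * by (intro level_curves_polynomial_exit[OF _ pe]) auto
  then obtain p where "p \<in> D" "u1 p = c1" "u2 p = c2"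
    using * by blast
  then show "card (level_curve M B D 1 c1 \<inter> level_curve M B D 2 c2) = card {p \<in> D. u1 p = c1 \<and> u2 p = c2} \<and>
      card {p \<in> D. u1 p = c1 \<and> u2 p = c2} \<in> S"
    using card[of p] * unfolding eq by auto
qed

lemma norm_prod_power2: "(norm (z :: real \<times> real))\<^sup>2 = (fst z)\<^sup>2 + (snd z)\<^sup>2"
  by (simp add: norm_prod_def)

lemma norm_prod_power4: "norm (z :: real \<times> real) ^ 4 = ((fst z)\<^sup>2 + (snd z)\<^sup>2)\<^sup>2"
  unfolding norm_prod_power2[symmetric] by simp

lemma growth_product:
  fixes f g :: "real \<times> real \<Rightarrow> real"
  assumes "\<And>z. \<bar>f z\<bar> \<le> F * (1 + (norm z)\<^sup>2)" "\<And>z. \<bar>g z\<bar> \<le> G * (1 + (norm z)\<^sup>2)"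
  shows "\<exists>A. \<forall>z. \<bar>k * f z\<bar> \<le> A * (1 + (norm z)\<^sup>2) \<and> \<bar>f z * g z\<bar> \<le> A * (1 + norm z ^ 4)"
proof -
  have FG: "0 \<le> F" "0 \<le> G"
    using assms(1)[of 0] assms(2)[of 0] by (auto dest: order_trans[OF abs_ge_zero])
  define A where "A = \<bar>k\<bar> * F + 2 * F * G"
  have "\<bar>k * f z\<bar> \<le> A * (1 + (norm z)\<^sup>2) \<and> \<bar>f z * g z\<bar> \<le> A * (1 + norm z ^ 4)" for z
  proof
    have "\<bar>k * f z\<bar> \<le> \<bar>k\<bar> * (F * (1 + (norm z)\<^sup>2))"
      unfolding abs_mult by (intro mult_left_mono assms) auto
    also have "\<dots> \<le> A * (1 + (norm z)\<^sup>2)"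
      unfolding mult.assoc[symmetric] A_def using FG by (intro mult_right_mono) auto
    finally show "\<bar>k * f z\<bar> \<le> A * (1 + (norm z)\<^sup>2)" .
    have "\<bar>f z * g z\<bar> \<le> (F * (1 + (norm z)\<^sup>2)) * (G * (1 + (norm z)\<^sup>2))"
      unfolding abs_mult using FG by (intro mult_mono assms) auto
    also have "\<dots> = F * G * (1 + (norm z)\<^sup>2)\<^sup>2"
      by (simp add: power2_eq_square mult_ac)
    also have "\<dots> \<le> F * G * (2 * (1 + norm z ^ 4))"
    proof (intro mult_left_mono)
      have "0 \<le> ((norm z)\<^sup>2 - 1)\<^sup>2" by simp
      then show "(1 + (norm z)\<^sup>2)\<^sup>2 \<le> 2 * (1 + norm z ^ 4)"
        by (simp add: power2_eq_square eval_nat_numeral algebra_simps)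
    qed (use FG in auto)
    also have "\<dots> = (2 * F * G) * (1 + norm z ^ 4)"
      by simp
    also have "\<dots> \<le> A * (1 + norm z ^ 4)"
      unfolding A_def using FG by (intro mult_right_mono) auto
    finally show "\<bar>f z * g z\<bar> \<le> A * (1 + norm z ^ 4)" .
  qed
  then show ?thesis by blast
qed

lemma growth_quadratic:
  "\<exists>F. \<forall>z :: real \<times> real. \<bar>e + b * snd z + P * (fst z)\<^sup>2 + Q * (snd z)\<^sup>2\<bar> \<le> F * (1 + (norm z)\<^sup>2)"
proof (intro exI allI)
  fix z :: "real \<times> real"
  have x: "(fst z)\<^sup>2 \<le> 1 + (norm z)\<^sup>2" and y: "(snd z)\<^sup>2 \<le> 1 + (norm z)\<^sup>2" and 1: "1 \<le> 1 + (norm z)\<^sup>2"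
    by (auto simp: norm_prod_power2)
  have "0 \<le> (\<bar>snd z\<bar> - 1)\<^sup>2" by simp
  then have "2 * \<bar>snd z\<bar> \<le> 1 + (snd z)\<^sup>2" by (simp add: power2_eq_square algebra_simps)
  then have y1: "\<bar>snd z\<bar> \<le> 1 + (norm z)\<^sup>2"
    unfolding norm_prod_power2 using zero_le_power2[of "fst z"] zero_le_power2[of "snd z"] by linarith
  have "\<bar>e + b * snd z + P * (fst z)\<^sup>2 + Q * (snd z)\<^sup>2\<bar> \<le> \<bar>e\<bar> + \<bar>b\<bar> * \<bar>snd z\<bar> + \<bar>P\<bar> * (fst z)\<^sup>2 + \<bar>Q\<bar> * (snd z)\<^sup>2"
    using abs_triangle_ineq[of "e + b * snd z + P * (fst z)\<^sup>2" "Q * (snd z)\<^sup>2"]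
      abs_triangle_ineq[of "e + b * snd z" "P * (fst z)\<^sup>2"] abs_triangle_ineq[of e "b * snd z"]
    by (simp add: abs_mult)
  also have "\<dots> \<le> \<bar>e\<bar> * (1 + (norm z)\<^sup>2) + \<bar>b\<bar> * (1 + (norm z)\<^sup>2) + \<bar>P\<bar> * (1 + (norm z)\<^sup>2) + \<bar>Q\<bar> * (1 + (norm z)\<^sup>2)"
    using mult_left_mono[OF 1 abs_ge_zero[of e]] mult_left_mono[OF y1 abs_ge_zero[of b]]
      mult_left_mono[OF x abs_ge_zero[of P]] mult_left_mono[OF y abs_ge_zero[of Q]] by simp
  finally show "\<bar>e + b * snd z + P * (fst z)\<^sup>2 + Q * (snd z)\<^sup>2\<bar> \<le> (\<bar>e\<bar> + \<bar>b\<bar> + \<bar>P\<bar> + \<bar>Q\<bar>) * (1 + (norm z)\<^sup>2)"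
    by (simp add: distrib_right)
qed

text \<open>On a compact set the comparison with \<open>quartic\<close> holds with
  \<open>\<kappa> = 1\<close>, since \<open>C\<close> can bound the difference of two continuous
  functions.\<close>

lemma polynomial_exit_compact:
  assumes D: "open D" "D \<noteq> UNIV" and c: "caloric (\<lambda>t z. u1 z + t)" "caloric (\<lambda>t z. u2 z + 2 * t * u1 z + t\<^sup>2)"
    and cont: "continuous_on UNIV u1" "continuous_on UNIV u2"
    and E: "compact E" "D \<subseteq> E" "\<And>z. z \<in> E \<Longrightarrow> z \<notin> D \<Longrightarrow> u1 z = 0 \<and> u2 z = 0"
  shows "polynomial_exit D u1 u2"
proof -
  have b: "\<exists>C. \<forall>z\<in>E. \<bar>f z\<bar> \<le> C" if "continuous_on UNIV f" for f :: "real \<times> real \<Rightarrow> real"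
  proof -
    have "bounded (f ` E)"
      by (intro compact_imp_bounded compact_continuous_image continuous_on_subset[OF that] E) auto
    then show ?thesis by (auto simp: bounded_iff)
  qed
  obtain C where C: "\<And>z. z \<in> E \<Longrightarrow> \<bar>norm z ^ 4 - quartic z\<bar> \<le> C"
  proof -
    have "continuous_on UNIV (\<lambda>z :: real \<times> real. norm z ^ 4 - quartic z)"
      unfolding quartic_def by (intro continuous_intros)
    from b[OF this] show ?thesis using that by blast
  qed
  obtain A1 A2 where A: "\<And>z. z \<in> E \<Longrightarrow> \<bar>u1 z\<bar> \<le> A1" "\<And>z. z \<in> E \<Longrightarrow> \<bar>u2 z\<bar> \<le> A2"
    using b[OF cont(1)] b[OF cont(2)] by blast
  have "\<bar>u1 z\<bar> \<le> (\<bar>A1\<bar> + \<bar>A2\<bar>) * (1 + (norm z)\<^sup>2) \<and> \<bar>u2 z\<bar> \<le> (\<bar>A1\<bar> + \<bar>A2\<bar>) * (1 + norm z ^ 4)" if "z \<in> E" for z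
  proof -
    have "(\<bar>A1\<bar> + \<bar>A2\<bar>) * 1 \<le> (\<bar>A1\<bar> + \<bar>A2\<bar>) * (1 + (norm z)\<^sup>2)" "(\<bar>A1\<bar> + \<bar>A2\<bar>) * 1 \<le> (\<bar>A1\<bar> + \<bar>A2\<bar>) * (1 + norm z ^ 4)"
      by (intro mult_left_mono; simp)+
    moreover have "\<bar>u1 z\<bar> \<le> (\<bar>A1\<bar> + \<bar>A2\<bar>) * 1" "\<bar>u2 z\<bar> \<le> (\<bar>A1\<bar> + \<bar>A2\<bar>) * 1"
      using A[OF that] by auto
    ultimately show ?thesis
      by (meson order_trans)
  qed
  moreover have "1 * norm z ^ 4 \<le> quartic z + C" if "z \<in> E" for z
    using C[OF that] by linarith
  ultimately have "\<exists>\<kappa>>0. \<exists>C. \<forall>z\<in>E. \<kappa> * norm z ^ 4 \<le> quartic z + C"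
    "\<exists>A. \<forall>z\<in>E. \<bar>u1 z\<bar> \<le> A * (1 + (norm z)\<^sup>2) \<and> \<bar>u2 z\<bar> \<le> A * (1 + norm z ^ 4)"
    using zero_less_one by blast+
  then show ?thesis
    unfolding polynomial_exit_def using D c E(2,3) compact_imp_closed[OF E(1)] by blast
qed

text \<open>The coefficients \<open>a0\<close>, \<open>bx\<close>, \<open>cy\<close> solve \<open>\<Delta>(f g) = - k f\<close>, so that \<open>f g\<close> is the second moment when
  \<open>k f / 2\<close> is the first. Negative \<open>P\<close> gives the hyperbola (\<open>e < 0\<close>) and the wedge (\<open>e = 0\<close>).\<close>

locale even_conic =
  fixes e P Q :: real
  assumes PQ: "0 < P + Q" "5 * P + Q \<noteq> 0" "P + 5 * Q \<noteq> 0"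
    and nondegenerate: "1 + P / (5 * P + Q) + Q / (P + 5 * Q) \<noteq> 0"
begin

definition f :: "real \<times> real \<Rightarrow> real" where "f z = e - P * (fst z)\<^sup>2 - Q * (snd z)\<^sup>2"
definition k :: real where "k = 1 / (P + Q)"
text \<open>Expanding \<open>\<Delta>(f g) = - k f\<close> produces the bracket
  \<open>2 (bx + cy) + k\<close> as a factor of \<open>f\<close>, and \<open>s\<close> is its value.
  Since \<open>bx\<close> and \<open>cy\<close> are multiples of \<open>s\<close>, this is a linear
  equation for \<open>s\<close>, solvable by \<open>nondegenerate\<close>.\<close>

definition s :: real where "s = k / (1 + P / (5 * P + Q) + Q / (P + 5 * Q))"
definition bx :: real where "bx = - (s * (P / (5 * P + Q))) / 2"
definition cy :: real where "cy = - (s * (Q / (P + 5 * Q))) / 2"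
definition a0 :: real where "a0 = e * s * k / 2"
definition g :: "real \<times> real \<Rightarrow> real" where "g z = a0 + bx * (fst z)\<^sup>2 + cy * (snd z)\<^sup>2"

lemma k: "k * (P + Q) = 1" "k > 0"
  using PQ by (auto simp: k_def)

lemma s: "s \<noteq> 0" "s = 2 * (bx + cy) + k"
proof -
  show "s \<noteq> 0"
    using k nondegenerate by (simp add: s_def)
  have half: "2 * (- x / 2) = - x" for x :: real
    by simp
  have "s * (1 + P / (5 * P + Q) + Q / (P + 5 * Q)) = k"
    using nondegenerate by (simp add: s_def)
  moreover have "2 * bx = - (s * (P / (5 * P + Q)))" "2 * cy = - (s * (Q / (P + 5 * Q)))"
    unfolding bx_def cy_def by (simp_all only: half)
  ultimately show "s = 2 * (bx + cy) + k"
    by (simp add: algebra_simps)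
qed

text \<open>Comparison of coefficients in
  \<open>s f = 2 (P + Q) g + 8 P bx x^2 + 8 Q cy y^2\<close>, which is
  \<open>\<Delta>(f g) = - k f\<close> rearranged.\<close>

lemma coefficients:
  "2 * a0 * (P + Q) = e * s" "2 * (5 * P + Q) * bx = - s * P" "2 * (P + 5 * Q) * cy = - s * Q"
proof -
  have "2 * a0 * (P + Q) = e * s * (k * (P + Q))"
    by (simp add: a0_def)
  then show "2 * a0 * (P + Q) = e * s"
    by (simp add: k(1))
  have half: "2 * D * (- (s * (r / D)) / 2) = - s * r" if "D \<noteq> 0" for D r :: real
    using that by simp
  show "2 * (5 * P + Q) * bx = - s * P" "2 * (P + 5 * Q) * cy = - s * Q"
    unfolding bx_def cy_def by (rule half, rule PQ)+
qed

lemma caloric_f: "caloric (\<lambda>t z. k / 2 * f z + t)"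
proof -
  have "caloric (\<lambda>t z. (k / 2 * e) * (heat_poly 0 t (fst z) * heat_poly 0 t (snd z)) +
      ((- (k / 2 * P)) * (heat_poly 2 t (fst z) * heat_poly 0 t (snd z)) +
       (- (k / 2 * Q)) * (heat_poly 0 t (fst z) * heat_poly 2 t (snd z))))"
    by (intro caloric_add caloric_heat_prod) auto
  also have "(\<lambda>t z. (k / 2 * e) * (heat_poly 0 t (fst z) * heat_poly 0 t (snd z)) +
      ((- (k / 2 * P)) * (heat_poly 2 t (fst z) * heat_poly 0 t (snd z)) +
       (- (k / 2 * Q)) * (heat_poly 0 t (fst z) * heat_poly 2 t (snd z)))) = (\<lambda>t z. k / 2 * f z + t)"
  proof (intro ext)
    fix t :: real and z :: "real \<times> real"
    show "(k / 2 * e) * (heat_poly 0 t (fst z) * heat_poly 0 t (snd z)) +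
      ((- (k / 2 * P)) * (heat_poly 2 t (fst z) * heat_poly 0 t (snd z)) +
       (- (k / 2 * Q)) * (heat_poly 0 t (fst z) * heat_poly 2 t (snd z))) = k / 2 * f z + t"
      using k(1) unfolding heat_poly_simps f_def by algebra
  qed
  finally show ?thesis .
qed

lemma caloric_fg: "caloric (\<lambda>t z. f z * g z + 2 * t * (k / 2 * f z) + t\<^sup>2)"
proof -
  let ?h = "\<lambda>t z. (e * a0) * (heat_poly 0 t (fst z) * heat_poly 0 t (snd z)) +
      ((e * bx - P * a0) * (heat_poly 2 t (fst z) * heat_poly 0 t (snd z)) +
      ((e * cy - Q * a0) * (heat_poly 0 t (fst z) * heat_poly 2 t (snd z)) +
      ((- (P * bx)) * (heat_poly 4 t (fst z) * heat_poly 0 t (snd z)) +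
      ((- (Q * cy)) * (heat_poly 0 t (fst z) * heat_poly 4 t (snd z)) +
       (- (P * cy + Q * bx)) * (heat_poly 2 t (fst z) * heat_poly 2 t (snd z))))))"
  have "caloric ?h"
    by (intro caloric_add caloric_heat_prod) auto
  also have "?h = (\<lambda>t z. f z * g z + 2 * t * (k / 2 * f z) + t\<^sup>2)"
  proof (intro ext)
    fix t :: real and z :: "real \<times> real"
    define x where "x = fst z" define y where "y = snd z"
    \<comment> \<open>Coefficientwise this is \<open>- \<Delta>(f g) = k f\<close>, the part linear
      in \<open>t\<close>. The part quadratic in \<open>t\<close> is half of the iterated Laplacian,
      \<open>k * (P + Q) = 1\<close>.\<close>
    have h: "- 2 * e * (bx + cy) + 2 * a0 * (P + Q) = e * k" "12 * P * bx + 2 * P * cy + 2 * Q * bx = - P * k"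
      "12 * Q * cy + 2 * P * cy + 2 * Q * bx = - Q * k"
      using coefficients s(2) k(1) by algebra+
    have "?h t z = f z * g z + t * ((- 2 * e * (bx + cy) + 2 * a0 * (P + Q)) + x\<^sup>2 * (12 * P * bx + 2 * P * cy + 2 * Q * bx)
        + y\<^sup>2 * (12 * Q * cy + 2 * P * cy + 2 * Q * bx)) - t\<^sup>2 * ((12 * P * bx + 2 * P * cy + 2 * Q * bx) + (12 * Q * cy + 2 * P * cy + 2 * Q * bx))"
      unfolding heat_poly_simps f_def g_def x_def y_def by algebra
    also have "\<dots> = f z * g z + 2 * t * (k / 2 * f z) + t\<^sup>2"
      unfolding h f_def x_def[symmetric] y_def[symmetric] using k(1) by algebra
    finally show "?h t z = f z * g z + 2 * t * (k / 2 * f z) + t\<^sup>2" .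
  qed
  finally show ?thesis .
qed

lemma continuous_f [continuous_intros]: "continuous_on A f"
  unfolding f_def[abs_def] by (intro continuous_intros)

lemma continuous_g [continuous_intros]: "continuous_on A g"
  unfolding g_def[abs_def] by (intro continuous_intros)

lemma growth: "\<exists>A. \<forall>z. \<bar>k / 2 * f z\<bar> \<le> A * (1 + (norm z)\<^sup>2) \<and> \<bar>f z * g z\<bar> \<le> A * (1 + norm z ^ 4)"
proof -
  obtain F G where "\<forall>z. \<bar>f z\<bar> \<le> F * (1 + (norm z)\<^sup>2)" "\<forall>z. \<bar>g z\<bar> \<le> G * (1 + (norm z)\<^sup>2)"
    using growth_quadratic[of e 0 "- P" "- Q"] growth_quadratic[of a0 0 bx cy] by (auto simp: f_def g_def)
  then show ?thesis
    by (intro growth_product) auto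
qed

text \<open>After division by \<open>f z > 0\<close> both conditions are linear in the differences
  of \<open>x^2\<close> and \<open>y^2\<close>. The determinant \<open>P * cy - Q * bx\<close> is a
  nonzero multiple of \<open>s * P * Q * (P - Q)\<close>; for the ellipse this is where
  \<open>a \<noteq> b\<close> enters.\<close>

lemma level_set:
  assumes ne: "P \<noteq> 0" "Q \<noteq> 0" "P \<noteq> Q" and pos: "0 < f z"
    and eq: "k / 2 * f w = k / 2 * f z" "f w * g w = f z * g z"
  shows "(fst w)\<^sup>2 = (fst z)\<^sup>2 \<and> (snd w)\<^sup>2 = (snd z)\<^sup>2"
proof -
  have f: "f w = f z" using eq(1) k(2) by simp
  then have g: "g w = g z" using eq(2) pos by simp
  define X where "X = (fst w)\<^sup>2 - (fst z)\<^sup>2"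
  define Y where "Y = (snd w)\<^sup>2 - (snd z)\<^sup>2"
  have 1: "P * X + Q * Y = 0" using f by (simp add: f_def X_def Y_def algebra_simps)
  have 2: "bx * X + cy * Y = 0" using g by (simp add: g_def X_def Y_def algebra_simps)
  have "(P * cy - Q * bx) * (2 * (5 * P + Q) * (P + 5 * Q)) = - s * P * Q * (4 * (P - Q))"
    using coefficients by algebra
  then have d: "P * cy - Q * bx \<noteq> 0"
    using ne s(1) by auto
  have "(P * cy - Q * bx) * X = 0" "(P * cy - Q * bx) * Y = 0"
    using 1 2 by algebra+
  then show ?thesis
    using d by (simp add: X_def Y_def)
qed

end

subsection \<open>The five non-rectangular domains\<close>

lemma card_sign_pair: "card {x, - x :: real} \<in> {2, 1}"
proof (cases "x = 0")
  case False
  then have "x \<noteq> - x" by linarith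
  then show ?thesis by simp
qed simp

lemma squares_eq_iff: "(x' :: real)\<^sup>2 = x\<^sup>2 \<longleftrightarrow> x' \<in> {x, - x}"
  by (simp add: power2_eq_iff)

context even_conic
begin

lemma f_g_cong: "(fst w)\<^sup>2 = (fst z)\<^sup>2 \<Longrightarrow> (snd w)\<^sup>2 = (snd z)\<^sup>2 \<Longrightarrow> f w = f z \<and> g w = g z"
  by (simp add: f_def g_def)

lemma elliptic_exit:
  assumes e: "0 < e" and P: "0 < P" and Q: "0 < Q"
  shows "polynomial_exit {z. 0 < f z} (\<lambda>z. k / 2 * f z) (\<lambda>z. f z * g z)"
proof (rule polynomial_exit_compact[where E = "{z. 0 \<le> f z}"])
  show "open {z. 0 < f z}"
    by (intro open_Collect_less continuous_intros)
  have "f (sqrt (e / P), 0) = 0"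
    using e P by (simp add: f_def)
  then show "{z. 0 < f z} \<noteq> UNIV"
    by (metis UNIV_I less_irrefl mem_Collect_eq)
  show "compact {z. 0 \<le> f z}"
  proof (rule compact_eq_bounded_closed[THEN iffD2, OF conjI])
    show "closed {z. 0 \<le> f z}"
      by (intro closed_Collect_le continuous_intros)
    have "(norm z)\<^sup>2 \<le> e / P + e / Q" if "0 \<le> f z" for z
    proof -
      have "P * (fst z)\<^sup>2 + Q * (snd z)\<^sup>2 \<le> e" using that by (simp add: f_def)
      moreover have "0 \<le> P * (fst z)\<^sup>2" "0 \<le> Q * (snd z)\<^sup>2" using P Q by auto
      ultimately have "P * (fst z)\<^sup>2 \<le> e" "Q * (snd z)\<^sup>2 \<le> e" by linarith+
      then have "(fst z)\<^sup>2 \<le> e / P" "(snd z)\<^sup>2 \<le> e / Q"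
        using P Q by (simp_all add: pos_le_divide_eq mult.commute)
      then show ?thesis unfolding norm_prod_power2 by simp
    qed
    then have "norm z \<le> sqrt (e / P + e / Q)" if "0 \<le> f z" for z
      using that by (intro real_le_rsqrt) auto
    then show "bounded {z. 0 \<le> f z}"
      unfolding bounded_iff by blast
  qed
  show "caloric (\<lambda>t z. k / 2 * f z + t)" by (rule caloric_f)
  show "caloric (\<lambda>t z. f z * g z + 2 * t * (k / 2 * f z) + t\<^sup>2)" by (rule caloric_fg)
qed (auto intro!: continuous_intros)

text \<open>The two signs are independent, and each choice collapses when the coordinate is
  0.\<close>

lemma elliptic_card:
  assumes e: "0 < e" and P: "0 < P" and Q: "0 < Q" "P \<noteq> Q" and p: "0 < f p"
  shows "card {q \<in> {z. 0 < f z}. k / 2 * f q = k / 2 * f p \<and> f q * g q = f p * g p} \<in> {4, 2, 1}"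
proof -
  have "{q \<in> {z. 0 < f z}. k / 2 * f q = k / 2 * f p \<and> f q * g q = f p * g p} =
      {fst p, - fst p} \<times> {snd p, - snd p}" (is "?L = ?R")
  proof (rule set_eqI)
    fix q
    have "q \<in> ?R \<longleftrightarrow> (fst q)\<^sup>2 = (fst p)\<^sup>2 \<and> (snd q)\<^sup>2 = (snd p)\<^sup>2"
      by (auto simp: squares_eq_iff prod_eq_iff)
    also have "\<dots> \<longleftrightarrow> q \<in> ?L"
      using level_set[of p q] f_g_cong[of q p] P Q p by auto
    finally show "q \<in> ?L \<longleftrightarrow> q \<in> ?R" by simp
  qed
  moreover have "m * n \<in> {4, 2, 1}" if "m \<in> {2, 1}" "n \<in> {2, 1}" for m n :: nat
    using that by auto
  ultimately show ?thesis
    using card_sign_pair by (simp only: card_cartesian_product)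
qed

text \<open>On \<open>E\<close> one has \<open>Y \<le> w X\<close> for \<open>X = x^2\<close>,
  \<open>Y = y^2\<close>, \<open>w = - P / Q < 1\<close>. There \<open>quartic\<close> is
  \<open>X^2 - 6 X Y + Y^2\<close>, which decreases in \<open>Y\<close>, so it is at least
  \<open>(1 - 6 w + w^2) X^2\<close>; the discriminant-like hypothesis makes this factor positive,
  that is, it keeps the asymptotic half-angle below \<open>pi / 8\<close>. Since
  \<open>X + Y \<le> 2 X\<close>, a quarter of the factor serves as \<open>\<kappa>\<close>.\<close>

lemma half_plane_exit:
  assumes e: "e \<le> 0" and P: "P < 0" and Q: "0 < Q" "0 < P\<^sup>2 + 6 * P * Q + Q\<^sup>2"
  shows "polynomial_exit {z. 0 < f z \<and> 0 < fst z} (\<lambda>z. k / 2 * f z) (\<lambda>z. f z * g z)"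
  unfolding polynomial_exit_def
proof (intro conjI exI[of _ "{z. 0 \<le> f z \<and> 0 \<le> fst z}"])
  show "open {z. 0 < f z \<and> 0 < fst z}"
    by (intro open_Collect_conj open_Collect_less continuous_intros)
  show "{z. 0 < f z \<and> 0 < fst z} \<noteq> UNIV"
    by (metis (mono_tags, lifting) UNIV_I fst_conv less_irrefl mem_Collect_eq)
  show "closed {z. 0 \<le> f z \<and> 0 \<le> fst z}"
    by (intro closed_Collect_conj closed_Collect_le continuous_intros)
  show "\<forall>z\<in>{z. 0 \<le> f z \<and> 0 \<le> fst z} - {z. 0 < f z \<and> 0 < fst z}. k / 2 * f z = 0 \<and> f z * g z = 0"
  proof
    fix z assume z: "z \<in> {z. 0 \<le> f z \<and> 0 \<le> fst z} - {z. 0 < f z \<and> 0 < fst z}"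
    \<comment> \<open>The part of \<open>E\<close> on the line \<open>x = 0\<close> has to lie in
      the zero set of \<open>f\<close>; this uses \<open>e \<le> 0\<close>.\<close>
    have "f z \<le> 0" if "fst z = 0"
      using order_trans[OF e mult_nonneg_nonneg[OF less_imp_le[OF Q(1)] zero_le_power2[of "snd z"]]] that
      by (simp add: f_def)
    then have "f z = 0" using z by force
    then show "k / 2 * f z = 0 \<and> f z * g z = 0" by simp
  qed
  show "\<exists>A. \<forall>z\<in>{z. 0 \<le> f z \<and> 0 \<le> fst z}. \<bar>k / 2 * f z\<bar> \<le> A * (1 + (norm z)\<^sup>2) \<and> \<bar>f z * g z\<bar> \<le> A * (1 + norm z ^ 4)"
    using growth by blast
  define w where "w = - P / Q"
  have w: "0 < w" "w < 1" "0 < 1 - 6 * w + w\<^sup>2"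
  proof -
    show "0 < w" "w < 1" using P Q(1) PQ(1) by (auto simp: w_def divide_simps)
    have "1 - 6 * w + w\<^sup>2 = (P\<^sup>2 + 6 * P * Q + Q\<^sup>2) / Q\<^sup>2"
      using Q(1) by (simp add: w_def field_simps power2_eq_square)
    then show "0 < 1 - 6 * w + w\<^sup>2" using Q by simp
  qed
  show "\<exists>\<kappa>>0. \<exists>C. \<forall>z\<in>{z. 0 \<le> f z \<and> 0 \<le> fst z}. \<kappa> * norm z ^ 4 \<le> quartic z + C"
  proof -
    have "(1 - 6 * w + w\<^sup>2) / 4 * norm z ^ 4 \<le> quartic z + 0" if "z \<in> {z. 0 \<le> f z \<and> 0 \<le> fst z}" for z
    proof -
    have z: "Q * (snd z)\<^sup>2 \<le> - P * (fst z)\<^sup>2" using e that by (simp add: f_def)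
    define X where "X = (fst z)\<^sup>2" define Y where "Y = (snd z)\<^sup>2"
    have XY: "0 \<le> X" "0 \<le> Y" by (auto simp: X_def Y_def)
    have Yw: "Y \<le> w * X"
      using z Q(1) unfolding X_def Y_def w_def by (simp add: field_simps)
    have YX: "Y \<le> X"
      using Yw w XY mult_right_mono[of w 1 X] by linarith
    have "w * X \<le> 1 * X" using w XY by (intro mult_right_mono) auto
    \<comment> \<open>This product is the difference between \<open>X^2 - 6 X Y + Y^2\<close> and
      its value at \<open>Y = w X\<close>.\<close>
    then have "0 \<le> (w * X - Y) * (6 * X - w * X - Y)"
      using Yw YX XY by (intro mult_nonneg_nonneg) linarith+
    then have 1: "(1 - 6 * w + w\<^sup>2) * X\<^sup>2 \<le> X\<^sup>2 - 6 * X * Y + Y\<^sup>2"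
      by (simp add: power2_eq_square algebra_simps)
    have "(X + Y)\<^sup>2 \<le> (2 * X)\<^sup>2"
      using YX XY by (intro power_mono) auto
    then have "(1 - 6 * w + w\<^sup>2) / 4 * (X + Y)\<^sup>2 \<le> (1 - 6 * w + w\<^sup>2) / 4 * (2 * X)\<^sup>2"
      using w by (intro mult_left_mono) auto
    also have "\<dots> = (1 - 6 * w + w\<^sup>2) * X\<^sup>2"
      by (simp add: power_mult_distrib)
    also have "\<dots> \<le> X\<^sup>2 - 6 * X * Y + Y\<^sup>2" by (rule 1)
    finally show ?thesis
      unfolding norm_prod_power4 quartic_def X_def Y_def by simp
    qed
    moreover have "0 < (1 - 6 * w + w\<^sup>2) / 4" using w by simp
    ultimately show ?thesis by blast
  qed
  show "{z. 0 < f z \<and> 0 < fst z} \<subseteq> {z. 0 \<le> f z \<and> 0 \<le> fst z}" by auto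
qed (rule caloric_f caloric_fg)+

lemma half_plane_card:
  assumes P: "P < 0" and Q: "0 < Q" and p: "0 < f p" "0 < fst p"
  shows "card {q \<in> {z. 0 < f z \<and> 0 < fst z}. k / 2 * f q = k / 2 * f p \<and> f q * g q = f p * g p} \<in> {2, 1}"
proof -
  have "{q \<in> {z. 0 < f z \<and> 0 < fst z}. k / 2 * f q = k / 2 * f p \<and> f q * g q = f p * g p} =
      {fst p} \<times> {snd p, - snd p}" (is "?L = ?R")
  proof (rule set_eqI)
    fix q
    have "q \<in> ?R \<longleftrightarrow> (fst q)\<^sup>2 = (fst p)\<^sup>2 \<and> 0 < fst q \<and> (snd q)\<^sup>2 = (snd p)\<^sup>2"
      using p by (auto simp: squares_eq_iff prod_eq_iff)
    also have "\<dots> \<longleftrightarrow> q \<in> ?L"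
      using level_set[of p q] f_g_cong[of q p] P Q p by auto
    finally show "q \<in> ?L \<longleftrightarrow> q \<in> ?R" by simp
  qed
  then show ?thesis
    using card_sign_pair[of "snd p"] by (simp only: card_cartesian_product) simp
qed

end

section \<open>Ellipse, hyperbola and wedge\<close>

text \<open>Everything follows from the positivity of \<open>P^2 + 6 P Q + Q^2\<close>: adding
  \<open>4 P^2\<close> to it gives \<open>(P + Q) * (5 P + Q)\<close>, and clearing denominators in
  the nondegeneracy condition gives six times it.\<close>

lemma even_conic_half_plane:
  fixes P Q :: real
  assumes "P < 0" "0 < P + Q" "0 < P\<^sup>2 + 6 * P * Q + Q\<^sup>2"
  shows "even_conic P Q"
proof
  show "0 < P + Q" by fact
  have 1: "0 < 5 * P + Q"
  proof (rule ccontr)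
    assume "\<not> 0 < 5 * P + Q"
    then have "(P + Q) * (5 * P + Q) \<le> 0"
      using assms by (intro mult_nonneg_nonpos) auto
    moreover have "(P + Q) * (5 * P + Q) = P\<^sup>2 + 6 * P * Q + Q\<^sup>2 + 4 * P\<^sup>2"
      by algebra
    ultimately show False
      using assms(3) zero_le_power2[of P] by linarith
  qed
  then show "5 * P + Q \<noteq> 0" by simp
  have 2: "0 < P + 5 * Q" using assms by linarith
  then show "P + 5 * Q \<noteq> 0" by simp
  have "(1 + P / A + Q / C) * (A * C) = A * C + P * C + Q * A" if "A \<noteq> 0" "C \<noteq> 0" for A C
    using that by (simp add: field_simps)
  from this[of "5 * P + Q" "P + 5 * Q"] 1 2
  have "(1 + P / (5 * P + Q) + Q / (P + 5 * Q)) * ((5 * P + Q) * (P + 5 * Q)) = 6 * (P\<^sup>2 + 6 * P * Q + Q\<^sup>2)"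
    by (simp add: power2_eq_square algebra_simps)
  then show "1 + P / (5 * P + Q) + Q / (P + 5 * Q) \<noteq> 0"
    using assms(3) by auto
qed

lemma elliptic_levels:
  assumes "0 < a" "0 < b" "a \<noteq> b"
  shows "\<exists>u1 u2. polynomial_exit (elliptic_domain a b) u1 u2 \<and>
    (\<forall>p\<in>elliptic_domain a b. card {q \<in> elliptic_domain a b. u1 q = u1 p \<and> u2 q = u2 p} \<in> {4, 2, 1})"
proof -
  define P where "P = 1 / a\<^sup>2" define Q where "Q = 1 / b\<^sup>2"
  have pos: "0 < P" "0 < Q" using assms by (auto simp: P_def Q_def)
  have ne: "P \<noteq> Q" using assms by (simp add: P_def Q_def power2_eq_iff)
  interpret even_conic 1 P Q
  proof
    have "0 < P / (5 * P + Q)" "0 < Q / (P + 5 * Q)" using pos by auto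
    then show "1 + P / (5 * P + Q) + Q / (P + 5 * Q) \<noteq> 0" by linarith
  qed (use pos in auto)
  have D: "elliptic_domain a b = {z. 0 < f z}"
  proof -
    have "f z = 1 - (fst z / a)\<^sup>2 - (snd z / b)\<^sup>2" for z
      unfolding f_def by (simp add: P_def Q_def power_divide)
    then show ?thesis by (auto simp: elliptic_domain_def)
  qed
  show ?thesis
    unfolding D
  proof (intro exI conjI ballI)
    show "polynomial_exit {z. 0 < f z} (\<lambda>z. k / 2 * f z) (\<lambda>z. f z * g z)"
      using pos by (intro elliptic_exit) auto
    show "card {q \<in> {z. 0 < f z}. k / 2 * f q = k / 2 * f p \<and> f q * g q = f p * g p} \<in> {4, 2, 1}"
      if "p \<in> {z. 0 < f z}" for p
      using pos ne that by (intro elliptic_card) auto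
  qed
qed

lemma hyperbolic_levels:
  assumes "0 < a" "0 < b" "a > (1 + sqrt 2) * b"
  shows "\<exists>u1 u2. polynomial_exit (hyperbolic_domain a b) u1 u2 \<and>
    (\<forall>p\<in>hyperbolic_domain a b. card {q \<in> hyperbolic_domain a b. u1 q = u1 p \<and> u2 q = u2 p} \<in> {2, 1})"
proof -
  \<comment> \<open>The condition on \<open>a\<close> and \<open>b\<close> becomes
    \<open>2 a b < a^2 - b^2\<close>; squared, it is the positivity of
    \<open>P^2 + 6 P Q + Q^2\<close> for \<open>P = - b^2\<close>, \<open>Q = a^2\<close>.\<close>
  have "sqrt 2 * b < a - b" using assms(3) by (simp add: algebra_simps)
  then have "(sqrt 2 * b)\<^sup>2 < (a - b)\<^sup>2"
    using assms by (intro power_strict_mono) auto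
  then have 1: "2 * a * b < a\<^sup>2 - b\<^sup>2"
    by (simp add: power_mult_distrib) (simp add: power2_eq_square algebra_simps)
  then have "(2 * a * b)\<^sup>2 < (a\<^sup>2 - b\<^sup>2)\<^sup>2"
    using assms by (intro power_strict_mono) auto
  then have 2: "0 < (- b\<^sup>2)\<^sup>2 + 6 * (- b\<^sup>2) * a\<^sup>2 + (a\<^sup>2)\<^sup>2"
    by (simp add: power2_eq_square algebra_simps)
  have 3: "0 < 2 * a * b" using assms by simp
  \<comment> \<open>The defining inequality multiplied by \<open>a^2 b^2\<close>.\<close>
  interpret even_conic "- (a\<^sup>2 * b\<^sup>2)" "- b\<^sup>2" "a\<^sup>2"
  proof (rule even_conic_half_plane)
    show "0 < - b\<^sup>2 + a\<^sup>2" using 1 3 by linarith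
  qed (use 2 assms in auto)
  have D: "hyperbolic_domain a b = {z. 0 < f z \<and> 0 < fst z}"
  proof (rule set_eqI, clarify)
    fix x y :: real
    have "1 < x\<^sup>2 / a\<^sup>2 - y\<^sup>2 / b\<^sup>2 \<longleftrightarrow> 0 < f (x, y)"
      using assms by (simp add: f_def field_simps)
    moreover have "a < x" if "0 < f (x, y)" "0 < x"
    proof -
      have "a\<^sup>2 * b\<^sup>2 + a\<^sup>2 * y\<^sup>2 < x\<^sup>2 * b\<^sup>2"
        using that(1) by (simp add: f_def algebra_simps)
      moreover have "0 \<le> a\<^sup>2 * y\<^sup>2" by simp
      ultimately have "a\<^sup>2 * b\<^sup>2 < x\<^sup>2 * b\<^sup>2" by linarith
      then have "a\<^sup>2 < x\<^sup>2" using assms by simp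
      then show "a < x" using that(2) by (intro power_less_imp_less_base[of a 2 x]) auto
    qed
    ultimately show "(x, y) \<in> hyperbolic_domain a b \<longleftrightarrow> (x, y) \<in> {z. 0 < f z \<and> 0 < fst z}"
      using assms by (auto simp: hyperbolic_domain_def)
  qed
  show ?thesis
    unfolding D
  proof (intro exI conjI ballI)
    show "polynomial_exit {z. 0 < f z \<and> 0 < fst z} (\<lambda>z. k / 2 * f z) (\<lambda>z. f z * g z)"
      using 2 assms by (intro half_plane_exit) auto
    show "card {q \<in> {z. 0 < f z \<and> 0 < fst z}. k / 2 * f q = k / 2 * f p \<and> f q * g q = f p * g p} \<in> {2, 1}"
      if "p \<in> {z. 0 < f z \<and> 0 < fst z}" for p
      using assms that by (intro half_plane_card) auto
  qed
qed

lemma wedge_levels: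
  assumes "0 < \<alpha>" "\<alpha> < pi / 4"
  shows "\<exists>u1 u2. polynomial_exit (wedge_domain \<alpha>) u1 u2 \<and>
    (\<forall>p\<in>wedge_domain \<alpha>. card {q \<in> wedge_domain \<alpha>. u1 q = u1 p \<and> u2 q = u2 p} \<in> {2, 1})"
proof -
  \<comment> \<open>The wedge is \<open>y^2 < m^2 x^2\<close>, \<open>x > 0\<close>. The bound on
    \<open>\<alpha>\<close> says \<open>tan \<alpha> < 1\<close>, which by the double angle formula
    is \<open>2 m < 1 - m^2\<close>, and the square of this is the required quadratic
    inequality.\<close>
  define m where "m = tan (\<alpha> / 2)"
  have m0: "0 < m"
    unfolding m_def using assms by (intro tan_gt_zero) auto
  have m1: "m < 1"
    unfolding m_def using assms tan_monotone[of "\<alpha> / 2" "pi / 4"] by (simp add: tan_45)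
  have "tan (2 * (\<alpha> / 2)) < 1"
    using assms tan_monotone[of \<alpha> "pi / 4"] by (simp add: tan_45)
  moreover have "tan (2 * (\<alpha> / 2)) = 2 * m / (1 - m\<^sup>2)"
    unfolding m_def using assms
    by (intro tan_double) (auto intro!: less_imp_neq[THEN not_sym] cos_gt_zero)
  moreover have "m\<^sup>2 < 1"
    using m0 m1 by (simp add: power_less_one_iff)
  ultimately have m2: "2 * m < 1 - m\<^sup>2"
    by (simp add: divide_less_eq)
  then have "(2 * m)\<^sup>2 < (1 - m\<^sup>2)\<^sup>2"
    using m0 by (intro power_strict_mono) auto
  then have 2: "0 < (- m\<^sup>2)\<^sup>2 + 6 * (- m\<^sup>2) * 1 + 1\<^sup>2"
    by (simp add: power2_eq_square algebra_simps)
  interpret even_conic 0 "- m\<^sup>2" 1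
    using m0 \<open>m\<^sup>2 < 1\<close> 2 by (intro even_conic_half_plane) auto
  have D: "wedge_domain \<alpha> = {z. 0 < f z \<and> 0 < fst z}"
  proof (rule set_eqI, safe)
    fix x y assume "(x, y) \<in> wedge_domain \<alpha>"
    then obtain r \<theta> where r: "x = r * cos \<theta>" "y = r * sin \<theta>" "0 < r" "- \<alpha> / 2 < \<theta>" "\<theta> < \<alpha> / 2"
      by (auto simp: wedge_domain_def)
    have c: "0 < cos \<theta>" using r assms by (intro cos_gt_zero_pi) auto
    then show "0 < fst (x, y)" using r by simp
    have "tan \<theta> < m" "tan (- \<theta>) < m"
      unfolding m_def using r assms by (intro tan_monotone; linarith)+
    then have "\<bar>tan \<theta>\<bar> < m" by simp
    then have "\<bar>tan \<theta>\<bar>\<^sup>2 < m\<^sup>2" by (intro power_strict_mono) auto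
    then have "(sin \<theta>)\<^sup>2 < m\<^sup>2 * (cos \<theta>)\<^sup>2"
      using c by (simp add: tan_def power_divide divide_less_eq)
    then have "r\<^sup>2 * (sin \<theta>)\<^sup>2 < r\<^sup>2 * (m\<^sup>2 * (cos \<theta>)\<^sup>2)"
      using r by (intro mult_strict_left_mono) auto
    then show "0 < f (x, y)" by (simp add: f_def r power_mult_distrib mult_ac)
  next
    fix x y :: real assume f: "0 < f (x, y)" and x: "0 < fst (x, y)"
    define \<theta> where "\<theta> = arctan (y / x)"
    define r where "r = sqrt (x\<^sup>2 + y\<^sup>2)"
    have x: "0 < x" using x by simp
    have "y\<^sup>2 < (m * x)\<^sup>2" using f by (simp add: f_def power_mult_distrib)
    then have "\<bar>y\<bar> < m * x"
      using x m0 by (metis abs_le_square_iff abs_of_pos linorder_not_less mult_pos_pos)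
    then have "\<bar>y / x\<bar> < m" using x by (simp add: divide_less_eq)
    then have "y / x < m" "- m < y / x" by linarith+
    then have "arctan (y / x) < arctan m" "arctan (- m) < arctan (y / x)"
      by (simp_all only: arctan_less_iff)
    moreover have "arctan m = \<alpha> / 2"
      unfolding m_def using assms by (intro arctan_tan) auto
    ultimately have \<theta>: "- \<alpha> / 2 < \<theta>" "\<theta> < \<alpha> / 2" by (auto simp: \<theta>_def arctan_minus)
    have r: "0 < r" unfolding r_def using x by (simp add: add_pos_nonneg)
    have sq: "sqrt (1 + (y / x)\<^sup>2) = r / x"
    proof -
      have "1 + (y / x)\<^sup>2 = (x\<^sup>2 + y\<^sup>2) / x\<^sup>2" using x by (simp add: field_simps)
      then show ?thesis using x by (simp add: real_sqrt_divide r_def)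
    qed
    have "x = r * cos \<theta>" "y = r * sin \<theta>"
      unfolding \<theta>_def cos_arctan sin_arctan sq using x r by auto
    then show "(x, y) \<in> wedge_domain \<alpha>"
      using r \<theta> by (auto simp: wedge_domain_def)
  qed
  show ?thesis
    unfolding D
  proof (intro exI conjI ballI)
    show "polynomial_exit {z. 0 < f z \<and> 0 < fst z} (\<lambda>z. k / 2 * f z) (\<lambda>z. f z * g z)"
      using 2 m0 by (intro half_plane_exit) auto
    show "card {q \<in> {z. 0 < f z \<and> 0 < fst z}. k / 2 * f q = k / 2 * f p \<and> f q * g q = f p * g p} \<in> {2, 1}"
      if "p \<in> {z. 0 < f z \<and> 0 < fst z}" for p
      using m0 that by (intro half_plane_card) auto
  qed
qed

section \<open>Parabola\<close>

lemma parabolic_levels: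
  assumes c: "0 < c"
  shows "\<exists>u1 u2. polynomial_exit (parabolic_domain c) u1 u2 \<and>
    (\<forall>p\<in>parabolic_domain c. card {q \<in> parabolic_domain c. u1 q = u1 p \<and> u2 q = u2 p} \<in> {2, 1})"
proof -
  \<comment> \<open>The relation \<open>c * d = 1\<close> in place of division keeps all identities
    below polynomial.\<close>
  define d where "d = 1 / c"
  have cd: "c * d = 1" and d: "0 < d" using c by (auto simp: d_def)
  define f where "f z = snd z - c * (fst z)\<^sup>2" for z :: "real \<times> real"
  \<comment> \<open>The coefficients solve \<open>\<Delta>(f g) = - d f\<close>, found by comparing
    coefficients of \<open>1\<close>, \<open>x^2\<close> and \<open>y\<close>.\<close>
  define g where "g z = 5 / 12 * d ^ 3 - d / 12 * (fst z)\<^sup>2 + 5 / 12 * d\<^sup>2 * snd z" for z :: "real \<times> real"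
  have D: "parabolic_domain c = {z. 0 < f z}"
    by (auto simp: parabolic_domain_def f_def)
  have cont: "continuous_on A f" for A
    unfolding f_def[abs_def] by (intro continuous_intros)
  have pe: "polynomial_exit {z. 0 < f z} (\<lambda>z. d / 2 * f z) (\<lambda>z. f z * g z)"
    unfolding polynomial_exit_def
  proof (intro conjI exI[of _ "{z. 0 \<le> f z}"])
    show "open {z. 0 < f z}"
      by (intro open_Collect_less continuous_intros cont)
    have "f (0, 0) = 0" by (simp add: f_def)
    then show "{z. 0 < f z} \<noteq> UNIV"
      by (metis UNIV_I less_irrefl mem_Collect_eq)
    show "closed {z. 0 \<le> f z}"
      by (intro closed_Collect_le continuous_intros cont)
    have "caloric (\<lambda>t z. (d / 2) * (heat_poly 0 t (fst z) * heat_poly 1 t (snd z)) +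
        (- (1 / 2)) * (heat_poly 2 t (fst z) * heat_poly 0 t (snd z)))"
      by (intro caloric_add caloric_heat_prod) auto
    moreover have "(d / 2) * (heat_poly 0 t (fst z) * heat_poly 1 t (snd z)) +
        (- (1 / 2)) * (heat_poly 2 t (fst z) * heat_poly 0 t (snd z)) = d / 2 * f z + t" for t :: real and z
      using cd unfolding heat_poly_simps f_def by algebra
    ultimately show "caloric (\<lambda>t z. d / 2 * f z + t)"
      by simp
    let ?h = "\<lambda>t z. (5 / 12 * d ^ 3) * (heat_poly 0 t (fst z) * heat_poly 1 t (snd z)) +
        ((- (1 / 2) * d) * (heat_poly 2 t (fst z) * heat_poly 1 t (snd z)) +
        ((5 / 12 * d\<^sup>2) * (heat_poly 0 t (fst z) * heat_poly 2 t (snd z)) +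
        ((- (5 / 12) * d\<^sup>2) * (heat_poly 2 t (fst z) * heat_poly 0 t (snd z)) +
         (1 / 12) * (heat_poly 4 t (fst z) * heat_poly 0 t (snd z)))))"
    have "caloric ?h"
      by (intro caloric_add caloric_heat_prod) auto
    moreover have "?h t z = f z * g z + 2 * t * (d / 2 * f z) + t\<^sup>2" for t :: real and z
      using cd unfolding heat_poly_simps f_def g_def by algebra
    ultimately show "caloric (\<lambda>t z. f z * g z + 2 * t * (d / 2 * f z) + t\<^sup>2)"
      by simp
    show "{z. 0 < f z} \<subseteq> {z. 0 \<le> f z}" by auto
    show "\<forall>z\<in>{z. 0 \<le> f z} - {z. 0 < f z}. d / 2 * f z = 0 \<and> f z * g z = 0"
      by auto
    obtain F G where "\<forall>z. \<bar>f z\<bar> \<le> F * (1 + (norm z)\<^sup>2)" "\<forall>z. \<bar>g z\<bar> \<le> G * (1 + (norm z)\<^sup>2)"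
      using growth_quadratic[of 0 1 "- c" 0] growth_quadratic[of "5 / 12 * d ^ 3" "5 / 12 * d\<^sup>2" "- d / 12" 0]
      by (auto simp: f_def g_def algebra_simps)
    then show "\<exists>A. \<forall>z\<in>{z. 0 \<le> f z}. \<bar>d / 2 * f z\<bar> \<le> A * (1 + (norm z)\<^sup>2) \<and> \<bar>f z * g z\<bar> \<le> A * (1 + norm z ^ 4)"
      using growth_product[of f F g G "d / 2"] by blast
    show "\<exists>\<kappa>>0. \<exists>C. \<forall>z\<in>{z. 0 \<le> f z}. \<kappa> * norm z ^ 4 \<le> quartic z + C"
    proof -
      \<comment> \<open>Inside the parabola \<open>x^2 \<le> d y\<close>, so the negative term
        \<open>6 x^2 y^2\<close> is at most \<open>6 d y^3\<close>. This is at most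
        \<open>y^4 / 2\<close> for \<open>y \<ge> 12 d\<close> and is bounded by the added constant
        otherwise.\<close>
      have "1 / 4 * norm z ^ 4 \<le> quartic z + 6 * d * (12 * d) ^ 3" if "z \<in> {z. 0 \<le> f z}" for z
      proof -
      have "c * (fst z)\<^sup>2 \<le> snd z" using that by (simp add: f_def)
      then have "d * (c * (fst z)\<^sup>2) \<le> d * snd z" using d by simp
      moreover have "d * (c * (fst z)\<^sup>2) = (fst z)\<^sup>2" using cd by algebra
      ultimately have X: "(fst z)\<^sup>2 \<le> d * snd z" by simp
      define X where "X = (fst z)\<^sup>2" define y where "y = snd z"
      have "0 \<le> d * y" using order_trans[OF zero_le_power2 X] by (simp add: y_def)
      then have y: "0 \<le> y" using d by (simp add: zero_le_mult_iff)
      have "6 * X * y\<^sup>2 \<le> 6 * (d * y) * y\<^sup>2"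
        using X by (intro mult_right_mono) (auto simp: X_def y_def)
      also have "\<dots> \<le> y ^ 4 / 2 + 6 * d * (12 * d) ^ 3"
      proof (cases "y \<le> 12 * d")
        case True
        have "6 * d * y ^ 3 \<le> 6 * d * (12 * d) ^ 3"
          using True y d by (intro mult_left_mono power_mono) auto
        moreover have "0 \<le> y ^ 4" by simp
        moreover have "6 * (d * y) * y\<^sup>2 = 6 * d * y ^ 3" by (simp add: eval_nat_numeral)
        ultimately show ?thesis by linarith
      next
        case False
        then have "12 * d * y ^ 3 \<le> y * y ^ 3" using y by (intro mult_right_mono) auto
        moreover have "6 * (d * y) * y\<^sup>2 = 6 * d * y ^ 3" "y * y ^ 3 = y ^ 4" by (simp_all add: eval_nat_numeral)
        moreover have "0 \<le> 6 * d * (12 * d) ^ 3" using d by simp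
        ultimately show ?thesis by linarith
      qed
      finally have 1: "6 * X * y\<^sup>2 \<le> y ^ 4 / 2 + 6 * d * (12 * d) ^ 3" .
      have "(X + y\<^sup>2)\<^sup>2 = 2 * X\<^sup>2 + 2 * y ^ 4 - (X - y\<^sup>2)\<^sup>2"
        by algebra
      then have "1 / 4 * (X + y\<^sup>2)\<^sup>2 \<le> X\<^sup>2 + y ^ 4 / 2"
        using zero_le_power2[of "X - y\<^sup>2"] zero_le_power2[of X] by linarith
      then have "1 / 4 * (X + y\<^sup>2)\<^sup>2 \<le> X\<^sup>2 - 6 * X * y\<^sup>2 + y ^ 4 + 6 * d * (12 * d) ^ 3"
        using 1 by linarith
      then show ?thesis
        unfolding norm_prod_power4 quartic_def X_def y_def by simp
      qed
      moreover have "0 < (1 / 4 :: real)" by simp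
      ultimately show ?thesis by blast
    qed
  qed
  have "card {q \<in> {z. 0 < f z}. d / 2 * f q = d / 2 * f p \<and> f q * g q = f p * g p} \<in> {2, 1}" if p: "0 < f p" for p
  proof -
    have "{q \<in> {z. 0 < f z}. d / 2 * f q = d / 2 * f p \<and> f q * g q = f p * g p} = {fst p, - fst p} \<times> {snd p}" (is "?L = ?R")
    proof (rule set_eqI)
      fix q
      have "q \<in> ?R \<longleftrightarrow> (fst q)\<^sup>2 = (fst p)\<^sup>2 \<and> snd q = snd p"
        by (auto simp: squares_eq_iff prod_eq_iff)
      also have "\<dots> \<longleftrightarrow> q \<in> ?L"
      proof
        assume "(fst q)\<^sup>2 = (fst p)\<^sup>2 \<and> snd q = snd p"
        then have "f q = f p" "g q = g p" by (auto simp: f_def g_def)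
        then show "q \<in> ?L" using p by simp
      next
        assume q: "q \<in> ?L"
        then have f: "f q = f p" using d by simp
        then have g: "g q = g p" using q p by simp
        \<comment> \<open>The combination \<open>g - 5 / 12 * d^2 * f\<close> eliminates
          \<open>y\<close>.\<close>
        have "d * ((fst q)\<^sup>2 - (fst p)\<^sup>2) = 3 * ((g q - g p) - 5 / 12 * d\<^sup>2 * (f q - f p))"
          using cd unfolding f_def g_def by algebra
        then have "(fst q)\<^sup>2 = (fst p)\<^sup>2" using d f g by simp
        moreover from this have "snd q = snd p" using f by (simp add: f_def)
        ultimately show "(fst q)\<^sup>2 = (fst p)\<^sup>2 \<and> snd q = snd p" by simp
      qed
      finally show "q \<in> ?L \<longleftrightarrow> q \<in> ?R" by simp
    qed
    then show ?thesis
      using card_sign_pair[of "fst p"] by (simp only: card_cartesian_product) simp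
  qed
  then show ?thesis
    unfolding D using pe by (intro exI[of _ "\<lambda>z. d / 2 * f z"] exI[of _ "\<lambda>z. f z * g z"] conjI ballI) blast+
qed

section \<open>Equilateral triangle\<close>

text \<open>The three quantities fix all elementary symmetric functions, so \<open>x1\<close> is a
  root of the cubic with roots \<open>a1\<close>, \<open>a2\<close>, \<open>a3\<close>; the other
  two values are then fixed by their sum and their sum of squares.\<close>

lemma permutation_of_symmetric:
  fixes x1 x2 x3 a1 a2 a3 :: real
  assumes "x1 + x2 + x3 = a1 + a2 + a3" "x1\<^sup>2 + x2\<^sup>2 + x3\<^sup>2 = a1\<^sup>2 + a2\<^sup>2 + a3\<^sup>2" "x1 * x2 * x3 = a1 * a2 * a3"
  shows "(x1, x2, x3) \<in> {(a1, a2, a3), (a1, a3, a2), (a2, a1, a3), (a2, a3, a1), (a3, a1, a2), (a3, a2, a1)}"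
proof -
  have two: "(y = b \<and> z = c) \<or> (y = c \<and> z = b)" if "y + z = b + c" "y\<^sup>2 + z\<^sup>2 = b\<^sup>2 + c\<^sup>2" for y z b c :: real
  proof -
    have "(y - b) * (y - c) = 0" using that by algebra
    then show ?thesis using that(1) by auto
  qed
  have "(x1 - a1) * (x1 - a2) * (x1 - a3) = 0" using assms by algebra
  then consider "x1 = a1" | "x1 = a2" | "x1 = a3" by auto
  then show ?thesis
  proof cases
    case 1
    then show ?thesis using two[of x2 x3 a2 a3] assms(1,2) by auto
  next
    case 2
    then show ?thesis using two[of x2 x3 a1 a3] assms(1,2) by auto
  next
    case 3
    then show ?thesis using two[of x2 x3 a1 a2] assms(1,2) by auto
  qed
qed

lemma card_permutations3:
  "card {(a1, a2, a3), (a1, a3, a2), (a2, a1, a3), (a2, a3, a1), (a3, a1, a2), (a3, a2, a1 :: real)} \<in> {6, 3, 1}"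
  by (cases "a1 = a2"; cases "a1 = a3"; cases "a2 = a3") (auto simp: card_insert_if)

lemma triangular_levels:
  assumes b: "0 < b"
  shows "\<exists>u1 u2. polynomial_exit (triangular_domain b) u1 u2 \<and>
    (\<forall>p\<in>triangular_domain b. card {q \<in> triangular_domain b. u1 q = u1 p \<and> u2 q = u2 p} \<in> {6, 3, 1})"
proof -
  define d where "d = 1 / b"
  have bd: "b * d = 1" and d: "0 < d" using b by (auto simp: d_def)
  \<comment> \<open>An opaque name for \<open>sqrt 3\<close>, so that polynomial identities use it
    through \<open>r * r = 3\<close>.\<close>
  define r where "r = sqrt (3 :: real)"
  have r: "r * r = 3" by (simp add: r_def)
  have s3: "sqrt 3 * sqrt 3 = (3 :: real)" "0 < sqrt (3 :: real)" by auto
  \<comment> \<open>\<open>snd z\<close>, \<open>l2 z\<close> and \<open>l3 z\<close> are the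
    distances to the three sides, and they add up to the height \<open>b\<close>.\<close>
  define l2 where "l2 z = (b - sqrt 3 * fst z - snd z) / 2" for z :: "real \<times> real"
  define l3 where "l3 z = (b + sqrt 3 * fst z - snd z) / 2" for z :: "real \<times> real"
  define f where "f z = snd z * l2 z * l3 z" for z
  \<comment> \<open>This is \<open>d / 6\<close> times the second elementary symmetric function of
    the three distances, written in coordinates; \<open>f\<close> is the third.\<close>
  define g where "g z = b / 24 + snd z / 12 - d / 8 * ((fst z)\<^sup>2 + (snd z)\<^sup>2)" for z :: "real \<times> real"
  have f: "f z = (b\<^sup>2 * snd z - 2 * b * (snd z)\<^sup>2 + snd z ^ 3 - 3 * (fst z)\<^sup>2 * snd z) / 4" for z
  proof -
    have "f z = (snd z * ((b - snd z)\<^sup>2 - (r * r) * (fst z)\<^sup>2)) / 4"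
    proof -
      have "(b - r * fst z - snd z) * (b + r * fst z - snd z) = (b - snd z)\<^sup>2 - (r * r) * (fst z)\<^sup>2"
        by algebra
      moreover have "y * (u / 2) * (v / 2) = y * (u * v) / 4" for y u v :: real
        by simp
      ultimately show ?thesis
        unfolding f_def l2_def l3_def r_def[symmetric] by simp
    qed
    then show ?thesis
      unfolding r by (simp add: power2_eq_square power3_eq_cube algebra_simps)
  qed
  have D: "triangular_domain b = {z. 0 < snd z \<and> 0 < l2 z \<and> 0 < l3 z}"
  proof (rule set_eqI, clarify)
    fix x y :: real
    have "\<bar>x\<bar> < b / sqrt 3 \<longleftrightarrow> sqrt 3 * \<bar>x\<bar> < b" using s3 by (simp add: pos_less_divide_eq mult.commute)
    moreover have "\<bar>x\<bar> < b / sqrt 3 \<longleftrightarrow> - b / sqrt 3 < x \<and> x < b / sqrt 3" by (auto simp: abs_less_iff)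
    moreover have "0 < l2 (x, y) \<and> 0 < l3 (x, y) \<longleftrightarrow> y < b - sqrt 3 * \<bar>x\<bar>"
    proof -
      define w where "w = sqrt 3 * x"
      have "sqrt 3 * \<bar>x\<bar> = \<bar>w\<bar>" by (simp add: w_def abs_mult)
      moreover have "0 < l2 (x, y) \<longleftrightarrow> y + w < b" "0 < l3 (x, y) \<longleftrightarrow> y - w < b"
        by (auto simp: l2_def l3_def w_def)
      ultimately show ?thesis by (simp only:) linarith
    qed
    ultimately show "(x, y) \<in> triangular_domain b \<longleftrightarrow> (x, y) \<in> {z. 0 < snd z \<and> 0 < l2 z \<and> 0 < l3 z}"
      by (auto simp: triangular_domain_def)
  qed
  have cont: "continuous_on A l2" "continuous_on A l3" "continuous_on A f" "continuous_on A g" for A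
    unfolding f_def[abs_def] g_def[abs_def] l2_def[abs_def] l3_def[abs_def] by (auto intro!: continuous_intros)
  have pe: "polynomial_exit {z. 0 < snd z \<and> 0 < l2 z \<and> 0 < l3 z} (\<lambda>z. d * f z) (\<lambda>z. f z * g z)"
  proof (rule polynomial_exit_compact[where E = "{z. 0 \<le> snd z \<and> 0 \<le> l2 z \<and> 0 \<le> l3 z}"])
    show "open {z. 0 < snd z \<and> 0 < l2 z \<and> 0 < l3 z}"
      by (intro open_Collect_conj open_Collect_less continuous_intros cont)
    show "{z. 0 < snd z \<and> 0 < l2 z \<and> 0 < l3 z} \<noteq> UNIV"
      by (metis (mono_tags, lifting) UNIV_I snd_conv less_irrefl mem_Collect_eq)
    show "compact {z. 0 \<le> snd z \<and> 0 \<le> l2 z \<and> 0 \<le> l3 z}"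
    proof (rule compact_eq_bounded_closed[THEN iffD2, OF conjI])
      show "closed {z. 0 \<le> snd z \<and> 0 \<le> l2 z \<and> 0 \<le> l3 z}"
        by (intro closed_Collect_conj closed_Collect_le continuous_intros cont)
      have "norm z \<le> b / sqrt 3 + b" if "0 \<le> snd z" "0 \<le> l2 z" "0 \<le> l3 z" for z
      proof -
        have "sqrt 3 * fst z \<le> b" "- (sqrt 3 * fst z) \<le> b" "snd z \<le> b"
          using that by (auto simp: l2_def l3_def)
        then have "\<bar>fst z\<bar> \<le> b / sqrt 3"
          using s3 by (auto simp: abs_le_iff pos_le_divide_eq minus_le_iff mult.commute)
        then show ?thesis
          using norm_Pair_le[of "fst z" "snd z"] that \<open>snd z \<le> b\<close> by simp
      qed
      then show "bounded {z. 0 \<le> snd z \<and> 0 \<le> l2 z \<and> 0 \<le> l3 z}"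
        unfolding bounded_iff by blast
    qed
    have "caloric (\<lambda>t z. (b / 4) * (heat_poly 0 t (fst z) * heat_poly 1 t (snd z)) +
        ((- (1 / 2)) * (heat_poly 0 t (fst z) * heat_poly 2 t (snd z)) +
        ((d / 4) * (heat_poly 0 t (fst z) * heat_poly 3 t (snd z)) +
         (- (3 / 4) * d) * (heat_poly 2 t (fst z) * heat_poly 1 t (snd z)))))"
      by (intro caloric_add caloric_heat_prod) auto
    moreover have "(b / 4) * (heat_poly 0 t (fst z) * heat_poly 1 t (snd z)) +
        ((- (1 / 2)) * (heat_poly 0 t (fst z) * heat_poly 2 t (snd z)) +
        ((d / 4) * (heat_poly 0 t (fst z) * heat_poly 3 t (snd z)) +
         (- (3 / 4) * d) * (heat_poly 2 t (fst z) * heat_poly 1 t (snd z)))) = d * f z + t" for t :: real and z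
      using bd unfolding heat_poly_simps f by algebra
    ultimately show "caloric (\<lambda>t z. d * f z + t)"
      by simp
    \<comment> \<open>\<open>F\<close> and \<open>G\<close> are \<open>f\<close> and
      \<open>g\<close> with the denominators 4 and 24 cleared, whence the factor
      \<open>1 / 96\<close> in front of \<open>?h\<close>.\<close>
    define F where "F x y = b\<^sup>2 * y - 2 * b * y\<^sup>2 + y ^ 3 - 3 * x\<^sup>2 * y" for x y :: real
    define G where "G x y = b + 2 * y - 3 * d * (x\<^sup>2 + y\<^sup>2)" for x y :: real
    have FG: "f z = F (fst z) (snd z) / 4" "g z = G (fst z) (snd z) / 24" for z
      unfolding f F_def G_def g_def by (simp_all add: field_simps)
    let ?h = "\<lambda>t z. b ^ 3 * (heat_poly 0 t (fst z) * heat_poly 1 t (snd z)) +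
        ((- 6 * b) * (heat_poly 0 t (fst z) * heat_poly 3 t (snd z)) +
        (8 * (heat_poly 0 t (fst z) * heat_poly 4 t (snd z)) +
        ((- 3 * d) * (heat_poly 0 t (fst z) * heat_poly 5 t (snd z)) +
        ((- 6 * b) * (heat_poly 2 t (fst z) * heat_poly 1 t (snd z)) +
        ((6 * d) * (heat_poly 2 t (fst z) * heat_poly 3 t (snd z)) +
         (9 * d) * (heat_poly 4 t (fst z) * heat_poly 1 t (snd z)))))))"
    have "caloric (\<lambda>t z. 1 / 96 * ?h t z)"
      by (intro caloric_scale caloric_add caloric_heat_prod) auto
    moreover have "1 / 96 * ?h t z = f z * g z + 2 * t * (d * f z) + t\<^sup>2" for t :: real and z
    proof -
      have bd': "b * (d * w) = w" for w
        using bd by (simp add: mult.assoc[symmetric])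
      have "b ^ 3 * y + ((- 6 * b) * (y ^ 3 - 6 * t * y) + (8 * (y ^ 4 - 12 * t * y\<^sup>2 + 12 * t\<^sup>2) +
          ((- 3 * d) * (y ^ 5 - 20 * t * y ^ 3 + 60 * t\<^sup>2 * y) + ((- 6 * b) * ((x\<^sup>2 - 2 * t) * y) +
          ((6 * d) * ((x\<^sup>2 - 2 * t) * (y ^ 3 - 6 * t * y)) + (9 * d) * ((x ^ 4 - 12 * t * x\<^sup>2 + 12 * t\<^sup>2) * y)))))) =
          F x y * G x y + 48 * t * d * F x y + 96 * t\<^sup>2" for x y
        unfolding F_def G_def by (simp add: eval_nat_numeral algebra_simps bd bd')
      from this[of "snd z" "fst z"] have "?h t z = F (fst z) (snd z) * G (fst z) (snd z) + 48 * t * d * F (fst z) (snd z) + 96 * t\<^sup>2"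
        unfolding heat_poly_simps by (simp only: mult_1)
      then show ?thesis
        unfolding FG by simp
    qed
    ultimately show "caloric (\<lambda>t z. f z * g z + 2 * t * (d * f z) + t\<^sup>2)"
      by (simp only:)
  qed (auto intro!: continuous_intros cont simp: f_def)
  have "card {q \<in> {z. 0 < snd z \<and> 0 < l2 z \<and> 0 < l3 z}. d * f q = d * f p \<and> f q * g q = f p * g p} \<in> {6, 3, 1}"
    if p: "0 < snd p" "0 < l2 p" "0 < l3 p" for p
  proof -
    define L where "L z = (snd z, l2 z, l3 z)" for z
    define S where "S = (let a1 = snd p; a2 = l2 p; a3 = l3 p in
      {(a1, a2, a3), (a1, a3, a2), (a2, a1, a3), (a2, a3, a1), (a3, a1, a2), (a3, a2, a1)})"
    \<comment> \<open>The inverse of \<open>L\<close> on the plane where the three distances sum to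
      \<open>b\<close>. The level set is the image of the set \<open>S\<close> of permutations, and
      every permutation of three positive distances belongs to a point of the triangle.\<close>
    define \<psi> where "\<psi> = (\<lambda>(m1, m2, m3). ((m3 - m2) / sqrt 3, m1 :: real))"
    have sum: "snd z + l2 z + l3 z = b" for z by (simp add: l2_def l3_def field_simps)
    have squares: "g z = d / 12 * (b\<^sup>2 - ((snd z)\<^sup>2 + (l2 z)\<^sup>2 + (l3 z)\<^sup>2))" for z
    proof -
      have "(b - r * fst z - snd z)\<^sup>2 + (b + r * fst z - snd z)\<^sup>2 = 2 * (b - snd z)\<^sup>2 + 2 * (r * r) * (fst z)\<^sup>2"
        by algebra
      then have "(l2 z)\<^sup>2 + (l3 z)\<^sup>2 = (b - snd z)\<^sup>2 / 2 + 3 / 2 * (fst z)\<^sup>2"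
        unfolding l2_def l3_def r_def[symmetric] r by (simp add: power_divide)
      then have S: "(snd z)\<^sup>2 + (l2 z)\<^sup>2 + (l3 z)\<^sup>2 = (b\<^sup>2 + 3 * (snd z)\<^sup>2 + 3 * (fst z)\<^sup>2 - 2 * b * snd z) / 2"
        by (simp add: power2_diff field_simps)
      have db: "d * b\<^sup>2 = b" "d * b = 1"
        using bd by (simp_all add: power2_eq_square mult.assoc[symmetric] mult.commute)
      have "d / 12 * (b\<^sup>2 - ((snd z)\<^sup>2 + (l2 z)\<^sup>2 + (l3 z)\<^sup>2)) =
          (d * b\<^sup>2 + 2 * (d * b) * snd z - 3 * d * ((fst z)\<^sup>2 + (snd z)\<^sup>2)) / 24"
        unfolding S by (simp add: field_simps)
      also have "\<dots> = g z"
        unfolding db g_def by (simp add: field_simps)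
      finally show ?thesis by simp
    qed
    have \<psi>L: "\<psi> (L z) = z" for z
      using s3 by (cases z) (simp add: \<psi>_def L_def l2_def l3_def field_simps)
    have L\<psi>: "L (\<psi> (m1, m2, m3)) = (m1, m2, m3)" if "m1 + m2 + m3 = b" for m1 m2 m3
      using s3 that by (auto simp: \<psi>_def L_def l2_def l3_def)
    have S_sum: "m1 + m2 + m3 = b" if "(m1, m2, m3) \<in> S" for m1 m2 m3
      using that sum[of p] unfolding S_def Let_def by auto
    have fp: "0 < f p" using p by (simp add: f_def)
    have "{q \<in> {z. 0 < snd z \<and> 0 < l2 z \<and> 0 < l3 z}. d * f q = d * f p \<and> f q * g q = f p * g p} = \<psi> ` S" (is "?L = _")
    proof (rule set_eqI, rule iffI)
      fix q assume q: "q \<in> ?L"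
      then have "f q = f p" using d by simp
      then have "g q = g p" using q fp by simp
      then have "(snd q)\<^sup>2 + (l2 q)\<^sup>2 + (l3 q)\<^sup>2 = (snd p)\<^sup>2 + (l2 p)\<^sup>2 + (l3 p)\<^sup>2"
        unfolding squares using d by simp
      then have "L q \<in> S"
        unfolding L_def S_def Let_def using sum[of q] sum[of p] \<open>f q = f p\<close>
        by (intro permutation_of_symmetric) (auto simp: f_def)
      then show "q \<in> \<psi> ` S" using \<psi>L[of q] by (metis imageI)
    next
      fix q assume "q \<in> \<psi> ` S"
      then obtain m1 m2 m3 where m: "(m1, m2, m3) \<in> S" "q = \<psi> (m1, m2, m3)" by auto
      then have "L q \<in> S" using L\<psi>[OF S_sum] by simp
      then have "0 < snd q \<and> 0 < l2 q \<and> 0 < l3 q \<and> f q = f p \<and>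
          (snd q)\<^sup>2 + (l2 q)\<^sup>2 + (l3 q)\<^sup>2 = (snd p)\<^sup>2 + (l2 p)\<^sup>2 + (l3 p)\<^sup>2"
        unfolding L_def S_def Let_def f_def using p by auto
      then show "q \<in> ?L" unfolding squares by simp
    qed
    moreover have "inj_on \<psi> S"
    proof (rule inj_onI)
      fix m m' assume "m \<in> S" "m' \<in> S" "\<psi> m = \<psi> m'"
      then show "m = m'" using L\<psi>[OF S_sum] by (cases m; cases m') metis
    qed
    ultimately show ?thesis
      using card_permutations3[of "snd p" "l2 p" "l3 p"] by (simp only: card_image S_def Let_def)
  qed
  then show ?thesis
    unfolding D using pe by (intro exI[of _ "\<lambda>z. d * f z"] exI[of _ "\<lambda>z. f z * g z"] conjI ballI) blast+
qed

subsection \<open>Sine expansions of the constant function\<close>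

definition odd_sine :: "(nat \<Rightarrow> real) \<Rightarrow> nat \<Rightarrow> real \<Rightarrow> real"
  where "odd_sine c N x = (\<Sum>m<N. c m * sin (real (2 * m + 1) * x))"

text \<open>The sum is a partial sum of the binomial series of \<open>(1 - cos\<^sup>2 x) powr (- 1 / 2)\<close>, so these sine polynomials
  lie between 0 and 1 on \<open>[0, \<pi>]\<close> and converge to 1 inside.\<close>

definition sine_partial :: "nat \<Rightarrow> real \<Rightarrow> real" where
  "sine_partial n x = sin x * (\<Sum>k<n. pochhammer (1 / 2) k / fact k * (cos x)\<^sup>2 ^ k)"

lemma binomial_half_sums:
  assumes "\<bar>y\<bar> < (1::real)"
  shows "(\<lambda>k. pochhammer (1 / 2) k / fact k * y ^ k) sums (1 - y) powr (- 1 / 2)"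
proof -
  have "(\<lambda>k. (- 1 / 2 gchoose k) * (- y) ^ k) sums (1 + - y) powr (- 1 / 2)"
    using assms by (intro gen_binomial_real) simp
  moreover have "(- 1 / 2 gchoose k) * (- y) ^ k = pochhammer (1 / 2) k / fact k * y ^ k" for k
    by (simp add: gbinomial_pochhammer power_minus[of y] mult_ac flip: power_add mult_2)
  ultimately show ?thesis
    by simp
qed

lemma cos_sq_less_one:
  assumes "0 < x" "x < pi"
  shows "(cos x)\<^sup>2 < 1"
  using sin_gt_zero[OF assms] sin_cos_squared_add[of x] by (smt (verit) zero_less_power)

lemma pochhammer_half_nonneg: "0 \<le> pochhammer (1 / 2 :: real) k"
  by (intro pochhammer_nonneg) simp

lemma sine_partial_bounds:
  assumes "0 \<le> x" "x \<le> pi"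
  shows "0 \<le> sine_partial n x" "sine_partial n x \<le> 1"
proof -
  show "0 \<le> sine_partial n x"
    unfolding sine_partial_def using assms
    by (intro mult_nonneg_nonneg sum_nonneg sin_ge_zero divide_nonneg_nonneg pochhammer_half_nonneg) auto
  show "sine_partial n x \<le> 1"
  proof (cases "0 < x \<and> x < pi")
    case True
    let ?t = "\<lambda>k. pochhammer (1 / 2) k / fact k * (cos x)\<^sup>2 ^ k"
    have s: "?t sums (1 - (cos x)\<^sup>2) powr (- 1 / 2)"
      using cos_sq_less_one True by (intro binomial_half_sums) auto
    have "(\<Sum>k<n. ?t k) \<le> suminf ?t"
      using s by (intro sum_le_suminf) (auto simp: sums_iff intro!: mult_nonneg_nonneg divide_nonneg_nonneg pochhammer_half_nonneg)
    also have "\<dots> = 1 / sin x"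
      using s True sin_gt_zero[of x]
      by (simp add: sums_iff sin_squared_eq[symmetric] powr_minus_divide powr_half_sqrt)
    finally show ?thesis
      using True sin_gt_zero[of x] by (simp add: sine_partial_def field_simps)
  next
    case False
    then have "x = 0 \<or> x = pi" using assms by auto
    then show ?thesis by (auto simp: sine_partial_def)
  qed
qed

lemma sine_partial_limit:
  assumes "0 < x" "x < pi"
  shows "(\<lambda>n. sine_partial n x) \<longlonglongrightarrow> 1"
proof -
  have "(\<lambda>k. pochhammer (1 / 2) k / fact k * (cos x)\<^sup>2 ^ k) sums (1 - (cos x)\<^sup>2) powr (- 1 / 2)"
    using cos_sq_less_one assms by (intro binomial_half_sums) auto
  then have "(\<lambda>n. sine_partial n x) \<longlonglongrightarrow> sin x * (1 - (cos x)\<^sup>2) powr (- 1 / 2)"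
    unfolding sine_partial_def sums_def by (intro tendsto_intros)
  then show ?thesis
    using sin_gt_zero[OF assms] by (simp add: sin_squared_eq[symmetric] powr_minus_divide powr_half_sqrt)
qed

lemma sine_partial_zero: "sine_partial n 0 = 0" "sine_partial n pi = 0"
  by (auto simp: sine_partial_def)

definition is_odd_sine :: "(real \<Rightarrow> real) \<Rightarrow> bool" where
  "is_odd_sine q \<longleftrightarrow> (\<exists>c N. q = odd_sine c N)"

lemma odd_sine_extend:
  assumes "N \<le> N'"
  shows "odd_sine c N = odd_sine (\<lambda>m. if m < N then c m else 0) N'"
  unfolding odd_sine_def using assms by (intro ext sum.mono_neutral_cong_left) auto

lemma is_odd_sine_add:
  assumes "is_odd_sine p" "is_odd_sine q"
  shows "is_odd_sine (\<lambda>x. p x + q x)"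
proof -
  obtain c N d N' where "p = odd_sine c N" "q = odd_sine d N'"
    using assms by (auto simp: is_odd_sine_def)
  then have "p = odd_sine (\<lambda>m. if m < N then c m else 0) (max N N')"
    "q = odd_sine (\<lambda>m. if m < N' then d m else 0) (max N N')"
    using odd_sine_extend[of N "max N N'" c] odd_sine_extend[of N' "max N N'" d] by auto
  then have "(\<lambda>x. p x + q x) = odd_sine (\<lambda>m. (if m < N then c m else 0) + (if m < N' then d m else 0)) (max N N')"
    by (simp add: odd_sine_def fun_eq_iff sum.distrib distrib_right)
  then show ?thesis
    unfolding is_odd_sine_def by blast
qed

lemma is_odd_sine_scale:
  assumes "is_odd_sine p"
  shows "is_odd_sine (\<lambda>x. a * p x)"
proof -
  obtain c N where "p = odd_sine c N"
    using assms by (auto simp: is_odd_sine_def)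
  then have "(\<lambda>x. a * p x) = odd_sine (\<lambda>m. a * c m) N"
    by (simp add: odd_sine_def fun_eq_iff sum_distrib_left mult.assoc)
  then show ?thesis
    unfolding is_odd_sine_def by blast
qed

lemma is_odd_sine_sin: "is_odd_sine (\<lambda>x. sin (real (2 * m + 1) * x))"
proof -
  have "(\<lambda>x. sin (real (2 * m + 1) * x)) = odd_sine (\<lambda>j. of_bool (j = m)) (Suc m)"
    by (simp add: odd_sine_def fun_eq_iff of_bool_def if_distrib[of "\<lambda>a. a * _"] cong: if_cong)
  then show ?thesis
    unfolding is_odd_sine_def by blast
qed

lemma is_odd_sine_zero: "is_odd_sine (\<lambda>x. 0)"
  unfolding is_odd_sine_def by (intro exI[of _ "\<lambda>_. 0"] exI[of _ 0]) (simp add: odd_sine_def fun_eq_iff)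

lemma is_odd_sine_sum:
  assumes "\<And>i. i \<in> A \<Longrightarrow> is_odd_sine (p i)"
  shows "is_odd_sine (\<lambda>x. \<Sum>i\<in>A. p i x)"
  using assms by (induction A rule: infinite_finite_induct) (auto intro: is_odd_sine_zero is_odd_sine_add)

text \<open>By the product-to-sum formula, multiplication by \<open>cos^2\<close> spreads a
  frequency to itself and its two neighbours at distance 2, so odd frequencies stay odd.\<close>

lemma is_odd_sine_cos_sq:
  assumes "is_odd_sine p"
  shows "is_odd_sine (\<lambda>x. (cos x)\<^sup>2 * p x)"
proof -
  have one: "is_odd_sine (\<lambda>x. (cos x)\<^sup>2 * sin (real (2 * m + 1) * x))" for m
  proof -
    \<comment> \<open>For \<open>m = 0\<close> the lower neighbour is the frequency -1, which is
      folded back to 1 with a change of sign.\<close>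
    have "(cos x)\<^sup>2 * sin (real (2 * m + 1) * x) =
        1 / 2 * sin (real (2 * m + 1) * x) + (1 / 4 * sin (real (2 * Suc m + 1) * x) +
        (if m = 0 then - 1 / 4 else 1 / 4) * sin (real (2 * (if m = 0 then 0 else m - 1) + 1) * x))" for x
    proof -
      have c: "(cos x)\<^sup>2 = 1 / 2 + cos (2 * x) / 2"
        unfolding cos_double_cos by (simp add: field_simps)
      let ?u = "real (2 * m + 1) * x"
      have "sin ?u * cos (2 * x) = (sin (?u + 2 * x) + sin (?u - 2 * x)) / 2"
        by (rule sin_times_cos)
      moreover have "?u + 2 * x = real (2 * Suc m + 1) * x"
        by (simp add: algebra_simps)
      moreover have "sin (?u - 2 * x) = (if m = 0 then - 1 else 1) * sin (real (2 * (if m = 0 then 0 else m - 1) + 1) * x)"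
      proof (cases m)
        case (Suc j)
        then have "?u - 2 * x = real (2 * j + 1) * x" by (simp add: algebra_simps)
        then show ?thesis using Suc by simp
      qed simp
      ultimately have prod: "sin ?u * cos (2 * x) = (sin (real (2 * Suc m + 1) * x) +
          (if m = 0 then - 1 else 1) * sin (real (2 * (if m = 0 then 0 else m - 1) + 1) * x)) / 2"
        by (simp only:)
      have real_eq: "(1 / 2 + C / 2) * S = 1 / 2 * S + (1 / 4 * P + e / 4 * Q)" if "S * C = (P + e * Q) / 2" for S C P Q e :: real
      proof -
        have "(1 / 2 + C / 2) * S = 1 / 2 * S + S * C / 2"
          by (simp add: distrib_right)
        then show ?thesis
          unfolding that by (simp add: add_divide_distrib)
      qed
      have "(if m = 0 then - 1 else 1) / 4 = (if m = 0 then - 1 / 4 else 1 / 4 :: real)"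
        by simp
      then show ?thesis
        unfolding c using real_eq[OF prod] by (simp only:)
    qed
    then show ?thesis
      by (simp only:) (intro is_odd_sine_add is_odd_sine_scale is_odd_sine_sin)
  qed
  obtain c N where p: "p = odd_sine c N"
    using assms by (auto simp: is_odd_sine_def)
  have "(\<lambda>x. (cos x)\<^sup>2 * p x) = (\<lambda>x. \<Sum>m<N. c m * ((cos x)\<^sup>2 * sin (real (2 * m + 1) * x)))"
    by (simp add: p odd_sine_def fun_eq_iff sum_distrib_left mult_ac)
  then show ?thesis
    by (simp only:) (intro is_odd_sine_sum is_odd_sine_scale one)
qed

lemma is_odd_sine_partial: "is_odd_sine (sine_partial n)"
proof -
  have "is_odd_sine (\<lambda>x. (cos x)\<^sup>2 ^ k * sin x)" for k
  proof (induction k)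
    case 0
    then show ?case using is_odd_sine_sin[of 0] by simp
  next
    case (Suc k)
    from is_odd_sine_cos_sq[OF this] show ?case by (simp add: mult.assoc)
  qed
  then have "is_odd_sine (\<lambda>x. \<Sum>k<n. pochhammer (1 / 2) k / fact k * ((cos x)\<^sup>2 ^ k * sin x))"
    by (intro is_odd_sine_sum is_odd_sine_scale)
  also have "(\<lambda>x. \<Sum>k<n. pochhammer (1 / 2) k / fact k * ((cos x)\<^sup>2 ^ k * sin x)) = sine_partial n"
    by (simp add: sine_partial_def fun_eq_iff sum_distrib_left mult_ac)
  finally show ?thesis .
qed

section \<open>Sine coefficients by orthogonality\<close>

lemma has_integral_sin_cos_scaled:
  fixes a :: real
  assumes "a \<noteq> 0"
  shows "((\<lambda>x. cos (a * x)) has_integral (sin (a * pi) / a)) {0..pi}"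
    "((\<lambda>x. sin (a * x)) has_integral ((1 - cos (a * pi)) / a)) {0..pi}"
proof -
  have "((\<lambda>x. cos (a * x)) has_integral (sin (a * pi) / a - sin (a * 0) / a)) {0..pi}"
    using assms by (intro fundamental_theorem_of_calculus)
      (auto intro!: derivative_eq_intros simp: has_real_derivative_iff_has_vector_derivative[symmetric])
  then show "((\<lambda>x. cos (a * x)) has_integral (sin (a * pi) / a)) {0..pi}"
    by simp
  have "((\<lambda>x. sin (a * x)) has_integral (- cos (a * pi) / a - (- cos (a * 0) / a))) {0..pi}"
    using assms by (intro fundamental_theorem_of_calculus)
      (auto intro!: derivative_eq_intros simp: has_real_derivative_iff_has_vector_derivative[symmetric])
  then show "((\<lambda>x. sin (a * x)) has_integral ((1 - cos (a * pi)) / a)) {0..pi}"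
    by (simp add: diff_divide_distrib)
qed

lemma sine_orthogonality:
  "((\<lambda>x. sin (real (2 * j + 1) * x) * sin (real (2 * m + 1) * x)) has_integral (if j = m then pi / 2 else 0)) {0..pi}"
proof (cases "j = m")
  case True
  let ?k = "real (2 * m + 1)"
  have "sin (2 * ?k * pi) = 0"
    using sin_npi[of "2 * (2 * m + 1)"] by (simp add: algebra_simps)
  then have "((\<lambda>x. cos (2 * ?k * x)) has_integral 0) {0..pi}"
    using has_integral_sin_cos_scaled(1)[of "2 * ?k"] by simp
  from has_integral_divide[OF has_integral_diff[OF has_integral_const_real[of 1 0 pi] this], of 2]
  have "((\<lambda>x. (1 - cos (2 * ?k * x)) / 2) has_integral pi / 2) {0..pi}"
    by simp
  moreover have "(1 - cos (2 * ?k * x)) / 2 = sin (?k * x) * sin (?k * x)" for x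
    using cos_double_sin[of "?k * x"] by (simp add: power2_eq_square algebra_simps)
  ultimately show ?thesis
    using True by simp
next
  case False
  let ?a = "real_of_int (2 * int j - 2 * int m)" and ?b = "real_of_int (2 * int j + 2 * int m + 2)"
  have ab: "?a \<noteq> 0" "?b \<noteq> 0" using False by auto
  have "sin (?a * pi) = 0" "sin (?b * pi) = 0"
    using sin_zero_iff_int2 by blast+
  then have "((\<lambda>x. cos (?a * x)) has_integral 0) {0..pi}" "((\<lambda>x. cos (?b * x)) has_integral 0) {0..pi}"
    using has_integral_sin_cos_scaled(1)[OF ab(1)] has_integral_sin_cos_scaled(1)[OF ab(2)] by simp_all
  from has_integral_divide[OF has_integral_diff[OF this], of 2]
  have "((\<lambda>x. (cos (?a * x) - cos (?b * x)) / 2) has_integral 0) {0..pi}"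
    by simp
  moreover have "(cos (?a * x) - cos (?b * x)) / 2 = sin (real (2 * j + 1) * x) * sin (real (2 * m + 1) * x)" for x
    by (subst sin_times_sin) (simp add: algebra_simps)
  ultimately show ?thesis
    using False by simp
qed

definition sine_degree :: "nat \<Rightarrow> nat" where
  "sine_degree n = (SOME N. \<exists>c. sine_partial n = odd_sine c N)"

text \<open>The requirement that coefficients vanish from the degree on allows sums to be extended
  to any common range.\<close>

definition sine_coeff :: "nat \<Rightarrow> nat \<Rightarrow> real" where
  "sine_coeff n = (SOME c. sine_partial n = odd_sine (\<lambda>m. c m) (sine_degree n) \<and> (\<forall>m\<ge>sine_degree n. c m = 0))"

lemma sine_partial_expansion: "sine_partial n = odd_sine (sine_coeff n) (sine_degree n)"
  and sine_coeff_zero: "sine_degree n \<le> m \<Longrightarrow> sine_coeff n m = 0"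
proof -
  have "\<exists>N c. sine_partial n = odd_sine c N"
    using is_odd_sine_partial[of n] unfolding is_odd_sine_def by blast
  then have "\<exists>c. sine_partial n = odd_sine c (sine_degree n)"
    unfolding sine_degree_def by (rule someI_ex)
  then obtain c where "sine_partial n = odd_sine c (sine_degree n)" ..
  then have "sine_partial n = odd_sine (\<lambda>m. if m < sine_degree n then c m else 0) (sine_degree n)"
    using odd_sine_extend[of "sine_degree n" "sine_degree n" c] by simp
  then have "\<exists>c. sine_partial n = odd_sine (\<lambda>m. c m) (sine_degree n) \<and> (\<forall>m\<ge>sine_degree n. c m = 0)"
    by (intro exI[of _ "\<lambda>m. if m < sine_degree n then c m else 0"]) auto
  from someI_ex[OF this, folded sine_coeff_def]
  show "sine_partial n = odd_sine (sine_coeff n) (sine_degree n)" "sine_degree n \<le> m \<Longrightarrow> sine_coeff n m = 0"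
    by auto
qed

lemma sine_coeff_integral:
  "((\<lambda>x. sine_partial n x * sin (real (2 * m + 1) * x)) has_integral (pi / 2 * sine_coeff n m)) {0..pi}"
proof -
  have "((\<lambda>x. \<Sum>j<sine_degree n. sine_coeff n j * (sin (real (2 * j + 1) * x) * sin (real (2 * m + 1) * x)))
      has_integral (\<Sum>j<sine_degree n. sine_coeff n j * (if j = m then pi / 2 else 0))) {0..pi}"
    by (intro has_integral_sum has_integral_mult_right sine_orthogonality) auto
  also have "(\<lambda>x. \<Sum>j<sine_degree n. sine_coeff n j * (sin (real (2 * j + 1) * x) * sin (real (2 * m + 1) * x))) =
      (\<lambda>x. sine_partial n x * sin (real (2 * m + 1) * x))"
    unfolding sine_partial_expansion by (simp add: odd_sine_def sum_distrib_right mult.assoc)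
  also have "(\<Sum>j<sine_degree n. sine_coeff n j * (if j = m then pi / 2 else 0)) = pi / 2 * sine_coeff n m"
    using sine_coeff_zero[of n m] by (cases "m < sine_degree n") (auto simp: if_distrib cong: if_cong)
  finally show ?thesis .
qed

text \<open>Because \<open>sine_partial\<close> lies between 0 and 1, the bound is uniform in
  \<open>n\<close>, so tail estimates survive the limit.\<close>

lemma sine_coeff_bound: "\<bar>sine_coeff n m\<bar> \<le> 2"
proof -
  have "norm (pi / 2 * sine_coeff n m) \<le> 1 * Henstock_Kurzweil_Integration.content (cbox 0 pi)"
  proof (rule has_integral_bound)
    show "((\<lambda>x. sine_partial n x * sin (real (2 * m + 1) * x)) has_integral (pi / 2 * sine_coeff n m)) (cbox 0 pi)"
      using sine_coeff_integral by simp
    fix x assume "x \<in> cbox 0 pi"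
    then have "\<bar>sine_partial n x\<bar> * \<bar>sin (real (2 * m + 1) * x)\<bar> \<le> 1 * 1"
      using sine_partial_bounds[of x n] by (intro mult_mono) auto
    then show "norm (sine_partial n x * sin (real (2 * m + 1) * x)) \<le> 1"
      by (simp add: abs_mult)
  qed simp
  then have "pi / 2 * \<bar>sine_coeff n m\<bar> \<le> pi"
    by (simp add: abs_mult)
  then show ?thesis
    by (simp add: field_simps)
qed

text \<open>The limits are the Fourier sine coefficients of the constant 1, by dominated convergence
  in the orthogonality integral.\<close>

lemma sine_coeff_limit: "(\<lambda>n. sine_coeff n m) \<longlonglongrightarrow> 4 / (pi * real (2 * m + 1))"
proof -
  let ?k = "real (2 * m + 1)"
  have "(\<lambda>n. integral {0..pi} (\<lambda>x. sine_partial n x * sin (?k * x))) \<longlonglongrightarrow> integral {0..pi} (\<lambda>x. sin (?k * x))"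
  proof (rule dominated_convergence)
    show "(\<lambda>x. sine_partial n x * sin (?k * x)) integrable_on {0..pi}" for n
      using sine_coeff_integral by blast
    show "norm (sine_partial n x * sin (?k * x)) \<le> 1" if "x \<in> {0..pi}" for n x
      using sine_partial_bounds[of x n] that mult_mono[of "\<bar>sine_partial n x\<bar>" 1 "\<bar>sin (?k * x)\<bar>" 1] by (simp add: abs_mult)
    show "(\<lambda>n. sine_partial n x * sin (?k * x)) \<longlonglongrightarrow> sin (?k * x)" if "x \<in> {0..pi}" for x
    proof (cases "0 < x \<and> x < pi")
      case True
      then show ?thesis
        using tendsto_mult[OF sine_partial_limit[of x] tendsto_const[of "sin (?k * x)"]] by simp
    next
      case False
      then have "x = 0 \<or> x = pi" using that by auto
      moreover have "sin (?k * pi) = 0" by (rule sin_npi)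
      ultimately show ?thesis by auto
    qed
  qed (auto intro: integrable_on_const)
  moreover have "integral {0..pi} (\<lambda>x. sine_partial n x * sin (?k * x)) = pi / 2 * sine_coeff n m" for n
    by (rule integral_unique[OF sine_coeff_integral])
  moreover have "integral {0..pi} (\<lambda>x. sin (?k * x)) = 2 / ?k"
  proof -
    have "((\<lambda>x. sin (?k * x)) has_integral ((1 - cos (?k * pi)) / ?k)) {0..pi}"
      by (rule has_integral_sin_cos_scaled(2)) simp
    moreover have "cos (?k * pi) = - 1"
      using cos_npi[of "2 * m + 1"] by simp
    ultimately have "((\<lambda>x. sin (?k * x)) has_integral 2 / ?k) {0..pi}"
      by simp
    then show ?thesis by (rule integral_unique)
  qed
  ultimately have "(\<lambda>n. pi / 2 * sine_coeff n m) \<longlonglongrightarrow> 2 / ?k"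
    by (simp only:)
  from tendsto_mult[OF tendsto_const[of "2 / pi"] this] show ?thesis
    by simp
qed

section \<open>Heat flow of the sine polynomials\<close>

text \<open>The solution at time \<open>s\<close> of the heat equation on \<open>[0, pi]\<close>
  with zero boundary values and initial value \<open>sine_partial n\<close>.\<close>

definition sine_heat :: "nat \<Rightarrow> real \<Rightarrow> real \<Rightarrow> real" where
  "sine_heat n s x = (\<Sum>m<sine_degree n. sine_coeff n m * exp (- (real (2 * m + 1))\<^sup>2 * s) * sin (real (2 * m + 1) * x))"

text \<open>Sines of odd frequency are symmetric about \<open>pi / 2\<close>; this is why reflected
  points of the rectangle share all moments.\<close>

lemma sine_heat_reflect: "sine_heat n s (pi - x) = sine_heat n s x"
proof -
  have "sin (real (2 * m + 1) * (pi - x)) = sin (real (2 * m + 1) * x)" for m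
  proof -
    have "sin (real (2 * m + 1) * (pi - x)) = sin (real (2 * m + 1) * pi - real (2 * m + 1) * x)"
      by (simp add: algebra_simps)
    also have "\<dots> = sin (real (2 * m + 1) * pi) * cos (real (2 * m + 1) * x) - cos (real (2 * m + 1) * pi) * sin (real (2 * m + 1) * x)"
      by (rule sin_diff)
    finally show ?thesis
      using sin_npi[of "2 * m + 1"] cos_npi[of "2 * m + 1"] by simp
  qed
  then show ?thesis
    by (simp add: sine_heat_def)
qed

text \<open>The squares of odd numbers grow at least linearly,
  \<open>(2 m + 1)^2 \<ge> (2 j + 1)^2 + (m - j)\<close>, so the tail is dominated by a geometric
  series of ratio \<open>exp (- s0)\<close>.\<close>

lemma gaussian_tail:
  assumes "0 < s0" "s0 \<le> s"
  shows "(\<Sum>m=j..<N. exp (- (real (2 * m + 1))\<^sup>2 * s)) \<le> exp (- (real (2 * j + 1))\<^sup>2 * s) / (1 - exp (- s0))"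
proof -
  have "(\<Sum>m=j..<N. exp (- (real (2 * m + 1))\<^sup>2 * s)) \<le> (\<Sum>m=j..<N. exp (- (real (2 * j + 1))\<^sup>2 * s) * exp (- s0) ^ (m - j))"
  proof (rule sum_mono)
    fix m assume m: "m \<in> {j..<N}"
    then obtain i where i: "m = j + i" using le_Suc_ex by auto
    have "(real (2 * j + 1))\<^sup>2 + real i \<le> (real (2 * m + 1))\<^sup>2"
      by (simp add: i power2_eq_square algebra_simps)
    then have "((real (2 * j + 1))\<^sup>2 + real i) * s \<le> (real (2 * m + 1))\<^sup>2 * s"
      using assms by (intro mult_right_mono) auto
    moreover have "real i * s0 \<le> real i * s"
      using assms by (intro mult_left_mono) auto
    ultimately have "- (real (2 * m + 1))\<^sup>2 * s \<le> - (real (2 * j + 1))\<^sup>2 * s + real i * (- s0)"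
      by (simp add: algebra_simps)
    then have "exp (- (real (2 * m + 1))\<^sup>2 * s) \<le> exp (- (real (2 * j + 1))\<^sup>2 * s + real i * (- s0))"
      by simp
    also have "\<dots> = exp (- (real (2 * j + 1))\<^sup>2 * s) * exp (- s0) ^ (m - j)"
      unfolding i by (simp only: exp_add exp_of_nat_mult) simp
    finally show "exp (- (real (2 * m + 1))\<^sup>2 * s) \<le> exp (- (real (2 * j + 1))\<^sup>2 * s) * exp (- s0) ^ (m - j)" .
  qed
  also have "\<dots> = exp (- (real (2 * j + 1))\<^sup>2 * s) * (\<Sum>m=j..<N. exp (- s0) ^ (m - j))"
    by (simp add: sum_distrib_left)
  also have "(\<Sum>m=j..<N. exp (- s0) ^ (m - j)) = (\<Sum>i<N - j. exp (- s0) ^ i)"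
    by (intro sum.reindex_bij_witness[of _ "\<lambda>i. i + j" "\<lambda>m. m - j"]) auto
  also have "(\<Sum>i<N - j. exp (- s0) ^ i) \<le> (\<Sum>i. exp (- s0) ^ i)"
    using assms by (intro sum_le_suminf summable_geometric) auto
  also have "(\<Sum>i. exp (- s0) ^ i) = 1 / (1 - exp (- s0))"
    using assms by (intro suminf_geometric) auto
  finally show ?thesis
    by (simp add: mult_left_mono)
qed

lemma sine_heat_tail:
  assumes "0 < s0" "s0 \<le> s"
  shows "\<bar>sine_heat n s x - (\<Sum>m<j. sine_coeff n m * exp (- (real (2 * m + 1))\<^sup>2 * s) * sin (real (2 * m + 1) * x))\<bar>
    \<le> 2 / (1 - exp (- s0)) * exp (- (real (2 * j + 1))\<^sup>2 * s)"
proof -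
  let ?t = "\<lambda>m. sine_coeff n m * exp (- (real (2 * m + 1))\<^sup>2 * s) * sin (real (2 * m + 1) * x)"
  let ?N = "max j (sine_degree n)"
  have "sine_heat n s x = (\<Sum>m<?N. ?t m)"
    unfolding sine_heat_def by (intro sum.mono_neutral_left) (auto simp: sine_coeff_zero)
  also have "\<dots> = (\<Sum>m<j. ?t m) + (\<Sum>m=j..<?N. ?t m)"
    using sum.atLeastLessThan_concat[of 0 j ?N ?t] by (simp add: lessThan_atLeast0)
  finally have "\<bar>sine_heat n s x - (\<Sum>m<j. ?t m)\<bar> = \<bar>\<Sum>m=j..<?N. ?t m\<bar>"
    by simp
  also have "\<dots> \<le> (\<Sum>m=j..<?N. \<bar>?t m\<bar>)"
    by (rule sum_abs)
  also have "\<dots> \<le> (\<Sum>m=j..<?N. 2 * exp (- (real (2 * m + 1))\<^sup>2 * s))"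
  proof (rule sum_mono)
    fix m
    have "\<bar>sine_coeff n m\<bar> * exp (- (real (2 * m + 1))\<^sup>2 * s) * \<bar>sin (real (2 * m + 1) * x)\<bar> \<le> 2 * exp (- (real (2 * m + 1))\<^sup>2 * s) * 1"
      using sine_coeff_bound by (intro mult_mono) auto
    then show "\<bar>?t m\<bar> \<le> 2 * exp (- (real (2 * m + 1))\<^sup>2 * s)"
      by (simp add: abs_mult)
  qed
  also have "\<dots> = 2 * (\<Sum>m=j..<?N. exp (- (real (2 * m + 1))\<^sup>2 * s))"
    by (simp add: sum_distrib_left)
  also have "\<dots> \<le> 2 * (exp (- (real (2 * j + 1))\<^sup>2 * s) / (1 - exp (- s0)))"
    by (intro mult_left_mono gaussian_tail assms) auto
  finally show ?thesis
    by simp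
qed


section \<open>Moments and leading exponentials\<close>

text \<open>The normalisation of the Erlang density.\<close>

lemma nn_integral_power_exp:
  assumes "0 < l"
  shows "(\<integral>\<^sup>+t. ennreal (indicator {0<..} t * (t ^ k * exp (- l * t))) \<partial>lborel) = ennreal (fact k / l ^ Suc k)"
proof -
  interpret prob_space "density lborel (erlang_density k l)"
    using assms by (rule prob_space_erlang_density)
  have "(\<integral>\<^sup>+t. ennreal (erlang_density k l t) \<partial>lborel) = 1"
    using emeasure_space_1 by (simp add: emeasure_density)
  moreover have "(\<integral>\<^sup>+t. ennreal (indicator {0<..} t * (t ^ k * exp (- l * t))) \<partial>lborel) =
      (\<integral>\<^sup>+t. ennreal (fact k / l ^ Suc k) * ennreal (erlang_density k l t) \<partial>lborel)"
  proof (rule nn_integral_cong_AE)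
    have "AE t in lborel. t \<noteq> (0 :: real)"
      by (rule AE_lborel_singleton)
    then show "AE t in lborel. ennreal (indicator {0<..} t * (t ^ k * exp (- l * t))) =
        ennreal (fact k / l ^ Suc k) * ennreal (erlang_density k l t)"
    proof eventually_elim
      case (elim t)
      then show ?case
        using assms by (auto simp: erlang_density_def indicator_def ennreal_mult[symmetric])
    qed
  qed
  ultimately show ?thesis
    by (simp add: nn_integral_cmult)
qed

lemma integral_power_exp:
  fixes l :: real
  assumes "0 < l"
  shows "integrable lborel (\<lambda>t. indicator {0<..} t * (t ^ k * exp (- l * t)))"
    "(\<integral>t. indicator {0<..} t * (t ^ k * exp (- l * t)) \<partial>lborel) = fact k / l ^ Suc k"
proof -
  have ae: "AE t in (lborel :: real measure). 0 \<le> indicator {0<..} t * (t ^ k * exp (- l * t))"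
    by (intro AE_I2) (auto simp: indicator_def)
  show "integrable lborel (\<lambda>t. indicator {0<..} t * (t ^ k * exp (- l * t)))"
    by (rule integrableI_nn_integral_finite[OF _ ae nn_integral_power_exp[OF assms]]) measurable
  show "(\<integral>t. indicator {0<..} t * (t ^ k * exp (- l * t)) \<partial>lborel) = fact k / l ^ Suc k"
    using assms by (subst integral_eq_nn_integral[OF _ ae]) (measurable, simp only: nn_integral_power_exp, simp)
qed

text \<open>Multiplying by \<open>l0 ^ Suc k\<close> and letting \<open>k\<close> tend to infinity
  isolates \<open>d0\<close>; after that \<open>l1 ^ Suc k\<close> isolates
  \<open>d1\<close>.\<close>

lemma two_exponentials_vanish:
  fixes d0 d1 C l0 l1 l2 :: real
  assumes l: "0 < l0" "l0 < l1" "l1 < l2"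
    and le: "\<And>k. \<bar>d0 / l0 ^ Suc k + d1 / l1 ^ Suc k\<bar> \<le> C / l2 ^ Suc k"
  shows "d0 = 0" "d1 = 0"
proof -
  have geo: "(\<lambda>k. c * (x / y) ^ Suc k) \<longlonglongrightarrow> c * 0" if "0 < x" "x < y" for c x y :: real
    using that by (intro tendsto_intros LIMSEQ_Suc LIMSEQ_realpow_zero) auto
  have 1: "\<bar>d0 + d1 * (l0 / l1) ^ Suc k\<bar> \<le> C * (l0 / l2) ^ Suc k" for k
  proof -
    have "l0 ^ Suc k * \<bar>d0 / l0 ^ Suc k + d1 / l1 ^ Suc k\<bar> \<le> l0 ^ Suc k * (C / l2 ^ Suc k)"
      using l by (intro mult_left_mono le) auto
    also have "l0 ^ Suc k * \<bar>d0 / l0 ^ Suc k + d1 / l1 ^ Suc k\<bar> = \<bar>l0 ^ Suc k * (d0 / l0 ^ Suc k + d1 / l1 ^ Suc k)\<bar>"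
      using l by (simp add: abs_mult)
    also have "l0 ^ Suc k * (d0 / l0 ^ Suc k + d1 / l1 ^ Suc k) = d0 + d1 * (l0 / l1) ^ Suc k"
      using l unfolding distrib_left power_divide by simp
    also have "l0 ^ Suc k * (C / l2 ^ Suc k) = C * (l0 / l2) ^ Suc k"
      unfolding power_divide by simp
    finally show ?thesis .
  qed
  have "(\<lambda>k. \<bar>d0 + d1 * (l0 / l1) ^ Suc k\<bar>) \<longlonglongrightarrow> \<bar>d0 + d1 * 0\<bar>"
    using l by (intro tendsto_intros geo) auto
  then have "\<bar>d0 + d1 * 0\<bar> \<le> C * 0"
    using l 1 by (intro LIMSEQ_le[OF _ geo[of l0 l2 C]]) auto
  then show d0: "d0 = 0" by simp
  have 2: "\<bar>d1\<bar> \<le> C * (l1 / l2) ^ Suc k" for k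
  proof -
    have "l1 ^ Suc k * \<bar>d1 / l1 ^ Suc k\<bar> \<le> l1 ^ Suc k * (C / l2 ^ Suc k)"
      using l le[of k] d0 by (intro mult_left_mono) auto
    also have "l1 ^ Suc k * \<bar>d1 / l1 ^ Suc k\<bar> = \<bar>d1\<bar>"
      using l by (simp add: abs_divide abs_mult)
    also have "l1 ^ Suc k * (C / l2 ^ Suc k) = C * (l1 / l2) ^ Suc k"
      unfolding power_divide by simp
    finally show ?thesis .
  qed
  have "\<bar>d1\<bar> \<le> C * 0"
    using l 2 by (intro LIMSEQ_le_const[OF geo[of l1 l2 C]]) auto
  then show "d1 = 0" by simp
qed

text \<open>One mode is kept in the factor with the larger rate and two in the other. The first
  neglected rates are \<open>9 * \<mu> + \<nu>\<close> and \<open>\<mu> + 25 * \<nu>\<close>, and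
  both exceed \<open>\<mu> + 9 * \<nu>\<close> precisely because \<open>\<nu> < \<mu>\<close>. The
  constants are products of the limiting coefficients \<open>4 / pi\<close> and
  \<open>4 / (3 * pi)\<close>.\<close>

lemma sine_heat_product_asymptotics:
  assumes \<nu>: "0 < \<nu>" "\<nu> < \<mu>"
    and lim: "\<And>t. 0 < t \<Longrightarrow> (\<lambda>n. sine_heat n (\<mu> * t) X * sine_heat n (\<nu> * t) Y) \<longlonglongrightarrow> S t"
    and S: "\<And>t. 0 < t \<Longrightarrow> \<bar>S t\<bar> \<le> 1"
  defines "a0 \<equiv> 16 / pi\<^sup>2 * sin X * sin Y" and "a1 \<equiv> 16 / (3 * pi\<^sup>2) * sin X * sin (3 * Y)"
    and "l2 \<equiv> min (9 * \<mu> + \<nu>) (\<mu> + 25 * \<nu>)"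
  shows "\<exists>C. \<forall>t>0. \<bar>S t - a0 * exp (- (\<mu> + \<nu>) * t) - a1 * exp (- (\<mu> + 9 * \<nu>) * t)\<bar> \<le> C * exp (- l2 * t)"
proof -
  define K where "K = 2 / (1 - exp (- \<nu>))"
  have K: "0 < K" using \<nu> by (simp add: K_def)
  define C where "C = K * K + 2 * K"
  \<comment> \<open>For \<open>t \<ge> 1\<close> both times are at least \<open>\<nu>\<close>, so a
    single geometric constant \<open>K\<close> serves all tails.\<close>
  have big: "\<bar>S t - a0 * exp (- (\<mu> + \<nu>) * t) - a1 * exp (- (\<mu> + 9 * \<nu>) * t)\<bar> \<le> C * exp (- l2 * t)" if t: "1 \<le> t" for t
  proof -
    have s: "\<nu> \<le> \<mu> * t" "\<nu> \<le> \<nu> * t"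
      using \<nu> t mult_mono[of \<nu> \<mu> 1 t] mult_left_mono[OF t, of \<nu>] by auto
    let ?c0 = "\<lambda>n. sine_coeff n 0" and ?c1 = "\<lambda>n. sine_coeff n 1"
    let ?A = "\<lambda>n. sine_heat n (\<mu> * t) X" and ?B = "\<lambda>n. sine_heat n (\<nu> * t) Y"
    let ?p = "\<lambda>n. ?c0 n * exp (- (\<mu> * t)) * sin X"
    let ?q = "\<lambda>n. ?c0 n * exp (- (\<nu> * t)) * sin Y + ?c1 n * exp (- 9 * (\<nu> * t)) * sin (3 * Y)"
    have A: "\<bar>?A n - ?p n\<bar> \<le> K * exp (- 9 * (\<mu> * t))" for n
      using sine_heat_tail[OF \<nu>(1) s(1), of n X 1] by (simp add: K_def)
    have B: "\<bar>?B n - ?q n\<bar> \<le> K * exp (- 25 * (\<nu> * t))" for n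
      using sine_heat_tail[OF \<nu>(1) s(2), of n Y 2] by (simp add: K_def eval_nat_numeral)
    have B0: "\<bar>?B n\<bar> \<le> K * exp (- (\<nu> * t))" for n
      using sine_heat_tail[OF \<nu>(1) s(2), of n Y 0] by (simp add: K_def)
    have e1: "exp (- 9 * (\<mu> * t)) * exp (- (\<nu> * t)) \<le> exp (- l2 * t)"
      and e2: "exp (- (\<mu> * t)) * exp (- 25 * (\<nu> * t)) \<le> exp (- l2 * t)"
    proof -
      have "l2 * t \<le> (9 * \<mu> + \<nu>) * t" "l2 * t \<le> (\<mu> + 25 * \<nu>) * t"
        using t by (auto simp: l2_def intro!: mult_right_mono)
      then show "exp (- 9 * (\<mu> * t)) * exp (- (\<nu> * t)) \<le> exp (- l2 * t)"
        "exp (- (\<mu> * t)) * exp (- 25 * (\<nu> * t)) \<le> exp (- l2 * t)"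
        unfolding exp_add[symmetric] by (auto simp: algebra_simps)
    qed
    have err: "\<bar>?A n * ?B n - ?p n * ?q n\<bar> \<le> C * exp (- l2 * t)" for n
    proof -
      have "?A n * ?B n - ?p n * ?q n = (?A n - ?p n) * ?B n + ?p n * (?B n - ?q n)"
        by (simp add: algebra_simps)
      then have "\<bar>?A n * ?B n - ?p n * ?q n\<bar> \<le> \<bar>?A n - ?p n\<bar> * \<bar>?B n\<bar> + \<bar>?p n\<bar> * \<bar>?B n - ?q n\<bar>"
        by (simp only: abs_mult[symmetric] abs_triangle_ineq)
      also have "\<bar>?A n - ?p n\<bar> * \<bar>?B n\<bar> \<le> (K * exp (- 9 * (\<mu> * t))) * (K * exp (- (\<nu> * t)))"
        using K by (intro mult_mono A B0) auto
      also have "\<dots> = K * K * (exp (- 9 * (\<mu> * t)) * exp (- (\<nu> * t)))" by simp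
      also have "\<dots> \<le> K * K * exp (- l2 * t)"
        using K by (intro mult_left_mono e1) auto
      also have "\<bar>?p n\<bar> * \<bar>?B n - ?q n\<bar> \<le> (2 * exp (- (\<mu> * t)) * 1) * (K * exp (- 25 * (\<nu> * t)))"
        unfolding abs_mult using sine_coeff_bound[of n 0] by (intro mult_mono B) auto
      also have "\<dots> = 2 * K * (exp (- (\<mu> * t)) * exp (- 25 * (\<nu> * t)))" by simp
      also have "\<dots> \<le> 2 * K * exp (- l2 * t)"
        using K by (intro mult_left_mono e2) auto
      finally show ?thesis by (simp add: C_def distrib_right)
    qed
    have c: "?c0 \<longlonglongrightarrow> 4 / pi" "?c1 \<longlonglongrightarrow> 4 / (3 * pi)"
      using sine_coeff_limit[of 0] sine_coeff_limit[of 1] by (simp_all add: mult.commute)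
    have "(\<lambda>n. \<bar>?A n * ?B n - ?p n * ?q n\<bar>) \<longlonglongrightarrow>
        \<bar>S t - (4 / pi * exp (- (\<mu> * t)) * sin X) * (4 / pi * exp (- (\<nu> * t)) * sin Y + 4 / (3 * pi) * exp (- 9 * (\<nu> * t)) * sin (3 * Y))\<bar>"
      using t by (intro tendsto_intros lim c) auto
    then have "\<bar>S t - (4 / pi * exp (- (\<mu> * t)) * sin X) * (4 / pi * exp (- (\<nu> * t)) * sin Y + 4 / (3 * pi) * exp (- 9 * (\<nu> * t)) * sin (3 * Y))\<bar>
        \<le> C * exp (- l2 * t)"
      by (rule LIMSEQ_le_const2) (use err in auto)
    also have "S t - (4 / pi * exp (- (\<mu> * t)) * sin X) * (4 / pi * exp (- (\<nu> * t)) * sin Y + 4 / (3 * pi) * exp (- 9 * (\<nu> * t)) * sin (3 * Y)) =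
        S t - a0 * exp (- (\<mu> + \<nu>) * t) - a1 * exp (- (\<mu> + 9 * \<nu>) * t)"
    proof -
      have "exp (- (\<mu> + \<nu>) * t) = exp (- (\<mu> * t)) * exp (- (\<nu> * t))" "exp (- (\<mu> + 9 * \<nu>) * t) = exp (- (\<mu> * t)) * exp (- 9 * (\<nu> * t))"
        by (simp_all add: algebra_simps flip: exp_add)
      moreover have "(4 / q * e * u) * (4 / q * e' * v + 4 / (3 * q) * e'' * w) =
          16 / q\<^sup>2 * u * v * (e * e') + 16 / (3 * q\<^sup>2) * u * w * (e * e'')" if "q \<noteq> 0" for q e e' e'' u v w :: real
        using that by (simp add: field_simps power2_eq_square)
      ultimately show ?thesis
        unfolding a0_def a1_def by simp
    qed
    finally show ?thesis .
  qed
  \<comment> \<open>Below time 1 every term is bounded, and \<open>exp l2\<close> compensates for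
    the decay of \<open>exp (- l2 * t)\<close>.\<close>
  define C' where "C' = C + (1 + \<bar>a0\<bar> + \<bar>a1\<bar>) * exp l2"
  have l2: "0 < l2" using \<nu> by (auto simp: l2_def)
  have C: "0 \<le> C" using K by (simp add: C_def)
  have "\<bar>S t - a0 * exp (- (\<mu> + \<nu>) * t) - a1 * exp (- (\<mu> + 9 * \<nu>) * t)\<bar> \<le> C' * exp (- l2 * t)" if t: "0 < t" for t
  proof (cases "1 \<le> t")
    case True
    have "C * exp (- l2 * t) \<le> C' * exp (- l2 * t)"
      by (intro mult_right_mono) (auto simp: C'_def)
    then show ?thesis
      using big[OF True] by linarith
  next
    case False
    have "exp (- (\<mu> + \<nu>) * t) \<le> 1" "exp (- (\<mu> + 9 * \<nu>) * t) \<le> 1"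
      using \<nu> t by (auto intro!: mult_nonpos_nonneg)
    then have "\<bar>a0 * exp (- (\<mu> + \<nu>) * t)\<bar> \<le> \<bar>a0\<bar> * 1" "\<bar>a1 * exp (- (\<mu> + 9 * \<nu>) * t)\<bar> \<le> \<bar>a1\<bar> * 1"
      unfolding abs_mult by (intro mult_left_mono; simp)+
    then have "\<bar>S t - a0 * exp (- (\<mu> + \<nu>) * t) - a1 * exp (- (\<mu> + 9 * \<nu>) * t)\<bar> \<le> (1 + \<bar>a0\<bar> + \<bar>a1\<bar>) * 1"
      using S[OF t] unfolding mult_1_right by linarith
    also have "\<dots> \<le> (1 + \<bar>a0\<bar> + \<bar>a1\<bar>) * (exp l2 * exp (- l2 * t))"
    proof (intro mult_left_mono)
      have "0 \<le> l2 * (1 - t)" using l2 False by simp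
      then show "1 \<le> exp l2 * exp (- l2 * t)"
        unfolding exp_add[symmetric] by (simp add: algebra_simps)
    qed simp
    also have "\<dots> \<le> C' * exp (- l2 * t)"
      using C by (simp add: C'_def distrib_right mult.assoc)
    finally show ?thesis .
  qed
  then show ?thesis by blast
qed

text \<open>Integration against \<open>t ^ k\<close> turns \<open>exp (- l * t)\<close> into
  \<open>fact k / l ^ Suc k\<close>, so equal moments force equal leading coefficients. The quotient
  of the two coefficients is a multiple of \<open>sin (3 * Y) / sin Y = 3 - 4 (sin Y)^2\<close>,
  which fixes the positive number \<open>sin Y\<close> and then \<open>sin X\<close>.\<close>

theorem sine_heat_moments_determine:
  assumes \<nu>: "0 < \<nu>" "\<nu> < \<mu>"
    and X: "0 < X" "X < pi" "0 < X'" "X' < pi" and Y: "0 < Y" "Y < pi" "0 < Y'" "Y' < pi"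
    and lim: "\<And>t. 0 < t \<Longrightarrow> (\<lambda>n. sine_heat n (\<mu> * t) X * sine_heat n (\<nu> * t) Y) \<longlonglongrightarrow> S t"
      "\<And>t. 0 < t \<Longrightarrow> (\<lambda>n. sine_heat n (\<mu> * t) X' * sine_heat n (\<nu> * t) Y') \<longlonglongrightarrow> S' t"
    and S: "\<And>t. 0 < t \<Longrightarrow> 0 \<le> S t \<and> S t \<le> 1" "\<And>t. 0 < t \<Longrightarrow> 0 \<le> S' t \<and> S' t \<le> 1"
    and meas [measurable]: "S \<in> borel_measurable borel" "S' \<in> borel_measurable borel"
    and moments: "\<And>k. (\<integral>\<^sup>+t. ennreal (indicator {0<..} t * (t ^ k * S t)) \<partial>lborel) =
      (\<integral>\<^sup>+t. ennreal (indicator {0<..} t * (t ^ k * S' t)) \<partial>lborel)"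
  shows "sin X = sin X' \<and> sin Y = sin Y'"
proof -
  define l0 where "l0 = \<mu> + \<nu>" define l1 where "l1 = \<mu> + 9 * \<nu>"
  define l2 where "l2 = min (9 * \<mu> + \<nu>) (\<mu> + 25 * \<nu>)"
  have l: "0 < l0" "l0 < l1" "l1 < l2" using \<nu> by (auto simp: l0_def l1_def l2_def)
  have single: "\<exists>C. \<forall>t>0. \<bar>S t - a0 * exp (- l0 * t) - a1 * exp (- l1 * t)\<bar> \<le> C * exp (- l2 * t)"
    if "\<And>t. 0 < t \<Longrightarrow> (\<lambda>n. sine_heat n (\<mu> * t) X * sine_heat n (\<nu> * t) Y) \<longlonglongrightarrow> S t"
      "\<And>t. 0 < t \<Longrightarrow> 0 \<le> S t \<and> S t \<le> 1"
      "a0 = 16 / pi\<^sup>2 * sin X * sin Y" "a1 = 16 / (3 * pi\<^sup>2) * sin X * sin (3 * Y)" for S X Y a0 a1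
    unfolding that(3,4) l0_def l1_def l2_def
    using that(2) by (intro sine_heat_product_asymptotics[OF \<nu> that(1)]) auto
  define a0 where "a0 = 16 / pi\<^sup>2 * sin X * sin Y" define a1 where "a1 = 16 / (3 * pi\<^sup>2) * sin X * sin (3 * Y)"
  define b0 where "b0 = 16 / pi\<^sup>2 * sin X' * sin Y'" define b1 where "b1 = 16 / (3 * pi\<^sup>2) * sin X' * sin (3 * Y')"
  obtain C1 where C1: "\<And>t. 0 < t \<Longrightarrow> \<bar>S t - a0 * exp (- l0 * t) - a1 * exp (- l1 * t)\<bar> \<le> C1 * exp (- l2 * t)"
    using single[OF lim(1) S(1) a0_def a1_def] by blast
  obtain C2 where C2: "\<And>t. 0 < t \<Longrightarrow> \<bar>S' t - b0 * exp (- l0 * t) - b1 * exp (- l1 * t)\<bar> \<le> C2 * exp (- l2 * t)"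
    using single[OF lim(2) S(2) b0_def b1_def] by blast
  let ?i = "indicator {0<..} :: real \<Rightarrow> real"
  let ?e = "\<lambda>k l t. ?i t * (t ^ k * exp (- l * t))"
  note pe = integral_power_exp[OF l(1)] integral_power_exp[OF less_trans[OF l(1,2)]] integral_power_exp[OF less_trans[OF less_trans[OF l(1,2)] l(3)]]
  have int: "integrable lborel (\<lambda>t. ?i t * (t ^ k * S t))"
    if [measurable]: "S \<in> borel_measurable borel" and b: "\<And>t. 0 < t \<Longrightarrow> \<bar>S t - a0 * exp (- l0 * t) - a1 * exp (- l1 * t)\<bar> \<le> C * exp (- l2 * t)"
    for S a0 a1 C k
  proof (rule Bochner_Integration.integrable_bound)
    show "integrable lborel (\<lambda>t. \<bar>a0\<bar> * ?e k l0 t + \<bar>a1\<bar> * ?e k l1 t + \<bar>C\<bar> * ?e k l2 t)"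
      using pe by (intro Bochner_Integration.integrable_add integrable_mult_right) auto
    show "AE t in lborel. norm (?i t * (t ^ k * S t)) \<le> norm (\<bar>a0\<bar> * ?e k l0 t + \<bar>a1\<bar> * ?e k l1 t + \<bar>C\<bar> * ?e k l2 t)"
    proof (intro AE_I2)
      fix t :: real
      show "norm (?i t * (t ^ k * S t)) \<le> norm (\<bar>a0\<bar> * ?e k l0 t + \<bar>a1\<bar> * ?e k l1 t + \<bar>C\<bar> * ?e k l2 t)"
      proof (cases "0 < t")
        case True
        have "\<bar>a0 * exp (- l0 * t)\<bar> = \<bar>a0\<bar> * exp (- l0 * t)" "\<bar>a1 * exp (- l1 * t)\<bar> = \<bar>a1\<bar> * exp (- l1 * t)"
          by (simp_all add: abs_mult)
        moreover have "C * exp (- l2 * t) \<le> \<bar>C\<bar> * exp (- l2 * t)"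
          by (intro mult_right_mono) auto
        ultimately have "\<bar>S t\<bar> \<le> \<bar>a0\<bar> * exp (- l0 * t) + \<bar>a1\<bar> * exp (- l1 * t) + \<bar>C\<bar> * exp (- l2 * t)"
          using b[OF True] by linarith
        then have "t ^ k * \<bar>S t\<bar> \<le> t ^ k * (\<bar>a0\<bar> * exp (- l0 * t) + \<bar>a1\<bar> * exp (- l1 * t) + \<bar>C\<bar> * exp (- l2 * t))"
          using True by (intro mult_left_mono) auto
        also have "\<dots> = \<bar>a0\<bar> * ?e k l0 t + \<bar>a1\<bar> * ?e k l1 t + \<bar>C\<bar> * ?e k l2 t"
          using True by (simp add: algebra_simps)
        finally show ?thesis
          using True unfolding real_norm_def by (intro order_trans[OF _ abs_ge_self]) (simp add: abs_mult)
      qed simp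
    qed
  qed measurable
  have intS: "integrable lborel (\<lambda>t. ?i t * (t ^ k * S t))" "integrable lborel (\<lambda>t. ?i t * (t ^ k * S' t))" for k
    using int[OF meas(1) C1] int[OF meas(2) C2] by blast+
  have eq: "(\<integral>t. ?i t * (t ^ k * S t) \<partial>lborel) = (\<integral>t. ?i t * (t ^ k * S' t) \<partial>lborel)" for k
  proof -
    have "AE t in lborel. 0 \<le> ?i t * (t ^ k * S t)" "AE t in lborel. 0 \<le> ?i t * (t ^ k * S' t)"
      using S by (auto intro!: AE_I2 simp: indicator_def)
    then show ?thesis
      using moments[of k] intS[of k] by (simp add: integral_eq_nn_integral)
  qed
  define C where "C = C1 + C2"
  have "\<bar>(a0 - b0) / l0 ^ Suc k + (a1 - b1) / l1 ^ Suc k\<bar> \<le> C / l2 ^ Suc k" for k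
  proof -
    \<comment> \<open>The difference of the leading terms minus the difference of the two functions.
      The latter integrates to 0 by equality of moments, and pointwise \<open>?D\<close> is a
      difference of remainders, hence of order \<open>exp (- l2 * t)\<close>.\<close>
    let ?D = "\<lambda>t. (a0 - b0) * ?e k l0 t + (a1 - b1) * ?e k l1 t - (?i t * (t ^ k * S t) - ?i t * (t ^ k * S' t))"
    have "(\<integral>t. ?D t \<partial>lborel) = (a0 - b0) * (fact k / l0 ^ Suc k) + (a1 - b1) * (fact k / l1 ^ Suc k)"
      using pe intS eq by (simp del: power_Suc)
    moreover have "\<bar>\<integral>t. ?D t \<partial>lborel\<bar> \<le> (\<integral>t. C * ?e k l2 t \<partial>lborel)"
    proof -
      have "\<bar>\<integral>t. ?D t \<partial>lborel\<bar> \<le> (\<integral>t. \<bar>?D t\<bar> \<partial>lborel)"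
        by (rule integral_abs_bound)
      also have "\<dots> \<le> (\<integral>t. C * ?e k l2 t \<partial>lborel)"
      proof (rule integral_mono)
        show "integrable lborel (\<lambda>t. \<bar>?D t\<bar>)"
          using pe intS by (intro integrable_abs Bochner_Integration.integrable_diff Bochner_Integration.integrable_add integrable_mult_right) auto
        show "integrable lborel (\<lambda>t. C * ?e k l2 t)"
          using pe by (intro integrable_mult_right) auto
        fix t :: real
        show "\<bar>?D t\<bar> \<le> C * ?e k l2 t"
        proof (cases "0 < t")
          case True
          let ?r = "S t - a0 * exp (- l0 * t) - a1 * exp (- l1 * t)" and ?r' = "S' t - b0 * exp (- l0 * t) - b1 * exp (- l1 * t)"
          have "?D t = t ^ k * (?r' - ?r)"
            using True by (simp add: algebra_simps)
          then have "\<bar>?D t\<bar> = t ^ k * \<bar>?r' - ?r\<bar>"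
            using True by (simp only: abs_mult) simp
          also have "\<dots> \<le> t ^ k * (C * exp (- l2 * t))"
            using C1[OF True] C2[OF True] True unfolding C_def distrib_right by (intro mult_left_mono) auto
          finally show ?thesis
            using True by (simp add: mult.left_commute)
        qed simp
      qed
      finally show ?thesis .
    qed
    moreover have "(\<integral>t. C * ?e k l2 t \<partial>lborel) = C * (fact k / l2 ^ Suc k)"
      using pe by (simp del: power_Suc)
    moreover have "(a0 - b0) * (fact k / l0 ^ Suc k) + (a1 - b1) * (fact k / l1 ^ Suc k) =
        fact k * ((a0 - b0) / l0 ^ Suc k + (a1 - b1) / l1 ^ Suc k)"
      by (simp add: distrib_left mult.commute)
    ultimately have "fact k * \<bar>(a0 - b0) / l0 ^ Suc k + (a1 - b1) / l1 ^ Suc k\<bar> \<le> fact k * (C / l2 ^ Suc k)"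
      by (simp add: abs_mult mult.commute)
    then show ?thesis
      by (rule mult_left_le_imp_le) simp
  qed
  from two_exponentials_vanish[OF l this] have d: "a0 = b0" "a1 = b1"
    by auto
  have s: "sin X * sin Y = sin X' * sin Y'" "sin X * sin (3 * Y) = sin X' * sin (3 * Y')"
    using d by (auto simp: a0_def b0_def a1_def b1_def)
  have pos: "0 < sin X" "0 < sin Y" "0 < sin X'" "0 < sin Y'"
    using X Y by (auto intro: sin_gt_zero)
  have triple: "sin (3 * y) = sin y * (3 - 4 * (sin y)\<^sup>2)" for y :: real
  proof -
    have "sin (3 * y) = sin (2 * y + y)" by simp
    also have "\<dots> = 2 * sin y * (cos y)\<^sup>2 + (1 - 2 * (sin y)\<^sup>2) * sin y"
      unfolding sin_add sin_double cos_double_sin by (simp add: power2_eq_square)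
    also have "\<dots> = sin y * (3 - 4 * (sin y)\<^sup>2)"
      unfolding cos_squared_eq by (simp add: algebra_simps)
    finally show ?thesis .
  qed
  have "(sin X' * sin Y') * (3 - 4 * (sin Y)\<^sup>2) = (sin X' * sin Y') * (3 - 4 * (sin Y')\<^sup>2)"
    using s(2) unfolding triple mult.assoc[symmetric] s(1) .
  then have "(sin Y)\<^sup>2 = (sin Y')\<^sup>2"
    using pos by simp
  then have "sin Y = sin Y'"
    using pos by (simp add: power2_eq_iff)
  then show ?thesis
    using s(1) pos by simp
qed

subsection \<open>The rectangle\<close>

lemma open_rectangular_domain: "open (rectangular_domain a b)"
proof -
  have "rectangular_domain a b = {0<..<a} \<times> {0<..<b}"
    by (auto simp: rectangular_domain_def)
  then show ?thesis by (simp add: open_Times)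
qed

lemma rectangular_domain_neq_UNIV: "rectangular_domain a b \<noteq> UNIV"
  by (auto simp: rectangular_domain_def set_eq_iff intro!: exI[of _ 0])

text \<open>The layer-cake formula for one value, which may be infinite like the exit time of a path
  that never leaves. In that case a finite value \<open>s\<close> of the integral would give
  \<open>(s + 1) ^ Suc k \<le> s\<close>.\<close>

lemma nn_integral_power_upto:
  "(\<integral>\<^sup>+t. ennreal (indicator {0<..} t * (real (Suc k) * t ^ k)) * indicator {t. ennreal t < e} t \<partial>lborel) = e ^ Suc k"
proof -
  have fin: "(\<integral>\<^sup>+t. ennreal (real (Suc k) * t ^ k) * indicator {0..r} t \<partial>lborel) = ennreal (r ^ Suc k)" if "0 \<le> r" for r
    using that by (subst nn_integral_FTC_Icc[where F = "\<lambda>t. t ^ Suc k"])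
      (auto intro!: derivative_eq_intros simp del: power_Suc)
  have ae: "AE t in lborel. ennreal (indicator {0<..} t * (real (Suc k) * t ^ k)) * indicator {t. ennreal t < ennreal r} t =
      ennreal (real (Suc k) * t ^ k) * indicator {0..r} t" if "0 \<le> r" for r
  proof -
    have "AE t in lborel. t \<noteq> 0 \<and> t \<noteq> r"
      using AE_lborel_singleton[of 0] AE_lborel_singleton[of r] by eventually_elim auto
    then show ?thesis
    proof eventually_elim
      case (elim t)
      then show ?case
        using that by (auto simp: indicator_def ennreal_less_iff)
    qed
  qed
  show ?thesis
  proof (cases e)
    case (real r)
    then show ?thesis
      using nn_integral_cong_AE[OF ae[of r]] fin[of r] by (simp add: ennreal_power del: power_Suc)
  next
    case top
    have le: "ennreal (r ^ Suc k) \<le> (\<integral>\<^sup>+t. ennreal (indicator {0<..} t * (real (Suc k) * t ^ k)) * indicator {t. ennreal t < e} t \<partial>lborel)"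
      if "0 \<le> r" for r
      unfolding fin[OF that, symmetric] nn_integral_cong_AE[OF ae[OF that], symmetric]
      by (intro nn_integral_mono mult_left_mono) (auto simp: indicator_def top)
    have "(\<integral>\<^sup>+t. ennreal (indicator {0<..} t * (real (Suc k) * t ^ k)) * indicator {t. ennreal t < e} t \<partial>lborel) = top"
      (is "?I = top")
    proof (cases ?I)
      case (real s)
      have "ennreal ((s + 1) ^ Suc k) \<le> ennreal s"
        using le[of "s + 1"] real by (simp only: add_nonneg_nonneg zero_le_one)
      then have "(s + 1) ^ Suc k \<le> s"
        using real(1) by (subst (asm) ennreal_le_iff) auto
      moreover have "s + 1 \<le> (s + 1) ^ Suc k"
        using real(1) by (intro self_le_power) auto
      ultimately show ?thesis by linarith
    qed
    then show ?thesis
      using top by simp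
  qed
qed

text \<open>A limit of explicit sine sums, free of \<open>M\<close> and \<open>B\<close>, so that
  the final count can depend on the values \<open>c\<close> alone.\<close>

definition survival :: "real \<Rightarrow> real \<Rightarrow> real \<times> real \<Rightarrow> real \<Rightarrow> real" where
  "survival a b p t = lim (\<lambda>n. sine_heat n (pi\<^sup>2 / a\<^sup>2 * t) (pi * fst p / a) * sine_heat n (pi\<^sup>2 / b\<^sup>2 * t) (pi * snd p / b))"

context planar_brownian_motion
begin

lemma exit_time_prob_measurable:
  assumes D: "open D" "D \<noteq> UNIV"
  shows "(\<lambda>t. prob {\<omega> \<in> space M. ennreal t < exit_time D (started_at p B) \<omega>}) \<in> borel_measurable borel"
proof -
  note [measurable] = exit_time_measurable[OF D, of p]
  have "mono (\<lambda>t. - prob {\<omega> \<in> space M. ennreal t < exit_time D (started_at p B) \<omega>})"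
    by (intro monoI) (auto intro!: finite_measure_mono elim: le_less_trans[OF ennreal_leI])
  then have "(\<lambda>t. - prob {\<omega> \<in> space M. ennreal t < exit_time D (started_at p B) \<omega>}) \<in> borel_measurable borel"
    by (rule borel_measurable_mono)
  then show ?thesis
    by (subst borel_measurable_uminus_eq[symmetric])
qed

lemma exit_moment_layer_cake:
  assumes D: "open D" "D \<noteq> UNIV"
  shows "exit_moment M B D (Suc k) p = ennreal (real (Suc k)) *
    (\<integral>\<^sup>+t. ennreal (indicator {0<..} t * (t ^ k * prob {\<omega> \<in> space M. ennreal t < exit_time D (started_at p B) \<omega>})) \<partial>lborel)"
proof -
  let ?e = "exit_time D (started_at p B)"
  let ?w = "\<lambda>t. ennreal (indicator {0<..} t * (real (Suc k) * t ^ k))"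
  interpret pair_sigma_finite lborel M ..
  note [measurable] = exit_time_measurable[OF D, of p]
  have "exit_moment M B D (Suc k) p = (\<integral>\<^sup>+\<omega>. \<integral>\<^sup>+t. ?w t * indicator {t. ennreal t < ?e \<omega>} t \<partial>lborel \<partial>M)"
    unfolding exit_moment_def nn_integral_power_upto ..
  also have "\<dots> = (\<integral>\<^sup>+\<omega>. \<integral>\<^sup>+t. ?w t * indicator {x \<in> space (lborel \<Otimes>\<^sub>M M). ennreal (fst x) < ?e (snd x)} (t, \<omega>) \<partial>lborel \<partial>M)"
    by (intro nn_integral_cong) (auto simp: indicator_def space_pair_measure)
  also have "\<dots> = (\<integral>\<^sup>+t. \<integral>\<^sup>+\<omega>. ?w t * indicator {x \<in> space (lborel \<Otimes>\<^sub>M M). ennreal (fst x) < ?e (snd x)} (t, \<omega>) \<partial>M \<partial>lborel)"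
    by (rule Fubini') measurable
  also have "\<dots> = (\<integral>\<^sup>+t. ennreal (real (Suc k)) * ennreal (indicator {0<..} t * (t ^ k * prob {\<omega> \<in> space M. ennreal t < ?e \<omega>})) \<partial>lborel)"
  proof (rule nn_integral_cong)
    fix t :: real
    have "(\<integral>\<^sup>+\<omega>. ?w t * indicator {x \<in> space (lborel \<Otimes>\<^sub>M M). ennreal (fst x) < ?e (snd x)} (t, \<omega>) \<partial>M) =
        (\<integral>\<^sup>+\<omega>. ?w t * indicator {\<omega> \<in> space M. ennreal t < ?e \<omega>} \<omega> \<partial>M)"
      by (intro nn_integral_cong) (auto simp: indicator_def space_pair_measure)
    also have "\<dots> = ?w t * emeasure M {\<omega> \<in> space M. ennreal t < ?e \<omega>}"
      by (rule nn_integral_cmult_indicator) measurable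
    also have "\<dots> = ennreal (real (Suc k)) * ennreal (indicator {0<..} t * (t ^ k * prob {\<omega> \<in> space M. ennreal t < ?e \<omega>}))"
      by (cases "0 < t") (auto simp: emeasure_eq_measure ennreal_mult[symmetric] mult.assoc simp del: of_nat_Suc)
    finally show "(\<integral>\<^sup>+\<omega>. ?w t * indicator {x \<in> space (lborel \<Otimes>\<^sub>M M). ennreal (fst x) < ?e (snd x)} (t, \<omega>) \<partial>M) =
        ennreal (real (Suc k)) * ennreal (indicator {0<..} t * (t ^ k * prob {\<omega> \<in> space M. ennreal t < ?e \<omega>}))" .
  qed
  also have "\<dots> = ennreal (real (Suc k)) * (\<integral>\<^sup>+t. ennreal (indicator {0<..} t * (t ^ k * prob {\<omega> \<in> space M. ennreal t < ?e \<omega>})) \<partial>lborel)"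
  proof (rule nn_integral_cmult)
    have "(\<lambda>t. prob {\<omega> \<in> space M. ennreal t < ?e \<omega>}) \<in> borel_measurable borel"
      by (rule exit_time_prob_measurable[OF D])
    then show "(\<lambda>t. ennreal (indicator {0<..} t * (t ^ k * prob {\<omega> \<in> space M. ennreal t < ?e \<omega>}))) \<in> borel_measurable lborel"
      by measurable
  qed
  finally show ?thesis .
qed

lemma le_exit_time_iff: "t \<le> real K \<Longrightarrow> 0 \<le> t \<Longrightarrow> ennreal t \<le> exit_time D (started_at p B) \<omega> \<longleftrightarrow> t \<le> exit_upto K D p \<omega>"
proof -
  assume t: "t \<le> real K" "0 \<le> t"
  have "t \<le> exit_upto K D p \<omega> \<longleftrightarrow> ennreal t \<le> ennreal (exit_upto K D p \<omega>)"
    using t exit_upto_bounds(1) by (simp add: ennreal_le_iff)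
  then show ?thesis
    using t by (simp add: ennreal_exit_upto ennreal_leI)
qed

lemma path_in_closure:
  assumes "open D" "p \<in> D" "closed E" "D \<subseteq> E" "\<omega> \<in> space M"
    and t: "0 \<le> t" "ennreal t \<le> exit_time D (started_at p B) \<omega>"
  shows "started_at p B t \<omega> \<in> E"
proof -
  obtain K :: nat where K: "t \<le> real K" using real_arch_simple by blast
  have "t \<le> exit_upto K D p \<omega>"
    using t K by (simp add: le_exit_time_iff)
  then consider "t < exit_upto K D p \<omega>" | "t = exit_upto K D p \<omega>" by linarith
  then show ?thesis
  proof cases
    case 1
    then show ?thesis using before_exit_upto[OF t(1) 1] assms by auto
  next
    case 2
    then show ?thesis using at_exit_closed[OF assms(1-5)] by simp
  qed
qed

lemma path_at_exit_time:
  assumes D: "open D" "\<omega> \<in> space M" and t: "0 \<le> t" "exit_time D (started_at p B) \<omega> = ennreal t"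
  shows "started_at p B t \<omega> \<notin> D"
proof -
  obtain K :: nat where K: "t < real K" using reals_Archimedean2 by blast
  then have e: "exit_upto K D p \<omega> = t"
    using t by (intro exit_upto_eq) auto
  show ?thesis
    using at_exit_upto(1)[OF D, of K p] K unfolding e by simp
qed

lemma path_before_exit_time:
  assumes t: "0 \<le> t" "ennreal t < exit_time D (started_at p B) \<omega>"
  shows "started_at p B t \<omega> \<in> D"
proof (rule ccontr)
  assume "started_at p B t \<omega> \<notin> D"
  then have "exit_time D (started_at p B) \<omega> \<le> ennreal t"
    unfolding exit_time_def using t(1) by (intro INF_lower) auto
  then show False using t(2) by simp
qed

text \<open>Optional stopping at \<open>min t T\<close> for the truncated exit \<open>T\<close>: a
  path that left before \<open>t\<close> is stopped where \<open>\<phi>\<close> vanishes, so only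
  the survivors contribute and the factor \<open>exp (l * t)\<close> comes out. The non-strict
  inequality is harmless, because at an exit exactly at time \<open>t\<close> the value of
  \<open>\<phi>\<close> is 0 as well.\<close>

lemma killed_expectation:
  assumes D: "open D" "D \<noteq> UNIV" and p: "p \<in> D" and E: "closed E" "D \<subseteq> E"
    and f: "caloric (\<lambda>t z. exp (l * t) * \<phi> z)" and zero: "\<And>z. z \<in> E \<Longrightarrow> z \<notin> D \<Longrightarrow> \<phi> z = 0"
    and t: "0 \<le> t"
  shows "(\<integral>\<omega>. of_bool (ennreal t \<le> exit_time D (started_at p B) \<omega>) * \<phi> (started_at p B t \<omega>) \<partial>M) = exp (- l * t) * \<phi> p"
proof -
  obtain K :: nat where K: "t \<le> real K" using real_arch_simple by blast
  let ?T = "exit_upto K D p" and ?e = "exit_time D (started_at p B)"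
  let ?\<theta> = "\<lambda>\<omega>. min t (?T \<omega>)"
  have "stopping K UNIV p ?\<theta>"
    by (rule stopping_exit_min[OF D t K])
  then have "(\<integral>\<omega>. exp (l * ?\<theta> \<omega>) * \<phi> (started_at p B (?\<theta> \<omega>) \<omega>) \<partial>M) = exp (l * 0) * \<phi> p"
    using f unfolding stopping_def by blast
  moreover have "exp (l * ?\<theta> \<omega>) * \<phi> (started_at p B (?\<theta> \<omega>) \<omega>) = exp (l * t) * (of_bool (ennreal t \<le> ?e \<omega>) * \<phi> (started_at p B t \<omega>))"
    if \<omega>: "\<omega> \<in> space M" for \<omega>
  proof (cases "t \<le> ?T \<omega>")
    case True
    then show ?thesis using le_exit_time_iff[OF K t, of D p \<omega>] by (simp add: min_absorb1)
  next
    case False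
    then have "?T \<omega> < real K" using K by linarith
    from at_exit_upto(1)[OF D(1) \<omega> this] have "\<phi> (started_at p B (?T \<omega>) \<omega>) = 0"
      by (intro zero at_exit_closed[OF D(1) p E \<omega>])
    then show ?thesis using False le_exit_time_iff[OF K t, of D p \<omega>] by (simp add: min_absorb2)
  qed
  ultimately have "(\<integral>\<omega>. exp (l * t) * (of_bool (ennreal t \<le> ?e \<omega>) * \<phi> (started_at p B t \<omega>)) \<partial>M) = \<phi> p"
    by (subst (asm) Bochner_Integration.integral_cong[OF refl]) auto
  then have "exp (l * t) * (\<integral>\<omega>. of_bool (ennreal t \<le> ?e \<omega>) * \<phi> (started_at p B t \<omega>) \<partial>M) = \<phi> p"
    by simp
  then show ?thesis
    by (auto simp: exp_minus field_simps)
qed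

text \<open>By linearity \<open>killed_expectation\<close> expresses the mean of the sine polynomial
  \<open>Q n\<close> over surviving paths as a product of two \<open>sine_heat\<close> values. As
  \<open>n\<close> grows, \<open>Q n\<close> tends to 1 inside the rectangle, while it is 0 on the
  boundary and bounded by 1 throughout.\<close>

lemma survival_probability:
  assumes ab: "0 < a" "0 < b" and p: "p \<in> rectangular_domain a b" and t: "0 < t"
  shows "(\<lambda>n. sine_heat n (pi\<^sup>2 / a\<^sup>2 * t) (pi * fst p / a) * sine_heat n (pi\<^sup>2 / b\<^sup>2 * t) (pi * snd p / b))
      \<longlonglongrightarrow> prob {\<omega> \<in> space M. ennreal t < exit_time (rectangular_domain a b) (started_at p B) \<omega>}"
proof -
  let ?D = "rectangular_domain a b" and ?E = "{0..a} \<times> {0..b}"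
  let ?e = "exit_time ?D (started_at p B)" and ?X = "started_at p B t"
  note D = open_rectangular_domain[of a b] rectangular_domain_neq_UNIV[of a b]
  have E: "closed ?E" "?D \<subseteq> ?E"
    by (auto simp: rectangular_domain_def intro: closed_Times)
  note [measurable] = exit_time_measurable[OF D, of p] measurable_start[OF less_imp_le[OF t], of p]
  define \<phi> where "\<phi> m l z = sin (real (2 * m + 1) * (pi * fst z / a)) * sin (real (2 * l + 1) * (pi * snd z / b))" for m l and z :: "real \<times> real"
  define Q where "Q n z = sine_partial n (pi * fst z / a) * sine_partial n (pi * snd z / b)" for n and z :: "real \<times> real"
  have edge: "fst z = 0 \<or> fst z = a \<or> snd z = 0 \<or> snd z = b" if "z \<in> ?E" "z \<notin> ?D" for z
    using that by (cases z) (auto simp: rectangular_domain_def)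
  have npi: "sin (real (2 * m + 1) * pi) = 0" for m
    by (rule sin_npi)
  have \<phi>0: "\<phi> m l z = 0" if "z \<in> ?E" "z \<notin> ?D" for m l z
    using edge[OF that] npi[of m] npi[of l] ab unfolding \<phi>_def by (elim disjE) (simp_all del: of_nat_Suc of_nat_add of_nat_mult)
  have Q0: "Q n z = 0" if "z \<in> ?E" "z \<notin> ?D" for n z
    using edge[OF that] ab unfolding Q_def by (elim disjE) (simp_all add: sine_partial_zero)
  let ?l = "\<lambda>m l. (real (2 * m + 1))\<^sup>2 * (pi\<^sup>2 / a\<^sup>2) + (real (2 * l + 1))\<^sup>2 * (pi\<^sup>2 / b\<^sup>2)"
  have cal: "caloric (\<lambda>t z. exp (?l m l * t) * \<phi> m l z)" for m l
  proof -
    have "caloric (\<lambda>t (x, y). (exp ((real (2 * m + 1) * pi / a)\<^sup>2 * t) * sin (real (2 * m + 1) * pi / a * x)) *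
        (exp ((real (2 * l + 1) * pi / b)\<^sup>2 * t) * sin (real (2 * l + 1) * pi / b * y)))"
      by (intro caloric_prod caloric1_sin)
    also have "(\<lambda>t (x, y). (exp ((real (2 * m + 1) * pi / a)\<^sup>2 * t) * sin (real (2 * m + 1) * pi / a * x)) *
        (exp ((real (2 * l + 1) * pi / b)\<^sup>2 * t) * sin (real (2 * l + 1) * pi / b * y))) = (\<lambda>t z. exp (?l m l * t) * \<phi> m l z)"
      unfolding \<phi>_def distrib_right exp_add
      by (simp add: fun_eq_iff power_mult_distrib power_divide mult_ac)
    finally show ?thesis .
  qed
  have \<phi>m [measurable]: "\<phi> m l \<in> borel_measurable borel" for m l
    unfolding \<phi>_def[abs_def] by (intro borel_measurable_continuous_onI continuous_intros) (use ab in auto)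
  have i: "integrable M (\<lambda>\<omega>. of_bool (ennreal t \<le> ?e \<omega>) * \<phi> m l (?X \<omega>))" for m l
  proof (rule integrable_const_bound[where B = 1])
    have "\<bar>\<phi> m l z\<bar> \<le> 1 * 1" for z
      unfolding \<phi>_def abs_mult by (intro mult_mono) auto
    then show "AE \<omega> in M. norm (of_bool (ennreal t \<le> ?e \<omega>) * \<phi> m l (?X \<omega>)) \<le> 1"
      by (intro AE_I2) (auto simp: of_bool_def)
  qed measurable
  have Q_sum: "Q n z = (\<Sum>m<sine_degree n. \<Sum>l<sine_degree n. sine_coeff n m * sine_coeff n l * \<phi> m l z)" for n z
    unfolding Q_def sine_partial_expansion odd_sine_def \<phi>_def sum_product by (simp add: mult_ac)
  have EQ: "(\<integral>\<omega>. of_bool (ennreal t \<le> ?e \<omega>) * Q n (?X \<omega>) \<partial>M) =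
      sine_heat n (pi\<^sup>2 / a\<^sup>2 * t) (pi * fst p / a) * sine_heat n (pi\<^sup>2 / b\<^sup>2 * t) (pi * snd p / b)" for n
  proof -
    have "(\<integral>\<omega>. of_bool (ennreal t \<le> ?e \<omega>) * Q n (?X \<omega>) \<partial>M) =
        (\<integral>\<omega>. (\<Sum>m<sine_degree n. \<Sum>l<sine_degree n. sine_coeff n m * sine_coeff n l * (of_bool (ennreal t \<le> ?e \<omega>) * \<phi> m l (?X \<omega>))) \<partial>M)"
      unfolding Q_sum sum_distrib_left by (simp add: mult_ac)
    also have "\<dots> = (\<Sum>m<sine_degree n. \<Sum>l<sine_degree n. sine_coeff n m * sine_coeff n l * (\<integral>\<omega>. of_bool (ennreal t \<le> ?e \<omega>) * \<phi> m l (?X \<omega>) \<partial>M))"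
      using i by (simp add: Bochner_Integration.integral_sum)
    also have "\<dots> = (\<Sum>m<sine_degree n. \<Sum>l<sine_degree n. sine_coeff n m * sine_coeff n l * (exp (- ?l m l * t) * \<phi> m l p))"
      using killed_expectation[OF D p E cal \<phi>0 less_imp_le[OF t]] by simp
    also have "\<dots> = sine_heat n (pi\<^sup>2 / a\<^sup>2 * t) (pi * fst p / a) * sine_heat n (pi\<^sup>2 / b\<^sup>2 * t) (pi * snd p / b)"
      unfolding sine_heat_def sum_product
    proof (intro sum.cong refl)
      fix m l
      have "exp (- ?l m l * t) = exp (- (real (2 * m + 1))\<^sup>2 * (pi\<^sup>2 / a\<^sup>2 * t)) * exp (- (real (2 * l + 1))\<^sup>2 * (pi\<^sup>2 / b\<^sup>2 * t))"
        unfolding exp_add[symmetric] by (simp add: algebra_simps)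
      then show "sine_coeff n m * sine_coeff n l * (exp (- ?l m l * t) * \<phi> m l p) =
          sine_coeff n m * exp (- (real (2 * m + 1))\<^sup>2 * (pi\<^sup>2 / a\<^sup>2 * t)) * sin (real (2 * m + 1) * (pi * fst p / a)) *
          (sine_coeff n l * exp (- (real (2 * l + 1))\<^sup>2 * (pi\<^sup>2 / b\<^sup>2 * t)) * sin (real (2 * l + 1) * (pi * snd p / b)))"
        unfolding \<phi>_def by (simp only: mult_ac)
    qed
    finally show ?thesis .
  qed
  have Qm [measurable]: "Q n \<in> borel_measurable borel" for n
    unfolding Q_sum[abs_def] by measurable
  have inE: "?X \<omega> \<in> ?E" if "\<omega> \<in> space M" "ennreal t \<le> ?e \<omega>" for \<omega>
    using path_in_closure[OF D(1) p E that(1) less_imp_le[OF t] that(2)] .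
  have "(\<lambda>n. \<integral>\<omega>. of_bool (ennreal t \<le> ?e \<omega>) * Q n (?X \<omega>) \<partial>M) \<longlonglongrightarrow> (\<integral>\<omega>. indicator {\<omega> \<in> space M. ennreal t < ?e \<omega>} \<omega> \<partial>M)"
  proof (rule integral_dominated_convergence[where w = "\<lambda>_. 1"])
    show "AE \<omega> in M. norm (of_bool (ennreal t \<le> ?e \<omega>) * Q n (?X \<omega>)) \<le> 1" for n
    proof (intro AE_I2)
      fix \<omega> assume \<omega>: "\<omega> \<in> space M"
      have "\<bar>Q n (?X \<omega>)\<bar> \<le> 1 * 1" if "ennreal t \<le> ?e \<omega>"
      proof -
        have "0 \<le> pi * fst (?X \<omega>) / a" "pi * fst (?X \<omega>) / a \<le> pi" "0 \<le> pi * snd (?X \<omega>) / b" "pi * snd (?X \<omega>) / b \<le> pi"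
          using inE[OF \<omega> that] ab by (auto simp: mem_Times_iff field_simps)
        then show ?thesis
          unfolding Q_def abs_mult using sine_partial_bounds by (intro mult_mono) (auto simp: abs_of_nonneg)
      qed
      then show "norm (of_bool (ennreal t \<le> ?e \<omega>) * Q n (?X \<omega>)) \<le> 1"
        by (auto simp: of_bool_def)
    qed
    show "AE \<omega> in M. (\<lambda>n. of_bool (ennreal t \<le> ?e \<omega>) * Q n (?X \<omega>)) \<longlonglongrightarrow> indicator {\<omega> \<in> space M. ennreal t < ?e \<omega>} \<omega>"
    proof (intro AE_I2)
      fix \<omega> assume \<omega>: "\<omega> \<in> space M"
      consider "ennreal t < ?e \<omega>" | "?e \<omega> = ennreal t" | "\<not> ennreal t \<le> ?e \<omega>"
        by (metis order_le_less)
      then show "(\<lambda>n. of_bool (ennreal t \<le> ?e \<omega>) * Q n (?X \<omega>)) \<longlonglongrightarrow> indicator {\<omega> \<in> space M. ennreal t < ?e \<omega>} \<omega>"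
      proof cases
        case 1
        then have "?X \<omega> \<in> ?D" using t by (intro path_before_exit_time) auto
        then have "0 < pi * fst (?X \<omega>) / a" "pi * fst (?X \<omega>) / a < pi" "0 < pi * snd (?X \<omega>) / b" "pi * snd (?X \<omega>) / b < pi"
          using ab by (auto simp: rectangular_domain_def case_prod_unfold field_simps)
        then have "(\<lambda>n. Q n (?X \<omega>)) \<longlonglongrightarrow> 1 * 1"
          unfolding Q_def by (intro tendsto_mult sine_partial_limit)
        then show ?thesis
          using 1 \<omega> by (simp add: less_imp_le)
      next
        case 2
        \<comment> \<open>An exit exactly at \<open>t\<close> lies on the boundary, where all
          \<open>Q n\<close> vanish; this turns the non-strict condition under the integral into the
          strict one in the limit.\<close>
        then have "?X \<omega> \<notin> ?D" using t \<omega> by (intro path_at_exit_time[OF D(1)]) auto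
        then have "Q n (?X \<omega>) = 0" for n
          using inE[OF \<omega>] 2 by (intro Q0) auto
        then show ?thesis using 2 by simp
      next
        case 3
        then show ?thesis by (auto simp: indicator_def)
      qed
    qed
  qed (auto)
  then show ?thesis
    unfolding EQ by simp
qed

lemma rectangle_survival:
  assumes "0 < a" "0 < b" "p \<in> rectangular_domain a b" "0 < t"
  shows "prob {\<omega> \<in> space M. ennreal t < exit_time (rectangular_domain a b) (started_at p B) \<omega>} = survival a b p t"
  unfolding survival_def using limI[OF survival_probability[OF assms]] by simp

lemma rectangle_exit_moment:
  assumes "0 < a" "0 < b" "p \<in> rectangular_domain a b"
  shows "exit_moment M B (rectangular_domain a b) (Suc k) p =
    ennreal (real (Suc k)) * (\<integral>\<^sup>+t. ennreal (indicator {0<..} t * (t ^ k * survival a b p t)) \<partial>lborel)"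
  unfolding exit_moment_layer_cake[OF open_rectangular_domain rectangular_domain_neq_UNIV]
  using rectangle_survival[OF assms]
  by (intro arg_cong2[where f = "(*)"] refl nn_integral_cong) (auto simp: indicator_def)

lemma rectangle_moments_determine:
  assumes ab: "0 < a" "0 < b" "a \<noteq> b" and p: "p \<in> rectangular_domain a b" and q: "q \<in> rectangular_domain a b"
    and eq: "\<And>k. exit_moment M B (rectangular_domain a b) (Suc k) p = exit_moment M B (rectangular_domain a b) (Suc k) q"
  shows "sin (pi * fst p / a) = sin (pi * fst q / a) \<and> sin (pi * snd p / b) = sin (pi * snd q / b)"
proof -
  note D = open_rectangular_domain[of a b] rectangular_domain_neq_UNIV[of a b]
  let ?S = "\<lambda>p t. prob {\<omega> \<in> space M. ennreal t < exit_time (rectangular_domain a b) (started_at p B) \<omega>}"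
  have m: "(\<integral>\<^sup>+t. ennreal (indicator {0<..} t * (t ^ k * ?S p t)) \<partial>lborel) = (\<integral>\<^sup>+t. ennreal (indicator {0<..} t * (t ^ k * ?S q t)) \<partial>lborel)" for k
    using eq[of k] unfolding exit_moment_layer_cake[OF D]
    by (subst (asm) ennreal_mult_cancel_left) (auto simp del: of_nat_Suc)
  have r: "0 < pi * fst p / a" "pi * fst p / a < pi" "0 < pi * snd p / b" "pi * snd p / b < pi"
    if "p \<in> rectangular_domain a b" for p
    using that ab by (auto simp: rectangular_domain_def case_prod_unfold field_simps)
  \<comment> \<open>The longer side has the smaller rate \<open>\<nu>\<close>, so its coordinate
    plays the role of \<open>Y\<close>.\<close>
  consider "a < b" | "b < a" using ab by linarith
  then show ?thesis
  proof cases
    case 1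
    have "pi\<^sup>2 / b\<^sup>2 < pi\<^sup>2 / a\<^sup>2"
      using 1 ab by (intro divide_strict_left_mono power_strict_mono) auto
    then show ?thesis
      using sine_heat_moments_determine[OF _ _ r(1,2)[OF p] r(1,2)[OF q] r(3,4)[OF p] r(3,4)[OF q],
          of "pi\<^sup>2 / b\<^sup>2" "pi\<^sup>2 / a\<^sup>2" "?S p" "?S q"]
        survival_probability[OF ab(1,2) p] survival_probability[OF ab(1,2) q] m exit_time_prob_measurable[OF D] ab
      by simp
  next
    case 2
    have "pi\<^sup>2 / a\<^sup>2 < pi\<^sup>2 / b\<^sup>2"
      using 2 ab by (intro divide_strict_left_mono power_strict_mono) auto
    then show ?thesis
      using sine_heat_moments_determine[OF _ _ r(3,4)[OF p] r(3,4)[OF q] r(1,2)[OF p] r(1,2)[OF q],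
          of "pi\<^sup>2 / a\<^sup>2" "pi\<^sup>2 / b\<^sup>2" "?S p" "?S q"]
        survival_probability[OF ab(1,2) p] survival_probability[OF ab(1,2) q] m exit_time_prob_measurable[OF D] ab
      by (simp add: mult.commute)
  qed
qed

end

section \<open>Counting the common points in the rectangle\<close>

text \<open>Folding at \<open>pi / 2\<close> moves both points into the range where
  \<open>sin\<close> is injective.\<close>

lemma sin_eq_imp_reflection:
  assumes "sin x = sin y" "0 < x" "x < pi" "0 < y" "y < pi"
  shows "x = y \<or> x = pi - y"
proof -
  define u where "u z = (if z \<le> pi / 2 then z else pi - z)" for z
  have u: "sin (u z) = sin z" for z by (simp add: u_def)
  have b: "- (pi / 2) \<le> u z" "u z \<le> pi / 2" if "0 < z" "z < pi" for z
    using that by (auto simp: u_def)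
  have "u x = u y"
    by (rule sin_inj_pi[OF b[OF assms(2,3)] b[OF assms(4,5)]]) (simp only: u assms(1))
  then show ?thesis by (auto simp: u_def split: if_splits)
qed

lemma survival_reflect:
  assumes ab: "0 < a" "0 < b" and q: "fst q \<in> {fst p, a - fst p}" "snd q \<in> {snd p, b - snd p}"
  shows "survival a b q = survival a b p"
proof -
  have "pi * fst q / a \<in> {pi * fst p / a, pi - pi * fst p / a}" "pi * snd q / b \<in> {pi * snd p / b, pi - pi * snd p / b}"
    using ab q by (auto simp: field_simps)
  then have "sine_heat n s (pi * fst q / a) = sine_heat n s (pi * fst p / a)" "sine_heat n s (pi * snd q / b) = sine_heat n s (pi * snd p / b)" for n s
    by (auto simp: sine_heat_reflect)
  then show ?thesis
    unfolding survival_def[abs_def] by simp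
qed

lemma rectangular_levels:
  assumes ab: "0 < a" "0 < b" "a \<noteq> b"
  shows "\<exists>N :: (nat \<Rightarrow> real) \<Rightarrow> nat. \<forall>(M :: 'w measure) B c.
        planar_brownian_motion M B \<and> (\<forall>k\<ge>1. c k > 0) \<and>
        (\<Inter>k\<in>{1..}. level_curve M B (rectangular_domain a b) k (c k)) \<noteq> {} \<longrightarrow>
        card (\<Inter>k\<in>{1..}. level_curve M B (rectangular_domain a b) k (c k)) = N c \<and> N c \<in> {1, 2, 4}"
proof -
  let ?D = "rectangular_domain a b"
  \<comment> \<open>\<open>V p k\<close> is the moment of order \<open>Suc k\<close> in terms of
    \<open>survival\<close>, with the index shifted because moments start at order 1.\<close>
  define V where "V p k = ennreal (real (Suc k)) * (\<integral>\<^sup>+t. ennreal (indicator {0<..} t * (t ^ k * survival a b p t)) \<partial>lborel)" for p k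
  define L where "L c = {p \<in> ?D. \<forall>k. V p k = ennreal (c (Suc k))}" for c :: "nat \<Rightarrow> real"
  show ?thesis
  proof (intro exI[of _ "\<lambda>c. card (L c)"] allI impI)
    fix M :: "'w measure" and B c
    assume *: "planar_brownian_motion M B \<and> (\<forall>k\<ge>1. c k > 0) \<and> (\<Inter>k\<in>{1..}. level_curve M B ?D k (c k)) \<noteq> {}"
    then interpret planar_brownian_motion M B by blast
    have mom: "exit_moment M B ?D (Suc k) p = V p k" if "p \<in> ?D" for p k
      unfolding V_def using rectangle_exit_moment[OF ab(1,2) that] .
    have L: "(\<Inter>k\<in>{1..}. level_curve M B ?D k (c k)) = L c"
    proof (rule set_eqI)
      fix p
      have "p \<in> (\<Inter>k\<in>{1..}. level_curve M B ?D k (c k)) \<longleftrightarrow> (\<forall>k. p \<in> level_curve M B ?D (Suc k) (c (Suc k)))"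
        by (auto simp: Suc_le_eq gr0_conv_Suc)
      also have "\<dots> \<longleftrightarrow> p \<in> L c"
        by (auto simp: level_curve_def L_def mom)
      finally show "p \<in> (\<Inter>k\<in>{1..}. level_curve M B ?D k (c k)) \<longleftrightarrow> p \<in> L c" .
    qed
    then obtain p where p: "p \<in> L c" using * by auto
    then have pD: "p \<in> ?D" by (simp add: L_def)
    \<comment> \<open>Each coordinate has two candidates, which coincide exactly on the
      corresponding symmetry axis; hence 1, 2 or 4 points.\<close>
    have "L c = {fst p, a - fst p} \<times> {snd p, b - snd p}" (is "_ = ?R")
    proof (rule set_eqI, rule iffI)
      fix q assume q: "q \<in> L c"
      then have qD: "q \<in> ?D" by (simp add: L_def)
      have "exit_moment M B ?D (Suc k) q = exit_moment M B ?D (Suc k) p" for k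
        using p q by (simp add: mom L_def)
      then have s: "sin (pi * fst q / a) = sin (pi * fst p / a)" "sin (pi * snd q / b) = sin (pi * snd p / b)"
        using rectangle_moments_determine[OF ab qD pD] by auto
      have r: "0 < pi * fst p / a" "pi * fst p / a < pi" "0 < pi * snd p / b" "pi * snd p / b < pi" if "p \<in> ?D" for p
        using that ab by (auto simp: rectangular_domain_def case_prod_unfold field_simps)
      have 1: "pi * fst q / a = pi * fst p / a \<or> pi * fst q / a = pi - pi * fst p / a"
        by (rule sin_eq_imp_reflection[OF s(1) r(1,2)[OF qD] r(1,2)[OF pD]])
      have 2: "pi * snd q / b = pi * snd p / b \<or> pi * snd q / b = pi - pi * snd p / b"
        by (rule sin_eq_imp_reflection[OF s(2) r(3,4)[OF qD] r(3,4)[OF pD]])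
      have 3: "x = y \<or> x = d - y" if "pi * x / d = pi * y / d \<or> pi * x / d = pi - pi * y / d" "0 < d" for x y d :: real
        using that(1)
      proof
        assume "pi * x / d = pi - pi * y / d"
        then have "pi * x / d = pi * (d - y) / d"
          using that(2) by (simp add: right_diff_distrib diff_divide_distrib)
        then show ?thesis using that(2) by simp
      qed (use that(2) in simp)
      show "q \<in> ?R"
        using 3[OF 1 ab(1)] 3[OF 2 ab(2)] by (auto simp: prod_eq_iff)
    next
      fix q assume q: "q \<in> ?R"
      then have "survival a b q = survival a b p"
        using ab by (intro survival_reflect) (auto simp: mem_Times_iff)
      moreover have "q \<in> ?D"
        using q pD by (auto simp: rectangular_domain_def)
      ultimately show "q \<in> L c"
        using p by (simp add: L_def V_def)
    qed
    moreover have "card {x, y :: real} \<in> {1, 2}" for x y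
      by (cases "x = y") auto
    then have "card {fst p, a - fst p} * card {snd p, b - snd p} \<in> {1, 2, 4}"
    proof -
      have "m * n \<in> {1, 2, 4}" if "m \<in> {1, 2}" "n \<in> {1, 2}" for m n :: nat
        using that by auto
      then show ?thesis
        using \<open>\<And>x y. card {x, y :: real} \<in> {1, 2}\<close> by blast
    qed
    ultimately show "card (\<Inter>k\<in>{1..}. level_curve M B ?D k (c k)) = card (L c) \<and> card (L c) \<in> {1, 2, 4}"
      unfolding L by (simp only: card_cartesian_product)
  qed
qed

theorem theorem1:
  shows "
    (\<forall>a b :: real. a > 0 \<and> b > 0 \<and> a \<noteq> b \<longrightarrow>
      (\<exists>N :: real \<Rightarrow> real \<Rightarrow> nat. \<forall>(M :: 'w measure) B c\<^sub>1 c\<^sub>2.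
        planar_brownian_motion M B \<and> c\<^sub>1 > 0 \<and> c\<^sub>2 > 0 \<and>
        level_curve M B (elliptic_domain a b) 1 c\<^sub>1 \<inter> level_curve M B (elliptic_domain a b) 2 c\<^sub>2 \<noteq> {} \<longrightarrow>
        card (level_curve M B (elliptic_domain a b) 1 c\<^sub>1 \<inter> level_curve M B (elliptic_domain a b) 2 c\<^sub>2) = N c\<^sub>1 c\<^sub>2 \<and>
        N c\<^sub>1 c\<^sub>2 \<in> {4, 2, 1})) \<and>
    (\<forall>D. (\<exists>c>0. D = parabolic_domain c) \<or>
         (\<exists>a>0. \<exists>b>0. a > (1 + sqrt 2) * b \<and> D = hyperbolic_domain a b) \<or>
         (\<exists>\<alpha>>0. \<alpha> < pi / 4 \<and> D = wedge_domain \<alpha>) \<longrightarrow>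
      (\<exists>N :: real \<Rightarrow> real \<Rightarrow> nat. \<forall>(M :: 'w measure) B c\<^sub>1 c\<^sub>2.
        planar_brownian_motion M B \<and> c\<^sub>1 > 0 \<and> c\<^sub>2 > 0 \<and>
        level_curve M B D 1 c\<^sub>1 \<inter> level_curve M B D 2 c\<^sub>2 \<noteq> {} \<longrightarrow>
        card (level_curve M B D 1 c\<^sub>1 \<inter> level_curve M B D 2 c\<^sub>2) = N c\<^sub>1 c\<^sub>2 \<and>
        N c\<^sub>1 c\<^sub>2 \<in> {2, 1})) \<and>
    (\<forall>b :: real. b > 0 \<longrightarrow>
      (\<exists>N :: real \<Rightarrow> real \<Rightarrow> nat. \<forall>(M :: 'w measure) B c\<^sub>1 c\<^sub>2.
        planar_brownian_motion M B \<and> c\<^sub>1 > 0 \<and> c\<^sub>2 > 0 \<and>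
        level_curve M B (triangular_domain b) 1 c\<^sub>1 \<inter> level_curve M B (triangular_domain b) 2 c\<^sub>2 \<noteq> {} \<longrightarrow>
        card (level_curve M B (triangular_domain b) 1 c\<^sub>1 \<inter> level_curve M B (triangular_domain b) 2 c\<^sub>2) = N c\<^sub>1 c\<^sub>2 \<and>
        N c\<^sub>1 c\<^sub>2 \<in> {6, 3, 1})) \<and>
    (\<forall>a b :: real. a > 0 \<and> b > 0 \<and> a \<noteq> b \<longrightarrow>
      (\<exists>N :: (nat \<Rightarrow> real) \<Rightarrow> nat. \<forall>(M :: 'w measure) B c.
        planar_brownian_motion M B \<and> (\<forall>k\<ge>1. c k > 0) \<and>
        (\<Inter>k\<in>{1..}. level_curve M B (rectangular_domain a b) k (c k)) \<noteq> {} \<longrightarrow>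
        card (\<Inter>k\<in>{1..}. level_curve M B (rectangular_domain a b) k (c k)) = N c \<and>
        N c \<in> {1, 2, 4}))"
proof (intro conjI allI impI)
  fix a b :: real assume "a > 0 \<and> b > 0 \<and> a \<noteq> b"
  then obtain u1 u2 where "polynomial_exit (elliptic_domain a b) u1 u2"
    "\<forall>p\<in>elliptic_domain a b. card {q \<in> elliptic_domain a b. u1 q = u1 p \<and> u2 q = u2 p} \<in> {4, 2, 1}"
    using elliptic_levels by blast
  then show "\<exists>N :: real \<Rightarrow> real \<Rightarrow> nat. \<forall>(M :: 'w measure) B c\<^sub>1 c\<^sub>2.
        planar_brownian_motion M B \<and> c\<^sub>1 > 0 \<and> c\<^sub>2 > 0 \<and>
        level_curve M B (elliptic_domain a b) 1 c\<^sub>1 \<inter> level_curve M B (elliptic_domain a b) 2 c\<^sub>2 \<noteq> {} \<longrightarrow>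
        card (level_curve M B (elliptic_domain a b) 1 c\<^sub>1 \<inter> level_curve M B (elliptic_domain a b) 2 c\<^sub>2) = N c\<^sub>1 c\<^sub>2 \<and>
        N c\<^sub>1 c\<^sub>2 \<in> {4, 2, 1}"
    by (intro level_curves_card) blast+
next
  fix D assume "(\<exists>c>0. D = parabolic_domain c) \<or>
         (\<exists>a>0. \<exists>b>0. a > (1 + sqrt 2) * b \<and> D = hyperbolic_domain a b) \<or>
         (\<exists>\<alpha>>0. \<alpha> < pi / 4 \<and> D = wedge_domain \<alpha>)"
  then obtain u1 u2 where "polynomial_exit D u1 u2"
    "\<forall>p\<in>D. card {q \<in> D. u1 q = u1 p \<and> u2 q = u2 p} \<in> {2, 1}"
  proof (elim disjE exE conjE)
    fix c :: real assume "0 < c" "D = parabolic_domain c"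
    then show thesis using that parabolic_levels[of c] by blast
  next
    fix a b :: real assume "0 < a" "0 < b" "(1 + sqrt 2) * b < a" "D = hyperbolic_domain a b"
    then show thesis using that hyperbolic_levels[of a b] by blast
  next
    fix \<alpha> :: real assume "0 < \<alpha>" "\<alpha> < pi / 4" "D = wedge_domain \<alpha>"
    then show thesis using that wedge_levels[of \<alpha>] by blast
  qed
  then show "\<exists>N :: real \<Rightarrow> real \<Rightarrow> nat. \<forall>(M :: 'w measure) B c\<^sub>1 c\<^sub>2.
        planar_brownian_motion M B \<and> c\<^sub>1 > 0 \<and> c\<^sub>2 > 0 \<and>
        level_curve M B D 1 c\<^sub>1 \<inter> level_curve M B D 2 c\<^sub>2 \<noteq> {} \<longrightarrow>
        card (level_curve M B D 1 c\<^sub>1 \<inter> level_curve M B D 2 c\<^sub>2) = N c\<^sub>1 c\<^sub>2 \<and>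
        N c\<^sub>1 c\<^sub>2 \<in> {2, 1}"
    by (intro level_curves_card) blast+
next
  fix b :: real assume "b > 0"
  then obtain u1 u2 where "polynomial_exit (triangular_domain b) u1 u2"
    "\<forall>p\<in>triangular_domain b. card {q \<in> triangular_domain b. u1 q = u1 p \<and> u2 q = u2 p} \<in> {6, 3, 1}"
    using triangular_levels by blast
  then show "\<exists>N :: real \<Rightarrow> real \<Rightarrow> nat. \<forall>(M :: 'w measure) B c\<^sub>1 c\<^sub>2.
        planar_brownian_motion M B \<and> c\<^sub>1 > 0 \<and> c\<^sub>2 > 0 \<and>
        level_curve M B (triangular_domain b) 1 c\<^sub>1 \<inter> level_curve M B (triangular_domain b) 2 c\<^sub>2 \<noteq> {} \<longrightarrow>
        card (level_curve M B (triangular_domain b) 1 c\<^sub>1 \<inter> level_curve M B (triangular_domain b) 2 c\<^sub>2) = N c\<^sub>1 c\<^sub>2 \<and>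
        N c\<^sub>1 c\<^sub>2 \<in> {6, 3, 1}"
    by (intro level_curves_card) blast+
next
  fix a b :: real assume "a > 0 \<and> b > 0 \<and> a \<noteq> b"
  then show "\<exists>N :: (nat \<Rightarrow> real) \<Rightarrow> nat. \<forall>(M :: 'w measure) B c.
        planar_brownian_motion M B \<and> (\<forall>k\<ge>1. c k > 0) \<and>
        (\<Inter>k\<in>{1..}. level_curve M B (rectangular_domain a b) k (c k)) \<noteq> {} \<longrightarrow>
        card (\<Inter>k\<in>{1..}. level_curve M B (rectangular_domain a b) k (c k)) = N c \<and>
        N c \<in> {1, 2, 4}"
    using rectangular_levels[of a b] by blast
qed

end
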